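(* Let $U\supseteq\mathrm{PA}$ be an arbitrary theory in a countable language $\mathcal L$ extending $\mathcal L_{\mathrm{PA}}$. The following conditions are equivalent: 1. $U$ imposes $\mathcal L_{\mathrm{PA}}$-recursive saturation. 2. $U$ semantically defines $\mathrm{RSAT}(\mathcal L_{\mathrm{PA}})$ modulo $\mathcal L_{\mathrm{PA}}$.
   Context: $\mathcal L_{\mathrm{PA}}=\{0,1,+,\times,<\}$; $U$ need not contain induction for its full language. $U$ imposes $\mathcal L_{\mathrm{PA}}$-recursive saturation if for every $\mathcal M\models U$ the reduct $\mathcal M\restriction_{\mathcal L_{\mathrm{PA}}}$ is recursively saturated. $\mathrm{RSAT}(\mathcal L_{\mathrm{PA}})$ is the theory in $\mathcal L_{\mathrm{PA}}\cup\{R\}$, $R$ a fresh ternary predicate, extending $\mathrm{PA}$ (without induction for formulae containing $R$) with the universal closures (over $y_1,\dots,y_k$) of the following axioms, for all $k,n\in\omega$ and all $p$ coding a total primitive recursive function $i\mapsto\phi^p_i(y_1,\dots,y_k,x)$ with values $\mathcal L_{\mathrm{PA}}$-formulae: (OP) $\exists x\bigwedge_{i=1}^n\phi^p_i(y_1,\dots,y_k,x)\rightarrow\forall x\bigl(R(\underline p,x,\langle y_1,\dots,y_k\rangle)\rightarrow\bigwedge_{i=1}^n\phi^p_i(y_1,\dots,y_k,x)\bigr)$; (NE) $\exists x\,R(\underline p,x,\langle y_1,\dots,y_k\rangle)$. Here $\underline p$ is the numeral of (the Gödel code) $p$ and $\langle y_1,\dots,y_k\rangle$ is the arithmetical code of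 the sequence. $U$ semantically defines $V$ (in $\mathcal L_{\mathrm{PA}}\cup\{R\}$) modulo $\mathcal L_{\mathrm{PA}}$ if for every $\mathcal M\models U$ there is a formula $\theta$ of the language of $U$, with parameters from $\mathcal M$, such that $\mathcal M\models\Phi[\theta/R]$ for every axiom $\Phi$ of $V$ (the $\mathcal L_{\mathrm{PA}}$-symbols being left unchanged). *)

theory Defs
  imports "HOL-Library.Nat_Bijection" "HOL-Library.Countable_Set"
begin

section \<open>First-order languages extending the language of arithmetic\<close>

text \<open>
  The symbols \<open>0, 1, +, \<times>, <\<close> are constructors of the syntax, so every language below extends
  the language of arithmetic. A language is given by its further function and relation symbols with
  their arities. Variables are de Bruijn indices.
\<close>

datatype 'f tm =
  Var nat | Zero | One | Add "'f tm" "'f tm" | Mul "'f tm" "'f tm" | Fun 'f "'f tm list"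

datatype ('f, 'r) fm =
  FF
| Eq "'f tm" "'f tm"
| Less "'f tm" "'f tm"
| Rel 'r "'f tm list"
| Imp "('f, 'r) fm" "('f, 'r) fm"
| Forall "('f, 'r) fm"

abbreviation Neg :: "('f, 'r) fm \<Rightarrow> ('f, 'r) fm" where
  "Neg \<phi> \<equiv> Imp \<phi> FF"

abbreviation Conj :: "('f, 'r) fm \<Rightarrow> ('f, 'r) fm \<Rightarrow> ('f, 'r) fm" where
  "Conj \<phi> \<psi> \<equiv> Neg (Imp \<phi> (Neg \<psi>))"

abbreviation Iff :: "('f, 'r) fm \<Rightarrow> ('f, 'r) fm \<Rightarrow> ('f, 'r) fm" where
  "Iff \<phi> \<psi> \<equiv> Conj (Imp \<phi> \<psi>) (Imp \<psi> \<phi>)"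

abbreviation Exists :: "('f, 'r) fm \<Rightarrow> ('f, 'r) fm" where
  "Exists \<phi> \<equiv> Neg (Forall (Neg \<phi>))"

definition Conjs :: "('f, 'r) fm list \<Rightarrow> ('f, 'r) fm" where
  "Conjs \<phi>s = foldr Conj \<phi>s (Neg FF)"

record ('f, 'r) lang =
  Fsyms :: "('f \<times> nat) set"
  Rsyms :: "('r \<times> nat) set"

definition LPA :: "('f, 'r) lang" where
  "LPA = \<lparr>Fsyms = {}, Rsyms = {}\<rparr>"

definition countable_lang :: "('f, 'r) lang \<Rightarrow> bool" where
  "countable_lang L \<longleftrightarrow> countable (Fsyms L) \<and> countable (Rsyms L)"

primrec tm_in :: "('f, 'r) lang \<Rightarrow> 'f tm \<Rightarrow> bool" where
  "tm_in L (Var i) \<longleftrightarrow> True"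
| "tm_in L Zero \<longleftrightarrow> True"
| "tm_in L One \<longleftrightarrow> True"
| "tm_in L (Add s t) \<longleftrightarrow> tm_in L s \<and> tm_in L t"
| "tm_in L (Mul s t) \<longleftrightarrow> tm_in L s \<and> tm_in L t"
| "tm_in L (Fun f ts) \<longleftrightarrow> (f, length ts) \<in> Fsyms L \<and> list_all (tm_in L) ts"

primrec fm_in :: "('f, 'r) lang \<Rightarrow> ('f, 'r) fm \<Rightarrow> bool" where
  "fm_in L FF \<longleftrightarrow> True"
| "fm_in L (Eq s t) \<longleftrightarrow> tm_in L s \<and> tm_in L t"
| "fm_in L (Less s t) \<longleftrightarrow> tm_in L s \<and> tm_in L t"
| "fm_in L (Rel r ts) \<longleftrightarrow> (r, length ts) \<in> Rsyms L \<and> list_all (tm_in L) ts"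
| "fm_in L (Imp \<phi> \<psi>) \<longleftrightarrow> fm_in L \<phi> \<and> fm_in L \<psi>"
| "fm_in L (Forall \<phi>) \<longleftrightarrow> fm_in L \<phi>"

primrec fv_tm :: "'f tm \<Rightarrow> nat set" where
  "fv_tm (Var i) = {i}"
| "fv_tm Zero = {}"
| "fv_tm One = {}"
| "fv_tm (Add s t) = fv_tm s \<union> fv_tm t"
| "fv_tm (Mul s t) = fv_tm s \<union> fv_tm t"
| "fv_tm (Fun f ts) = \<Union> (set (map fv_tm ts))"

primrec fv :: "('f, 'r) fm \<Rightarrow> nat set" where
  "fv FF = {}"
| "fv (Eq s t) = fv_tm s \<union> fv_tm t"
| "fv (Less s t) = fv_tm s \<union> fv_tm t"
| "fv (Rel r ts) = \<Union> (set (map fv_tm ts))"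
| "fv (Imp \<phi> \<psi>) = fv \<phi> \<union> fv \<psi>"
| "fv (Forall \<phi>) = {i. Suc i \<in> fv \<phi>}"

definition theory_in :: "('f, 'r) lang \<Rightarrow> ('f, 'r) fm set \<Rightarrow> bool" where
  "theory_in L T \<longleftrightarrow> (\<forall>\<phi>\<in>T. fm_in L \<phi> \<and> fv \<phi> = {})"

primrec subst_tm :: "(nat \<Rightarrow> 'f tm) \<Rightarrow> 'f tm \<Rightarrow> 'f tm" where
  "subst_tm \<sigma> (Var i) = \<sigma> i"
| "subst_tm \<sigma> Zero = Zero"
| "subst_tm \<sigma> One = One"
| "subst_tm \<sigma> (Add s t) = Add (subst_tm \<sigma> s) (subst_tm \<sigma> t)"
| "subst_tm \<sigma> (Mul s t) = Mul (subst_tm \<sigma> s) (subst_tm \<sigma> t)"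
| "subst_tm \<sigma> (Fun f ts) = Fun f (map (subst_tm \<sigma>) ts)"

definition lift_tm :: "'f tm \<Rightarrow> 'f tm" where
  "lift_tm = subst_tm (\<lambda>i. Var (Suc i))"

primrec subst :: "(nat \<Rightarrow> 'f tm) \<Rightarrow> ('f, 'r) fm \<Rightarrow> ('f, 'r) fm" where
  "subst \<sigma> FF = FF"
| "subst \<sigma> (Eq s t) = Eq (subst_tm \<sigma> s) (subst_tm \<sigma> t)"
| "subst \<sigma> (Less s t) = Less (subst_tm \<sigma> s) (subst_tm \<sigma> t)"
| "subst \<sigma> (Rel r ts) = Rel r (map (subst_tm \<sigma>) ts)"
| "subst \<sigma> (Imp \<phi> \<psi>) = Imp (subst \<sigma> \<phi>) (subst \<sigma> \<psi>)"
| "subst \<sigma> (Forall \<phi>) = Forall (subst (case_nat (Var 0) (\<lambda>i. lift_tm (\<sigma> i))) \<phi>)"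


section \<open>Structures\<close>

record ('f, 'r, 'm) struc =
  Dom :: "'m set"
  zeroI :: 'm
  oneI :: 'm
  addI :: "'m \<Rightarrow> 'm \<Rightarrow> 'm"
  mulI :: "'m \<Rightarrow> 'm \<Rightarrow> 'm"
  lessI :: "'m \<Rightarrow> 'm \<Rightarrow> bool"
  funI :: "'f \<Rightarrow> 'm list \<Rightarrow> 'm"
  relI :: "'r \<Rightarrow> 'm list \<Rightarrow> bool"

definition structure_for :: "('f, 'r) lang \<Rightarrow> ('f, 'r, 'm) struc \<Rightarrow> bool" where
  "structure_for L M \<longleftrightarrow>
     zeroI M \<in> Dom M \<and> oneI M \<in> Dom M \<and>
     (\<forall>a\<in>Dom M. \<forall>b\<in>Dom M. addI M a b \<in> Dom M \<and> mulI M a b \<in> Dom M) \<and>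
     (\<forall>(f, n)\<in>Fsyms L. \<forall>as. length as = n \<and> set as \<subseteq> Dom M \<longrightarrow> funI M f as \<in> Dom M)"

primrec eval :: "('f, 'r, 'm) struc \<Rightarrow> (nat \<Rightarrow> 'm) \<Rightarrow> 'f tm \<Rightarrow> 'm" where
  "eval M e (Var i) = e i"
| "eval M e Zero = zeroI M"
| "eval M e One = oneI M"
| "eval M e (Add s t) = addI M (eval M e s) (eval M e t)"
| "eval M e (Mul s t) = mulI M (eval M e s) (eval M e t)"
| "eval M e (Fun f ts) = funI M f (map (eval M e) ts)"

primrec sat :: "('f, 'r, 'm) struc \<Rightarrow> (nat \<Rightarrow> 'm) \<Rightarrow> ('f, 'r) fm \<Rightarrow> bool" where
  "sat M e FF \<longleftrightarrow> False"
| "sat M e (Eq s t) \<longleftrightarrow> eval M e s = eval M e t"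
| "sat M e (Less s t) \<longleftrightarrow> lessI M (eval M e s) (eval M e t)"
| "sat M e (Rel r ts) \<longleftrightarrow> relI M r (map (eval M e) ts)"
| "sat M e (Imp \<phi> \<psi>) \<longleftrightarrow> (sat M e \<phi> \<longrightarrow> sat M e \<psi>)"
| "sat M e (Forall \<phi>) \<longleftrightarrow> (\<forall>a\<in>Dom M. sat M (case_nat a e) \<phi>)"

definition models :: "('f, 'r) lang \<Rightarrow> ('f, 'r, 'm) struc \<Rightarrow> ('f, 'r) fm set \<Rightarrow> bool" where
  "models L M T \<longleftrightarrow>
     structure_for L M \<and> (\<forall>\<phi>\<in>T. \<forall>e. range e \<subseteq> Dom M \<longrightarrow> sat M e \<phi>)"

text \<open>
  The reduct forgets the interpretation of the symbols outside the language; these receive dummy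
  values, which no formula of the language mentions.
\<close>

definition reduct :: "('f, 'r) lang \<Rightarrow> ('f, 'r, 'm) struc \<Rightarrow> ('f, 'r, 'm) struc" where
  "reduct L M = M
     \<lparr>funI := \<lambda>f as. if (f, length as) \<in> Fsyms L then funI M f as else zeroI M,
      relI := \<lambda>r as. (r, length as) \<in> Rsyms L \<and> relI M r as\<rparr>"


section \<open>Peano arithmetic\<close>

text \<open>
  The induction scheme covers the formulas of the language of arithmetic only, whatever the
  ambient language; the induction variable is \<open>Var 0\<close> and the side parameters are
  \<open>Var 1, \<dots>, Var k\<close>.
\<close>

definition induction_axiom :: "('f, 'r) fm \<Rightarrow> ('f, 'r) fm" where
  "induction_axiom \<phi> =
     Imp (subst (case_nat Zero Var) \<phi>)
      (Imp (Forall (Imp \<phi> (subst (case_nat (Add (Var 0) One) (\<lambda>i. Var (Suc i))) \<phi>)))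
        (Forall \<phi>))"

definition PA :: "('f, 'r) fm set" where
  "PA =
     {Forall (Neg (Eq (Add (Var 0) One) Zero)),
      Forall (Forall (Imp (Eq (Add (Var 1) One) (Add (Var 0) One)) (Eq (Var 1) (Var 0)))),
      Forall (Eq (Add (Var 0) Zero) (Var 0)),
      Forall (Forall (Eq (Add (Var 1) (Add (Var 0) One)) (Add (Add (Var 1) (Var 0)) One))),
      Forall (Eq (Mul (Var 0) Zero) Zero),
      Forall (Forall (Eq (Mul (Var 1) (Add (Var 0) One)) (Add (Mul (Var 1) (Var 0)) (Var 1)))),
      Forall (Forall (Iff (Less (Var 1) (Var 0))
        (Exists (Eq (Add (Var 2) (Add (Var 0) One)) (Var 1)))))} \<union>
     {(Forall ^^ k) (induction_axiom \<phi>) | k \<phi>. fm_in LPA \<phi> \<and> fv \<phi> \<subseteq> {..k}}"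


section \<open>Recursive functions and codes\<close>

text \<open>
  Functions of any arity are functions on lists in which missing arguments are read as 0 and
  superfluous ones are ignored; on lists of length \<open>n\<close> one obtains exactly the usual \<open>n\<close>-ary
  (primitive) recursive functions.
\<close>

definition arg :: "nat \<Rightarrow> nat list \<Rightarrow> nat" where
  "arg i xs = (if i < length xs then xs ! i else 0)"

definition comp_op :: "(nat list \<Rightarrow> nat) \<Rightarrow> (nat list \<Rightarrow> nat) list \<Rightarrow> nat list \<Rightarrow> nat" where
  "comp_op F Gs xs = F (map (\<lambda>G. G xs) Gs)"

definition prec_op :: "(nat list \<Rightarrow> nat) \<Rightarrow> (nat list \<Rightarrow> nat) \<Rightarrow> nat list \<Rightarrow> nat" where
  "prec_op F G xs = rec_nat (F (tl xs)) (\<lambda>n r. G (r # n # tl xs)) (arg 0 xs)"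

datatype prim_rec = PZero | PSucc | PProj nat | PComp prim_rec "prim_rec list" | PRec prim_rec prim_rec

primrec pr_eval :: "prim_rec \<Rightarrow> nat list \<Rightarrow> nat" where
  "pr_eval PZero = (\<lambda>xs. 0)"
| "pr_eval PSucc = (\<lambda>xs. Suc (arg 0 xs))"
| "pr_eval (PProj i) = arg i"
| "pr_eval (PComp f gs) = comp_op (pr_eval f) (map pr_eval gs)"
| "pr_eval (PRec f g) = prec_op (pr_eval f) (pr_eval g)"

primrec pr_code :: "prim_rec \<Rightarrow> nat" where
  "pr_code PZero = prod_encode (0, 0)"
| "pr_code PSucc = prod_encode (1, 0)"
| "pr_code (PProj i) = prod_encode (2, i)"
| "pr_code (PComp f gs) = prod_encode (3, prod_encode (pr_code f, list_encode (map pr_code gs)))"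
| "pr_code (PRec f g) = prod_encode (4, prod_encode (pr_code f, pr_code g))"

text \<open>Total recursive functions: minimization is applied to regular functions only.\<close>

inductive recursive :: "(nat list \<Rightarrow> nat) \<Rightarrow> bool" where
  zero: "recursive (\<lambda>xs. 0)"
| succ: "recursive (\<lambda>xs. Suc (arg 0 xs))"
| proj: "recursive (arg i)"
| comp: "recursive F \<Longrightarrow> \<forall>G\<in>set Gs. recursive G \<Longrightarrow> recursive (comp_op F Gs)"
| prec: "recursive F \<Longrightarrow> recursive G \<Longrightarrow> recursive (prec_op F G)"
| mu: "recursive F \<Longrightarrow> \<forall>xs. \<exists>n. F (n # xs) = 0 \<Longrightarrow> recursive (\<lambda>xs. LEAST n. F (n # xs) = 0)"

definition recursive_set :: "nat set \<Rightarrow> bool" where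
  "recursive_set A \<longleftrightarrow> (\<exists>F. recursive F \<and> (\<forall>n. F [n] = (if n \<in> A then 1 else 0)))"

text \<open>Codes are meaningful, and injective, for the language of arithmetic only.\<close>

primrec tm_code :: "'f tm \<Rightarrow> nat" where
  "tm_code (Var i) = prod_encode (0, i)"
| "tm_code Zero = prod_encode (1, 0)"
| "tm_code One = prod_encode (2, 0)"
| "tm_code (Add s t) = prod_encode (3, prod_encode (tm_code s, tm_code t))"
| "tm_code (Mul s t) = prod_encode (4, prod_encode (tm_code s, tm_code t))"
| "tm_code (Fun f ts) = 0"

primrec fm_code :: "('f, 'r) fm \<Rightarrow> nat" where
  "fm_code FF = prod_encode (0, 0)"
| "fm_code (Eq s t) = prod_encode (1, prod_encode (tm_code s, tm_code t))"
| "fm_code (Less s t) = prod_encode (2, prod_encode (tm_code s, tm_code t))"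
| "fm_code (Imp \<phi> \<psi>) = prod_encode (3, prod_encode (fm_code \<phi>, fm_code \<psi>))"
| "fm_code (Forall \<phi>) = prod_encode (4, fm_code \<phi>)"
| "fm_code (Rel r ts) = 0"


section \<open>Recursive saturation\<close>

text \<open>
  A type over \<open>a\<^sub>1, \<dots>, a\<^sub>k\<close> is a set of formulas in the type variable \<open>Var 0\<close> and
  \<open>Var 1, \<dots>, Var k\<close>, the latter evaluated at \<open>a\<^sub>1, \<dots>, a\<^sub>k\<close>
  (\<open>a 0, \<dots>, a (k - 1)\<close> below).
\<close>

definition recursively_saturated :: "('f, 'r, 'm) struc \<Rightarrow> bool" where
  "recursively_saturated M \<longleftrightarrow>
     (\<forall>k a \<Gamma>. range a \<subseteq> Dom M \<longrightarrow>
        (\<forall>\<phi>\<in>\<Gamma>. fm_in LPA \<phi> \<and> fv \<phi> \<subseteq> {..k}) \<longrightarrow>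
        recursive_set (fm_code ` \<Gamma>) \<longrightarrow>
        (\<forall>\<Delta>. finite \<Delta> \<and> \<Delta> \<subseteq> \<Gamma> \<longrightarrow> (\<exists>b\<in>Dom M. \<forall>\<phi>\<in>\<Delta>. sat M (case_nat b a) \<phi>)) \<longrightarrow>
        (\<exists>b\<in>Dom M. \<forall>\<phi>\<in>\<Gamma>. sat M (case_nat b a) \<phi>))"

text \<open>
  The type argument fixes the type from which the carriers of models are taken; carriers are
  arbitrary subsets of it.
\<close>

definition imposes_recursive_saturation ::
    "'m itself \<Rightarrow> ('f, 'r) lang \<Rightarrow> ('f, 'r) fm set \<Rightarrow> bool" where
  "imposes_recursive_saturation TYPE('m) L U \<longleftrightarrow>
     (\<forall>M :: ('f, 'r, 'm) struc. models L M U \<longrightarrow> recursively_saturated (reduct LPA M))"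


section \<open>The theory RSAT\<close>

datatype rsym = R

primrec numeral_tm :: "nat \<Rightarrow> 'f tm" where
  "numeral_tm 0 = Zero"
| "numeral_tm (Suc n) = Add (numeral_tm n) One"

text \<open>
  Sequences are coded as by \<open>list_encode\<close>: the empty sequence by 0, and a sequence with head
  \<open>y\<close> and tail coded by \<open>w\<close> by \<open>z = (y + w)(y + w + 1)/2 + y + 1\<close>. The formula
  \<open>seq_fm i k j\<close> says that \<open>Var j\<close> is the code of the sequence
  \<open>Var i, \<dots>, Var (i + k - 1)\<close>.
\<close>

primrec seq_fm :: "nat \<Rightarrow> nat \<Rightarrow> nat \<Rightarrow> ('f, 'r) fm" where
  "seq_fm i 0 j = Eq (Var j) Zero"
| "seq_fm i (Suc k) j =
     (let z = Var (Suc j); y = Var (Suc i); w = Var 0 in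
      Exists (Conj
        (Eq (Add z z)
          (Add (Mul (Add y w) (Add (Add y w) One)) (Add (Add y y) (Add One One))))
        (seq_fm (Suc (Suc i)) k 0)))"

text \<open>
  From here on \<open>x\<close> is \<open>Var 0\<close> and \<open>y\<^sub>1, \<dots>, y\<^sub>k\<close> are
  \<open>Var 1, \<dots>, Var k\<close>. As the sequence code is not a term, the atom
  \<open>R(p, x, \<langle>y\<^sub>1, \<dots>, y\<^sub>k\<rangle>)\<close> reads: some \<open>z\<close> codes the sequence
  and \<open>R(p, x, z)\<close>.
\<close>

definition R_fm :: "nat \<Rightarrow> nat \<Rightarrow> ('f, rsym) fm" where
  "R_fm p k = Exists (Conj (seq_fm 2 k 0) (Rel R [numeral_tm p, Var 1, Var 0]))"

definition codes_formulas :: "nat \<Rightarrow> nat \<Rightarrow> (nat \<Rightarrow> ('f, 'r) fm) \<Rightarrow> bool" where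
  "codes_formulas k p \<phi> \<longleftrightarrow>
     (\<forall>i. fm_in LPA (\<phi> i) \<and> fv (\<phi> i) \<subseteq> {..k}) \<and>
     (\<exists>f. p = pr_code f \<and> (\<forall>i. pr_eval f [i] = fm_code (\<phi> i)))"

text \<open>
  In \<open>OP\<close> the variables \<open>y\<^sub>1, \<dots>, y\<^sub>k\<close> are bound by the \<open>k\<close> outer quantifiers, and
  \<open>x\<close> by the innermost one.
\<close>

definition OP :: "nat \<Rightarrow> nat \<Rightarrow> nat \<Rightarrow> (nat \<Rightarrow> ('f, rsym) fm) \<Rightarrow> ('f, rsym) fm" where
  "OP k p n \<phi> = (Forall ^^ k)
     (Imp (Exists (Conjs (map \<phi> [1..<Suc n])))
       (Forall (Imp (R_fm p k) (Conjs (map \<phi> [1..<Suc n])))))"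

definition NE :: "nat \<Rightarrow> nat \<Rightarrow> ('f, rsym) fm" where
  "NE k p = (Forall ^^ k) (Exists (R_fm p k))"

definition RSAT :: "('f, rsym) fm set" where
  "RSAT = PA \<union> {OP k p n \<phi> | k p n \<phi>. codes_formulas k p \<phi>}
             \<union> {NE k p | k p. \<exists>\<phi> :: nat \<Rightarrow> ('f, rsym) fm. codes_formulas k p \<phi>}"


section \<open>Semantic definability\<close>

text \<open>
  \<open>subst_R \<theta> n \<Phi>\<close> replaces \<open>R(t\<^sub>0, t\<^sub>1, t\<^sub>2)\<close> by
  \<open>\<theta>(t\<^sub>0, t\<^sub>1, t\<^sub>2)\<close> below \<open>n\<close> quantifiers. In \<open>\<theta>\<close> the variables 0, 1, 2 are the
  argument places and \<open>Var (3 + i)\<close> is the parameter \<open>i\<close>; in the result, for a sentence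
  \<open>\<Phi>\<close> and \<open>n = 0\<close>, the parameter \<open>i\<close> is \<open>Var i\<close>.
\<close>

primrec subst_R :: "('f, 'r) fm \<Rightarrow> nat \<Rightarrow> ('f, rsym) fm \<Rightarrow> ('f, 'r) fm" where
  "subst_R \<theta> n FF = FF"
| "subst_R \<theta> n (Eq s t) = Eq s t"
| "subst_R \<theta> n (Less s t) = Less s t"
| "subst_R \<theta> n (Rel r ts) = subst (\<lambda>i. if i < 3 then ts ! i else Var (i - 3 + n)) \<theta>"
| "subst_R \<theta> n (Imp \<phi> \<psi>) = Imp (subst_R \<theta> n \<phi>) (subst_R \<theta> n \<psi>)"
| "subst_R \<theta> n (Forall \<phi>) = Forall (subst_R \<theta> (Suc n) \<phi>)"

definition semantically_defines ::
    "'m itself \<Rightarrow> ('f, 'r) lang \<Rightarrow> ('f, 'r) fm set \<Rightarrow> ('f, rsym) fm set \<Rightarrow> bool" where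
  "semantically_defines TYPE('m) L U V \<longleftrightarrow>
     (\<forall>M :: ('f, 'r, 'm) struc. models L M U \<longrightarrow>
        (\<exists>\<theta> a. fm_in L \<theta> \<and> range a \<subseteq> Dom M \<and> (\<forall>\<Phi>\<in>V. sat M a (subst_R \<theta> 0 \<Phi>))))"

end

theory Submission
  imports Defs
begin

text \<open>
  If RSAT is definable in \<open>M\<close>, a finitely satisfiable recursive type is enumerated by a primitive
  recursive function, whose program \<open>p\<close> yields by NE and OP an element realizing the type.

  For the converse let \<open>\<psi>\<^sub>m(x, p, s)\<close> enumerate the instances of OP, as conditions on a value \<open>x\<close> of
  \<open>R\<close> at the program \<open>p\<close> and the sequence code \<open>s\<close>; they are finitely satisfiable. Consider the
  recursive type saying of \<open>a\<close>, given a highly divisible number \<open>c\<close>, that \<open>a\<close> codes (by divisibility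
  by the numbers \<open>1 + (v + 1) c\<close>) the truth values of all \<open>\<psi>\<^sub>m\<close> at all small arguments. As it is
  realized in all models elementarily equivalent to \<open>M\<close>, the omitting types theorem yields a
  formula \<open>\<chi>(a, c)\<close> that is satisfiable for arbitrarily divisible \<open>c\<close> and, for each \<open>m\<close>, implies that
  \<open>a\<close> is right about \<open>\<psi>\<^sub>m\<close> as soon as \<open>c\<close> is divisible enough. Hence the predicate \<open>S(m, x, p, s)\<close>,
  "eventually \<open>a\<close> says that \<open>\<psi>\<^sub>m(x, p, s)\<close>", is definable and correct for standard \<open>m\<close>, although
  \<open>U\<close> has no induction for it. The set of \<open>k\<close> such that for all \<open>p, s\<close> some \<open>x\<close> satisfies
  \<open>S(i, x, p, s)\<close> for all \<open>i < k\<close> contains the standard numbers. If it has a nonstandard element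
  \<open>k\<close>, then \<open>\<forall>i < k. S(i, x, p, s)\<close> defines \<open>R\<close>. Otherwise it is the standard cut, so that the truth of
  all \<open>\<psi>\<^sub>m\<close> with \<open>m\<close> standard is definable; this defines \<open>R\<close>, with NE by recursive saturation.
\<close>

section \<open>Substitution and changes of structure\<close>

text \<open>A limit along \<open>c\<close> is forced: the arguments of \<open>R\<close> range over
  the whole model, while a code \<open>a\<close> answers only for indices \<open>v\<close> with
  \<open>divs v c\<close>, so no fixed pair of \<open>a\<close> and \<open>c\<close> serves all
  arguments. Moreover each \<open>psi m\<close> has its own threshold beyond which the codes are
  right about it. Largeness in the omitting types argument is therefore cofinality under
  divisibility, not mere satisfiability. The hypothesis concerns models with carrier in
  \<open>'m\<close>, so the model omitting the type has to live there as well. It is built from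
  natural numbers, carried into \<open>'m\<close> by the numerals of \<open>M\<close>. Enumerating
  the instances of OP involves evaluating arbitrary programs, which no single primitive recursive
  function does. Derivations avoid this: a number codes a whole computation, and checking it is
  primitive recursive.\<close>

lemma eval_subst_tm: "eval M e (subst_tm \<sigma> t) = eval M (\<lambda>i. eval M e (\<sigma> i)) t"
  by (induction t) (auto cong: map_cong simp: comp_def)

lemma eval_lift_tm [simp]: "eval M (case_nat a e) (lift_tm t) = eval M e t"
  by (simp add: lift_tm_def eval_subst_tm)

lemma sat_subst: "sat M e (subst \<sigma> \<phi>) = sat M (\<lambda>i. eval M e (\<sigma> i)) \<phi>"
proof (induction \<phi> arbitrary: \<sigma> e)
  case (Forall \<phi>)
  have "(\<lambda>i. eval M (case_nat a e) (case_nat (Var 0) (\<lambda>i. lift_tm (\<sigma> i)) i)) =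
      case_nat a (\<lambda>i. eval M e (\<sigma> i))" for a
    by (auto split: nat.split)
  with Forall show ?case by simp
qed (auto simp: eval_subst_tm comp_def)

lemma eval_cong: "(\<And>i. i \<in> fv_tm t \<Longrightarrow> e i = e' i) \<Longrightarrow> eval M e t = eval M e' t"
proof (induction t)
  case (Fun f ts)
  then have "map (eval M e) ts = map (eval M e') ts"
    by (intro map_cong refl) auto
  then show ?case by (simp only: eval.simps)
qed auto

lemma sat_cong: "(\<And>i. i \<in> fv \<phi> \<Longrightarrow> e i = e' i) \<Longrightarrow> sat M e \<phi> = sat M e' \<phi>"
proof (induction \<phi> arbitrary: e e')
  case (Rel r ts)
  then have "map (eval M e) ts = map (eval M e') ts"
    by (intro map_cong refl eval_cong) auto
  then show ?case by (simp only: sat.simps)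
next
  case (Forall \<phi>)
  have "sat M (case_nat a e) \<phi> = sat M (case_nat a e') \<phi>" for a
    by (rule Forall.IH) (auto split: nat.split intro: Forall.prems)
  then show ?case by simp
next
  case (Imp \<phi> \<psi>)
  have "sat M e \<phi> = sat M e' \<phi>" by (rule Imp.IH(1)) (simp add: Imp.prems)
  moreover have "sat M e \<psi> = sat M e' \<psi>" by (rule Imp.IH(2)) (simp add: Imp.prems)
  ultimately show ?case by simp
next
  case (Eq s t)
  have "eval M e s = eval M e' s" "eval M e t = eval M e' t"
    by (rule eval_cong, simp add: Eq)+
  then show ?case by simp
next
  case (Less s t)
  have "eval M e s = eval M e' s" "eval M e t = eval M e' t"
    by (rule eval_cong, simp add: Less)+
  then show ?case by simp
qed simp

lemma finite_fv_tm: "finite (fv_tm t)"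
  by (induction t) auto

lemma finite_fv: "finite (fv \<phi>)"
proof (induction \<phi>)
  case (Forall \<phi>)
  have "{i. Suc i \<in> fv \<phi>} = Suc -` fv \<phi>" by auto
  with Forall show ?case by (simp add: finite_vimageI)
qed (auto simp: finite_fv_tm)

lemma fv_bounded: "\<exists>n. fv \<phi> \<subseteq> {..<n}"
  by (meson finite_fv finite_nat_iff_bounded)

lemma tm_in_subst: "tm_in L t \<Longrightarrow> (\<And>i. tm_in L (\<sigma> i)) \<Longrightarrow> tm_in L (subst_tm \<sigma> t)"
  by (induction t) (auto simp: list_all_iff)

lemma fm_in_subst: "fm_in L \<phi> \<Longrightarrow> (\<And>i. tm_in L (\<sigma> i)) \<Longrightarrow> fm_in L (subst \<sigma> \<phi>)"
proof (induction \<phi> arbitrary: \<sigma>)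
  case (Forall \<phi>)
  have "tm_in L (case_nat (Var 0) (\<lambda>i. lift_tm (\<sigma> i)) i)" for i
    by (auto split: nat.split simp: lift_tm_def intro: tm_in_subst Forall.prems)
  with Forall show ?case by simp
qed (auto simp: tm_in_subst list_all_iff)

lemma tm_in_mono: "tm_in LPA t \<Longrightarrow> tm_in L t"
  by (induction t) (auto simp: LPA_def)

lemma fm_in_mono: "fm_in LPA \<phi> \<Longrightarrow> fm_in L \<phi>"
  by (induction \<phi>) (auto simp: tm_in_mono, auto simp: LPA_def)

section \<open>Environments with a finite prefix\<close>

definition prepend :: "'m list \<Rightarrow> (nat \<Rightarrow> 'm) \<Rightarrow> nat \<Rightarrow> 'm" where
  "prepend xs e i = (if i < length xs then xs ! i else e (i - length xs))"

lemma prepend_Nil [simp]: "prepend [] e = e"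
  by (auto simp: prepend_def)

text \<open>Applied throughout: each binder becomes a cons, so an environment below a block of
  quantifiers is one explicit list with the innermost variable first.\<close>

lemma case_nat_prepend: "case_nat a (prepend xs e) = prepend (a # xs) e"
proof
  fix i
  show "case_nat a (prepend xs e) i = prepend (a # xs) e i"
    by (cases i) (simp_all add: prepend_def)
qed

lemma prepend_case_nat: "prepend xs (case_nat a e) = prepend (xs @ [a]) e"
proof
  fix i
  show "prepend xs (case_nat a e) i = prepend (xs @ [a]) e i"
  proof (cases "i - length xs")
    case (Suc j)
    then have "j = i - Suc (length xs)" "\<not> i < Suc (length xs)" by simp_all
    with Suc show ?thesis by (simp add: prepend_def)
  qed (auto simp: prepend_def nth_append)
qed

lemma prepend_Cons_0 [simp]: "prepend (x # xs) e 0 = x"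
  by (simp add: prepend_def)

lemma prepend_Cons_Suc [simp]: "prepend (x # xs) e (Suc i) = prepend xs e i"
  by (simp add: prepend_def)

lemma prepend_nth: "i < length xs \<Longrightarrow> prepend xs e i = xs ! i"
  by (simp add: prepend_def)

lemma prepend_add [simp]: "length xs = n \<Longrightarrow> prepend xs e (n + i) = e i" "length xs = n \<Longrightarrow> prepend xs e (i + n) = e i"
  by (simp_all add: prepend_def)

lemma range_case_nat: "range (case_nat a e) \<subseteq> A \<longleftrightarrow> a \<in> A \<and> range e \<subseteq> A"
  by (auto simp: image_subset_iff split: nat.split)

lemma range_prepend: "set xs \<subseteq> A \<Longrightarrow> range e \<subseteq> A \<Longrightarrow> range (prepend xs e) \<subseteq> A"
  by (auto simp: prepend_def subset_iff)

text \<open>The outermost quantifier binds the variable with the highest index, so the induction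
  appends its value at the end of the list.\<close>

lemma sat_Forall_pow:
  "sat M e ((Forall ^^ k) \<phi>) \<longleftrightarrow>
     (\<forall>xs. length xs = k \<and> set xs \<subseteq> Dom M \<longrightarrow> sat M (prepend xs e) \<phi>)"
proof (induction k arbitrary: e)
  case (Suc k)
  have "sat M e ((Forall ^^ Suc k) \<phi>) \<longleftrightarrow>
      (\<forall>a\<in>Dom M. \<forall>xs. length xs = k \<and> set xs \<subseteq> Dom M \<longrightarrow> sat M (prepend (xs @ [a]) e) \<phi>)"
    by (simp add: Suc.IH prepend_case_nat)
  also have "\<dots> \<longleftrightarrow> (\<forall>xs. length xs = Suc k \<and> set xs \<subseteq> Dom M \<longrightarrow> sat M (prepend xs e) \<phi>)"
  proof safe
    fix xs :: "'c list"
    assume *: "\<forall>a\<in>Dom M. \<forall>xs. length xs = k \<and> set xs \<subseteq> Dom M \<longrightarrow> sat M (prepend (xs @ [a]) e) \<phi>"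
      and xs: "length xs = Suc k" "set xs \<subseteq> Dom M"
    obtain ys y where "xs = ys @ [y]" using xs(1) by (metis length_Suc_conv_rev)
    with * xs show "sat M (prepend xs e) \<phi>" by auto
  qed auto
  finally show ?case .
qed auto

lemma fm_in_Forall_pow [simp]: "fm_in L ((Forall ^^ k) \<phi>) = fm_in L \<phi>"
  by (induction k) auto

lemma fv_Forall_pow: "fv ((Forall ^^ k) \<phi>) = {i. i + k \<in> fv \<phi>}"
  by (induction k) auto

lemma sat_Conjs [simp]: "sat M e (Conjs \<phi>s) \<longleftrightarrow> (\<forall>\<phi>\<in>set \<phi>s. sat M e \<phi>)"
  by (induction \<phi>s) (auto simp: Conjs_def)

lemma fm_in_Conjs [simp]: "fm_in L (Conjs \<phi>s) \<longleftrightarrow> (\<forall>\<phi>\<in>set \<phi>s. fm_in L \<phi>)"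
  by (induction \<phi>s) (auto simp: Conjs_def)

lemma tm_in_numeral_tm [simp]: "tm_in L (numeral_tm n)"
  by (induction n) auto

lemma fv_numeral_tm [simp]: "fv_tm (numeral_tm n) = {}"
  by (induction n) auto

text \<open>
  RSAT and \<open>U\<close> consist of formulas of different types; \<open>conv\<close> translates formulas of arithmetic
  between them (on other relation atoms its value is junk).
\<close>

primrec conv :: "('f, 'r) fm \<Rightarrow> ('f, 's) fm" where
  "conv FF = FF"
| "conv (Eq s t) = Eq s t"
| "conv (Less s t) = Less s t"
| "conv (Rel r ts) = FF"
| "conv (Imp \<phi> \<psi>) = Imp (conv \<phi>) (conv \<psi>)"
| "conv (Forall \<phi>) = Forall (conv \<phi>)"

lemma fm_in_conv [simp]: "fm_in LPA \<phi> \<Longrightarrow> fm_in LPA (conv \<phi>)"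
  by (induction \<phi>) (auto simp: tm_in_mono)

lemma fv_conv [simp]: "fm_in LPA \<phi> \<Longrightarrow> fv (conv \<phi>) = fv \<phi>"
  by (induction \<phi>) (auto simp: LPA_def)

lemma fm_code_conv [simp]: "fm_in LPA \<phi> \<Longrightarrow> fm_code (conv \<phi>) = fm_code \<phi>"
  by (induction \<phi>) (auto simp: LPA_def)

lemma conv_subst: "conv (subst \<sigma> \<phi>) = subst \<sigma> (conv \<phi>)"
  by (induction \<phi> arbitrary: \<sigma>) auto

lemma conv_Forall_pow [simp]: "conv ((Forall ^^ k) \<phi>) = (Forall ^^ k) (conv \<phi>)"
  by (induction k) auto

lemma conv_PA:
  assumes "\<Phi> \<in> (PA :: ('f, 'r) fm set)"
  shows "(conv \<Phi> :: ('f, 's) fm) \<in> PA"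
proof (cases "\<exists>k \<phi>. \<Phi> = (Forall ^^ k) (induction_axiom \<phi>) \<and> fm_in LPA \<phi> \<and> fv \<phi> \<subseteq> {..k}")
  case True
  then obtain k \<phi> where \<Phi>: "\<Phi> = (Forall ^^ k) (induction_axiom \<phi>)"
    and \<phi>: "fm_in LPA \<phi>" "fv \<phi> \<subseteq> {..k}"
    by blast
  have "conv \<Phi> = (Forall ^^ k) (induction_axiom (conv \<phi> :: ('f, 's) fm))"
    by (simp add: \<Phi> induction_axiom_def conv_subst)
  moreover have "fm_in LPA (conv \<phi> :: ('f, 's) fm)" "fv (conv \<phi> :: ('f, 's) fm) \<subseteq> {..k}"
    using \<phi> by simp_all
  ultimately show ?thesis unfolding PA_def by blast
next
  \<comment> \<open>What remains are the seven basic axioms, on which \<open>conv\<close> only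
    changes the type.\<close>
  case False
  then have "\<Phi> \<in> PA - {(Forall ^^ k) (induction_axiom \<phi>) | k \<phi>. fm_in LPA \<phi> \<and> fv \<phi> \<subseteq> {..k}}"
    using assms by blast
  then show ?thesis unfolding PA_def by auto
qed

section \<open>Comparison of structures over different relation symbols\<close>

definition same_arith :: "('f, 'r, 'm) struc \<Rightarrow> ('f, 's, 'm) struc \<Rightarrow> bool" where
  "same_arith M N \<longleftrightarrow> Dom M = Dom N \<and> zeroI M = zeroI N \<and> oneI M = oneI N \<and>
     addI M = addI N \<and> mulI M = mulI N \<and> lessI M = lessI N"

lemma eval_same_arith: "same_arith M N \<Longrightarrow> tm_in LPA t \<Longrightarrow> eval M e t = eval N e t"
  by (induction t) (auto simp: same_arith_def LPA_def)

lemma sat_conv: "same_arith M N \<Longrightarrow> fm_in LPA \<phi> \<Longrightarrow> sat N e (conv \<phi>) = sat M e \<phi>"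
proof (induction \<phi> arbitrary: e)
  case (Rel r ts)
  then show ?case by (simp add: LPA_def)
next
  case (Forall \<phi>)
  then show ?case by (simp add: same_arith_def)
qed (auto simp: eval_same_arith, auto simp: same_arith_def)

lemma conv_id: "fm_in LPA \<phi> \<Longrightarrow> conv \<phi> = \<phi>"
  by (induction \<phi>) (auto simp: LPA_def)

lemma Dom_reduct [simp]: "Dom (reduct K M) = Dom M"
  by (simp add: reduct_def)

lemma sat_reduct:
  assumes "fm_in LPA \<phi>" shows "sat (reduct LPA M) e \<phi> = sat M e \<phi>"
proof -
  have "same_arith M (reduct LPA M)" by (simp add: same_arith_def reduct_def)
  from sat_conv[OF this assms] show ?thesis by (simp add: conv_id assms)
qed

text \<open>Semantic counterpart of \<open>subst_R\<close>. As \<open>rsym\<close> has one element,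
  \<open>r\<close> is ignored; with three arguments, \<open>prepend xs a\<close> puts the parameter
  \<open>a i\<close> at \<open>Var (3 + i)\<close>, where \<open>subst_R\<close> expects it.\<close>

definition expandR :: "('f, 'r, 'm) struc \<Rightarrow> ('f, 'r) fm \<Rightarrow> (nat \<Rightarrow> 'm) \<Rightarrow> ('f, rsym, 'm) struc" where
  "expandR M \<theta> a = \<lparr>Dom = Dom M, zeroI = zeroI M, oneI = oneI M, addI = addI M, mulI = mulI M,
     lessI = lessI M, funI = funI M, relI = \<lambda>r xs. sat M (prepend xs a) \<theta>\<rparr>"

lemma same_arith_expandR: "same_arith M (expandR M \<theta> a)" "same_arith (expandR M \<theta> a) M"
  by (simp_all add: same_arith_def expandR_def)

lemma eval_expandR [simp]: "eval (expandR M \<theta> a) = eval M"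
proof (intro ext)
  fix e t show "eval (expandR M \<theta> a) e t = eval M e t"
    by (induction t) (auto simp: expandR_def cong: map_cong)
qed

lemma expandR_sel [simp]:
  "Dom (expandR M \<theta> a) = Dom M"
  "lessI (expandR M \<theta> a) = lessI M"
  "relI (expandR M \<theta> a) r xs = sat M (prepend xs a) \<theta>"
  by (simp_all add: expandR_def)

text \<open>On an atom with another number of arguments, \<open>subst_R\<close> and
  \<open>expandR\<close> disagree: the former always reads the places 0, 1, 2, the latter shifts the
  parameters by the actual length.\<close>

primrec ternary :: "('f, 'r) fm \<Rightarrow> bool" where
  "ternary FF = True"
| "ternary (Eq s t) = True"
| "ternary (Less s t) = True"
| "ternary (Rel r ts) = (length ts = 3)"
| "ternary (Imp \<phi> \<psi>) = (ternary \<phi> \<and> ternary \<psi>)"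
| "ternary (Forall \<phi>) = ternary \<phi>"

lemma ternary_LPA: "fm_in LPA \<phi> \<Longrightarrow> ternary \<phi>"
  by (induction \<phi>) (auto simp: LPA_def)

text \<open>The hypothesis on \<open>e\<close> says that the parameters are still visible below the
  \<open>n\<close> binders passed so far; the offset \<open>n\<close> in \<open>subst_R\<close>
  accounts for them.\<close>

lemma sat_subst_R:
  "ternary \<Phi> \<Longrightarrow> (\<And>i. e (i + n) = a i) \<Longrightarrow>
     sat M e (subst_R \<theta> n \<Phi>) = sat (expandR M \<theta> a) e \<Phi>"
proof (induction \<Phi> arbitrary: n e)
  case (Rel r ts)
  have "(\<lambda>i. eval M e (if i < 3 then ts ! i else Var (i - 3 + n))) =
      prepend (map (eval M e) ts) a" (is "?l = ?r")
  proof
    fix i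
    show "?l i = ?r i"
    proof (cases "i < 3")
      case False
      have "eval M e (Var (i - 3 + n)) = a (i - 3)" using Rel.prems(2) by simp
      with False Rel.prems(1) show ?thesis by (simp only: prepend_def length_map if_False ternary.simps)
    qed (use Rel.prems(1) in \<open>simp add: prepend_def\<close>)
  qed
  then show ?case
    by (simp add: sat_subst)
qed auto

section \<open>Omitting types\<close>

instance tm :: (countable) countable
  by countable_datatype

instance fm :: (countable, countable) countable
  by countable_datatype

lemma set_tm_in: "tm_in L t \<Longrightarrow> set_tm t \<subseteq> fst ` Fsyms L"
proof (induction t)
  case (Fun f ts)
  then have "f \<in> fst ` Fsyms L" by (force simp: image_iff)
  with Fun show ?case by (auto simp: list_all_iff)
qed auto

lemma set_fm_in: "fm_in L \<phi> \<Longrightarrow> set1_fm \<phi> \<subseteq> fst ` Fsyms L \<and> set2_fm \<phi> \<subseteq> fst ` Rsyms L"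
proof (induction \<phi>)
  case (Rel r ts)
  then have "r \<in> fst ` Rsyms L" by (force simp: image_iff)
  moreover have "set_tm t \<subseteq> fst ` Fsyms L" if "t \<in> set ts" for t
    using Rel that by (intro set_tm_in) (auto simp: list_all_iff)
  ultimately show ?case by auto
qed (use set_tm_in in \<open>auto dest: subsetD\<close>)

text \<open>The types of symbols may be uncountable. Renaming along injections into
  \<open>nat\<close> that are defined on the symbols of \<open>L\<close> embeds the formulas of
  \<open>L\<close> into a countable type.\<close>

lemma countable_fm_in:
  fixes L :: "('f, 'r) lang"
  assumes "countable_lang L" shows "countable {\<phi>. fm_in L \<phi>}"
proof -
  have "countable (fst ` Fsyms L)" "countable (fst ` Rsyms L)"
    using assms by (simp_all add: countable_lang_def)
  then obtain g :: "'f \<Rightarrow> nat" and h :: "'r \<Rightarrow> nat"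
    where gh: "inj_on g (fst ` Fsyms L)" "inj_on h (fst ` Rsyms L)"
    by (meson countableE)
  have "inj_on (map_fm g h) {\<phi>. fm_in L \<phi>}"
  proof (rule inj_onI)
    fix \<phi> \<psi> assume "\<phi> \<in> {\<phi>. fm_in L \<phi>}" "\<psi> \<in> {\<phi>. fm_in L \<phi>}" and eq: "map_fm g h \<phi> = map_fm g h \<psi>"
    then have "set1_fm \<phi> \<subseteq> fst ` Fsyms L" "set2_fm \<phi> \<subseteq> fst ` Rsyms L"
      "set1_fm \<psi> \<subseteq> fst ` Fsyms L" "set2_fm \<psi> \<subseteq> fst ` Rsyms L"
      using set_fm_in[of L \<phi>] set_fm_in[of L \<psi>] by auto
    with gh show "\<phi> = \<psi>"
      by (intro fm.inj_map_strong[OF _ _ eq]) (auto dest: inj_onD)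
  qed
  then show ?thesis using countableI_type countable_image_inj_on countable_subset by blast
qed

lemma eval_in_Dom:
  assumes "structure_for L M" "tm_in L t" "range e \<subseteq> Dom M"
  shows "eval M e t \<in> Dom M"
  using assms(2)
proof (induction t)
  case (Fun f ts)
  then have "length (map (eval M e) ts) = length ts" "set (map (eval M e) ts) \<subseteq> Dom M"
    by (auto simp: list_all_iff)
  with Fun.prems assms(1) show ?case unfolding structure_for_def by fastforce
qed (use assms in \<open>auto simp: structure_for_def\<close>)

text \<open>
  A Henkin construction. \<open>Pos\<close> is a notion of large set of interpretations of the constant for
  which a type is to be omitted; variables serve as constants, \<open>Var 0\<close> as the distinguished one.
  Conditions are formulas satisfied for a large set of values of \<open>Var 0\<close>.
\<close>

locale omitting =
  fixes L :: "('f, 'r) lang" and M :: "('f, 'r, 'm) struc" and h :: "nat \<Rightarrow> 'm"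
    and Pos :: "'m set \<Rightarrow> bool" and Q :: "nat \<Rightarrow> ('f, 'r) fm"
  assumes L: "countable_lang L" and M: "structure_for L M" and h: "inj h"
    and Pos_mono: "Pos A \<Longrightarrow> A \<subseteq> B \<Longrightarrow> Pos B"
    and Pos_Un: "Pos (A \<union> B) \<Longrightarrow> Pos A \<or> Pos B"
    and Pos_Dom: "Pos (Dom M)" and Pos_empty: "\<not> Pos {}"
    and Q: "fm_in L (Q m)"
    and not_isolated: "fm_in L \<chi> \<Longrightarrow> Pos {e 0 | e. range e \<subseteq> Dom M \<and> sat M e \<chi>} \<Longrightarrow>
      \<exists>m. Pos {e 0 | e. range e \<subseteq> Dom M \<and> sat M e \<chi> \<and> \<not> sat M (case_nat (e j) (\<lambda>_. e 0)) (Q m)}"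
begin

section \<open>Conditions of the Henkin construction\<close>

definition Env :: "(nat \<Rightarrow> 'm) set" where "Env = {e. range e \<subseteq> Dom M}"
definition Sat :: "('f, 'r) fm \<Rightarrow> (nat \<Rightarrow> 'm) set" where "Sat \<phi> = {e \<in> Env. sat M e \<phi>}"
definition good :: "('f, 'r) fm \<Rightarrow> bool" where "good \<chi> \<longleftrightarrow> fm_in L \<chi> \<and> Pos ((\<lambda>e. e 0) ` Sat \<chi>)"
definition inst :: "nat \<Rightarrow> nat \<Rightarrow> 'f tm" where "inst w = case_nat (Var w) Var"

lemma sat_inst: "sat M e (subst (inst w) \<phi>) = sat M (case_nat (e w) e) \<phi>"
proof -
  have "(\<lambda>i. eval M e (inst w i)) = case_nat (e w) e"
    by (auto simp: inst_def fun_eq_iff split: nat.split)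
  then show ?thesis by (simp add: sat_subst)
qed

lemma fm_in_inst: "fm_in L \<phi> \<Longrightarrow> fm_in L (subst (inst w) \<phi>)"
  by (rule fm_in_subst) (auto simp: inst_def split: nat.split)

text \<open>The constant \<open>Var j\<close> takes the place of the type variable. All other
  variables of \<open>Q m\<close> go to the distinguished constant, as the type has a single
  parameter.\<close>

definition omit :: "nat \<Rightarrow> nat \<Rightarrow> ('f, 'r) fm" where
  "omit j m = Neg (subst (case_nat (Var j) (\<lambda>_. Var 0)) (Q m))"

lemma sat_omit: "sat M e (omit j m) \<longleftrightarrow> \<not> sat M (case_nat (e j) (\<lambda>_. e 0)) (Q m)"
proof -
  have "(\<lambda>i. eval M e (case_nat (Var j) (\<lambda>_. Var 0) i)) = case_nat (e j) (\<lambda>_. e 0)"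
    by (auto simp: fun_eq_iff split: nat.split)
  then show ?thesis by (simp add: omit_def sat_subst)
qed

lemma fm_in_omit: "fm_in L (omit j m)"
  unfolding omit_def fm_in.simps
  by (intro conjI TrueI fm_in_subst Q) (auto split: nat.split)

text \<open>Partition regularity in the form \<open>Pos_Un\<close> is what permits deciding a
  formula: one of two parts of a large set is large.\<close>

lemma good_decide:
  assumes "good \<chi>" "fm_in L \<phi>"
  shows "good (Conj \<chi> \<phi>) \<or> good (Conj \<chi> (Neg \<phi>))"
proof -
  have "(\<lambda>e. e 0) ` Sat \<chi> = (\<lambda>e. e 0) ` Sat (Conj \<chi> \<phi>) \<union> (\<lambda>e. e 0) ` Sat (Conj \<chi> (Neg \<phi>))"
    by (auto simp: Sat_def)
  with assms Pos_Un show ?thesis unfolding good_def by auto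
qed

text \<open>A fresh variable \<open>w\<close> is the Henkin constant. Since \<open>w\<close> is not
  0, redirecting \<open>e w\<close> to a counterexample leaves \<open>e 0\<close> alone, so the set
  of values of \<open>Var 0\<close> does not shrink.\<close>

lemma good_witness:
  assumes "good \<chi>" "Sat \<chi> \<subseteq> Sat (Neg (Forall \<phi>))" "fm_in L \<phi>"
  shows "\<exists>w. good (Conj \<chi> (Neg (subst (inst w) \<phi>)))"
proof -
  obtain n1 n2 where n: "fv \<chi> \<subseteq> {..<n1}" "fv \<phi> \<subseteq> {..<n2}" using fv_bounded by metis
  define w where "w = Suc (max n1 n2)"
  have w: "w \<notin> fv \<chi>" "Suc w \<notin> fv \<phi>" "w \<noteq> 0" using n by (auto simp: w_def)
  have "e 0 \<in> (\<lambda>e. e 0) ` Sat (Conj \<chi> (Neg (subst (inst w) \<phi>)))" if e: "e \<in> Sat \<chi>" for e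
  proof -
    obtain a where a: "a \<in> Dom M" "\<not> sat M (case_nat a e) \<phi>"
      using e assms(2) by (auto simp: Sat_def)
    let ?e = "e(w := a)"
    have "sat M ?e \<chi> = sat M e \<chi>" by (rule sat_cong) (use w in auto)
    moreover have "sat M (case_nat (?e w) ?e) \<phi> = sat M (case_nat a e) \<phi>"
      by (rule sat_cong) (use w in \<open>auto split: nat.split\<close>)
    ultimately have "?e \<in> Sat (Conj \<chi> (Neg (subst (inst w) \<phi>)))"
      using e a by (auto simp: Sat_def Env_def sat_inst)
    then show ?thesis using w by (intro image_eqI[of _ _ ?e]) auto
  qed
  then have "good (Conj \<chi> (Neg (subst (inst w) \<phi>)))"
    using assms Pos_mono[of "(\<lambda>e. e 0) ` Sat \<chi>"] by (auto simp: good_def fm_in_inst)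
  then show ?thesis by blast
qed

lemma good_omit:
  assumes "good \<chi>" shows "\<exists>m. good (Conj \<chi> (omit j m))"
proof -
  have "(\<lambda>e. e 0) ` Sat \<chi> = {e 0 | e. range e \<subseteq> Dom M \<and> sat M e \<chi>}"
    by (auto simp: Sat_def Env_def)
  then obtain m where
    "Pos {e 0 | e. range e \<subseteq> Dom M \<and> sat M e \<chi> \<and> \<not> sat M (case_nat (e j) (\<lambda>_. e 0)) (Q m)}"
    using not_isolated[of \<chi> j] assms by (auto simp: good_def)
  also have "{e 0 | e. range e \<subseteq> Dom M \<and> sat M e \<chi> \<and> \<not> sat M (case_nat (e j) (\<lambda>_. e 0)) (Q m)} =
      (\<lambda>e. e 0) ` Sat (Conj \<chi> (omit j m))"
    by (auto simp: Sat_def Env_def sat_omit)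
  finally show ?thesis using assms fm_in_omit by (auto simp: good_def)
qed

text \<open>Three successive strengthenings: decide \<open>\<phi>\<close>, name a counterexample if
  a universal \<open>\<phi>\<close> was refuted, and keep \<open>Var j\<close> from realizing the
  type. Inclusion of satisfaction sets plays the part of provability.\<close>

lemma good_extend:
  assumes "good \<chi>" "fm_in L \<phi>"
  shows "\<exists>\<chi>'. good \<chi>' \<and> Sat \<chi>' \<subseteq> Sat \<chi> \<and> (Sat \<chi>' \<subseteq> Sat \<phi> \<or> Sat \<chi>' \<subseteq> Sat (Neg \<phi>)) \<and>
    (\<forall>\<phi>'. \<phi> = Forall \<phi>' \<longrightarrow> Sat \<chi>' \<subseteq> Sat \<phi> \<or> (\<exists>w. Sat \<chi>' \<subseteq> Sat (Neg (subst (inst w) \<phi>')))) \<and>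
    (\<exists>m. Sat \<chi>' \<subseteq> Sat (omit j m))"
proof -
  obtain \<chi>1 where 1: "good \<chi>1" "Sat \<chi>1 \<subseteq> Sat \<chi>" "Sat \<chi>1 \<subseteq> Sat \<phi> \<or> Sat \<chi>1 \<subseteq> Sat (Neg \<phi>)"
  proof -
    have "Sat (Conj \<chi> \<theta>) \<subseteq> Sat \<chi>" "Sat (Conj \<chi> \<theta>) \<subseteq> Sat \<theta>" for \<theta> by (auto simp: Sat_def)
    with good_decide[OF assms] that show ?thesis by blast
  qed
  obtain \<chi>2 where 2: "good \<chi>2" "Sat \<chi>2 \<subseteq> Sat \<chi>1"
    "\<forall>\<phi>'. \<phi> = Forall \<phi>' \<longrightarrow> Sat \<chi>2 \<subseteq> Sat \<phi> \<or> (\<exists>w. Sat \<chi>2 \<subseteq> Sat (Neg (subst (inst w) \<phi>')))"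
  proof (cases "\<exists>\<phi>'. \<phi> = Forall \<phi>' \<and> Sat \<chi>1 \<subseteq> Sat (Neg \<phi>)")
    case True
    then obtain \<phi>' where \<phi>': "\<phi> = Forall \<phi>'" "Sat \<chi>1 \<subseteq> Sat (Neg (Forall \<phi>'))" by blast
    obtain w where "good (Conj \<chi>1 (Neg (subst (inst w) \<phi>')))"
      using good_witness[OF 1(1) \<phi>'(2)] assms(2) \<phi>'(1) by auto
    moreover have "Sat (Conj \<chi>1 \<theta>) \<subseteq> Sat \<chi>1" "Sat (Conj \<chi>1 \<theta>) \<subseteq> Sat \<theta>" for \<theta>
      by (auto simp: Sat_def)
    ultimately show ?thesis using that \<phi>'(1) by blast
  next
    case False
    then show ?thesis using that[of \<chi>1] 1 by blast
  qed
  obtain m where m: "good (Conj \<chi>2 (omit j m))" using good_omit[OF 2(1)] by blast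
  have sub: "Sat (Conj \<chi>2 (omit j m)) \<subseteq> Sat \<chi>2" "Sat (Conj \<chi>2 (omit j m)) \<subseteq> Sat (omit j m)"
    by (auto simp: Sat_def)
  show ?thesis
  proof (intro exI[of _ "Conj \<chi>2 (omit j m)"] conjI)
    show "Sat (Conj \<chi>2 (omit j m)) \<subseteq> Sat \<chi>" using 1(2) 2(2) sub(1) by order
    show "Sat (Conj \<chi>2 (omit j m)) \<subseteq> Sat \<phi> \<or> Sat (Conj \<chi>2 (omit j m)) \<subseteq> Sat (Neg \<phi>)"
      using 1(3) subset_trans[OF sub(1) 2(2)] by (elim disjE) (auto dest: subset_trans)
    show "\<forall>\<phi>'. \<phi> = Forall \<phi>' \<longrightarrow> Sat (Conj \<chi>2 (omit j m)) \<subseteq> Sat \<phi> \<or>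
        (\<exists>w. Sat (Conj \<chi>2 (omit j m)) \<subseteq> Sat (Neg (subst (inst w) \<phi>')))"
      using 2(3) subset_trans[OF sub(1)] by metis
    show "\<exists>m'. Sat (Conj \<chi>2 (omit j m)) \<subseteq> Sat (omit j m')" using sub(2) by blast
  qed (rule m)
qed

text \<open>Stage \<open>n\<close> treats both the \<open>n\<close>-th formula and the constant
  \<open>Var n\<close>, so every requirement is met at some finite stage.\<close>

lemma generic:
  "\<exists>X. (\<forall>n. good (X n) \<and> Sat (X (Suc n)) \<subseteq> Sat (X n)) \<and>
     (\<forall>\<phi>. fm_in L \<phi> \<longrightarrow> (\<exists>n. Sat (X n) \<subseteq> Sat \<phi> \<or> Sat (X n) \<subseteq> Sat (Neg \<phi>))) \<and>
     (\<forall>\<phi>. fm_in L \<phi> \<longrightarrow> (\<exists>n. Sat (X n) \<subseteq> Sat (Forall \<phi>) \<or> (\<exists>w. Sat (X n) \<subseteq> Sat (Neg (subst (inst w) \<phi>))))) \<and>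
     (\<forall>j. \<exists>n m. Sat (X n) \<subseteq> Sat (omit j m))"
proof -
  define enum where "enum = from_nat_into {\<phi>. fm_in L \<phi>}"
  have nonempty: "{\<phi>. fm_in L \<phi>} \<noteq> {}" by (metis empty_iff fm_in.simps(1) mem_Collect_eq)
  have enum: "fm_in L (enum n)" for n
    using from_nat_into[OF nonempty, of n] by (simp add: enum_def)
  have surj: "\<exists>n. enum n = \<phi>" if "fm_in L \<phi>" for \<phi>
    using from_nat_into_surj[OF countable_fm_in[OF L], of \<phi>] that by (auto simp: enum_def)
  define R where "R n \<chi> \<chi>' \<longleftrightarrow> Sat \<chi>' \<subseteq> Sat \<chi> \<and>
      (Sat \<chi>' \<subseteq> Sat (enum n) \<or> Sat \<chi>' \<subseteq> Sat (Neg (enum n))) \<and>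
      (\<forall>\<phi>'. enum n = Forall \<phi>' \<longrightarrow> Sat \<chi>' \<subseteq> Sat (enum n) \<or>
        (\<exists>w. Sat \<chi>' \<subseteq> Sat (Neg (subst (inst w) \<phi>')))) \<and>
      (\<exists>m. Sat \<chi>' \<subseteq> Sat (omit n m))" for n \<chi> \<chi>'
  have "\<exists>X. \<forall>n. good (X n) \<and> R n (X n) (X (Suc n))"
  proof (rule dependent_nat_choice)
    \<comment> \<open>The trivial condition is large because constant environments project onto all
      of \<open>Dom M\<close>.\<close>
    have "Dom M \<subseteq> (\<lambda>e. e 0) ` Sat (Neg FF)"
    proof
      fix a assume "a \<in> Dom M"
      then have "(\<lambda>_. a) \<in> Sat (Neg FF)" by (auto simp: Sat_def Env_def)
      then show "a \<in> (\<lambda>e. e 0) ` Sat (Neg FF)" by (intro image_eqI[of _ _ "\<lambda>_. a"]) simp_all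
    qed
    then have "good (Neg FF)" unfolding good_def using Pos_mono Pos_Dom by auto
    then show "\<exists>\<chi>. good \<chi>" by blast
  next
    fix \<chi> n assume "good \<chi>"
    from good_extend[OF this enum, of n n] show "\<exists>\<chi>'. good \<chi>' \<and> R n \<chi> \<chi>'"
      unfolding R_def by blast
  qed
  then obtain X where X: "\<And>n. good (X n)" "\<And>n. R n (X n) (X (Suc n))" by blast
  show ?thesis
  proof (intro exI[of _ X] conjI allI impI)
    show "good (X n)" "Sat (X (Suc n)) \<subseteq> Sat (X n)" for n using X by (simp_all add: R_def)
    show "\<exists>n. Sat (X n) \<subseteq> Sat \<phi> \<or> Sat (X n) \<subseteq> Sat (Neg \<phi>)" if "fm_in L \<phi>" for \<phi>
    proof -
      obtain n where "enum n = \<phi>" using surj[OF \<open>fm_in L \<phi>\<close>] by blast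
      with X(2)[of n] show ?thesis unfolding R_def by (intro exI[of _ "Suc n"]) simp
    qed
    show "\<exists>n m. Sat (X n) \<subseteq> Sat (omit j m)" for j
      using X(2)[of j] unfolding R_def by blast
    show "\<exists>n. Sat (X n) \<subseteq> Sat (Forall \<phi>) \<or> (\<exists>w. Sat (X n) \<subseteq> Sat (Neg (subst (inst w) \<phi>)))"
      if "fm_in L \<phi>" for \<phi>
    proof -
      obtain n where "enum n = Forall \<phi>" using surj[of "Forall \<phi>"] \<open>fm_in L \<phi>\<close> by auto
      with X(2)[of n] show ?thesis unfolding R_def by (intro exI[of _ "Suc n"]) simp
    qed
  qed
qed

section \<open>The generic filter and its model\<close>

definition X :: "nat \<Rightarrow> ('f, 'r) fm" where
  "X = (SOME X. (\<forall>n. good (X n) \<and> Sat (X (Suc n)) \<subseteq> Sat (X n)) \<and>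
     (\<forall>\<phi>. fm_in L \<phi> \<longrightarrow> (\<exists>n. Sat (X n) \<subseteq> Sat \<phi> \<or> Sat (X n) \<subseteq> Sat (Neg \<phi>))) \<and>
     (\<forall>\<phi>. fm_in L \<phi> \<longrightarrow> (\<exists>n. Sat (X n) \<subseteq> Sat (Forall \<phi>) \<or> (\<exists>w. Sat (X n) \<subseteq> Sat (Neg (subst (inst w) \<phi>))))) \<and>
     (\<forall>j. \<exists>n m. Sat (X n) \<subseteq> Sat (omit j m)))"

lemmas X = someI_ex[OF generic, folded X_def]

lemma X_good: "good (X n)" and X_step: "Sat (X (Suc n)) \<subseteq> Sat (X n)"
  using X[THEN conjunct1] by blast+

text \<open>The filter generated by the descending sets \<open>Sat (X n)\<close>. It is proper and
  decides every set defined by a formula of \<open>L\<close>, so a model can be read off from it as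
  from an ultrafilter.\<close>

definition F :: "(nat \<Rightarrow> 'm) set \<Rightarrow> bool" where
  "F A \<longleftrightarrow> (\<exists>n. Sat (X n) \<subseteq> A)"

lemma Sat_X_antimono: "m \<le> n \<Longrightarrow> Sat (X n) \<subseteq> Sat (X m)"
  by (rule lift_Suc_antimono_le[of "\<lambda>n. Sat (X n)", OF X_step])

lemma F_mono: "F A \<Longrightarrow> A \<subseteq> B \<Longrightarrow> F B"
  unfolding F_def by blast

lemma F_Int:
  assumes "F A" "F B" shows "F (A \<inter> B)"
proof -
  obtain m n where "Sat (X m) \<subseteq> A" "Sat (X n) \<subseteq> B" using assms by (auto simp: F_def)
  moreover have "Sat (X (max m n)) \<subseteq> Sat (X m)" "Sat (X (max m n)) \<subseteq> Sat (X n)"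
    by (auto intro!: Sat_X_antimono)
  ultimately show ?thesis unfolding F_def by blast
qed

lemma F_Env: "F Env"
  unfolding F_def Sat_def by blast

lemma F_not_empty: "\<not> F {}"
proof
  assume "F {}"
  then obtain n where "Sat (X n) = {}" by (auto simp: F_def)
  moreover have "good (X n)" by (rule X_good)
  ultimately show False by (simp add: good_def Pos_empty)
qed

lemma F_disjoint: "F A \<Longrightarrow> F B \<Longrightarrow> A \<inter> B \<noteq> {}"
  using F_Int F_not_empty by metis

lemma F_decide: "fm_in L \<phi> \<Longrightarrow> F (Sat \<phi>) \<or> F (Sat (Neg \<phi>))"
  using X[THEN conjunct2, THEN conjunct1] unfolding F_def by blast

lemma F_witness: "fm_in L \<phi> \<Longrightarrow> F (Sat (Forall \<phi>)) \<or> (\<exists>w. F (Sat (Neg (subst (inst w) \<phi>))))"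
  using X[THEN conjunct2, THEN conjunct2, THEN conjunct1] unfolding F_def by blast

lemma F_omit: "\<exists>m. F (Sat (omit j m))"
  using X[THEN conjunct2, THEN conjunct2, THEN conjunct2] unfolding F_def by blast

lemma F_cong: "F C \<Longrightarrow> C \<inter> A = C \<inter> B \<Longrightarrow> F A \<longleftrightarrow> F B"
  by (metis F_Int F_mono inf_le2)

lemma F_finite: "finite I \<Longrightarrow> (\<And>i. i \<in> I \<Longrightarrow> F (A i)) \<Longrightarrow> F {e \<in> Env. \<forall>i\<in>I. e \<in> A i}"
proof (induction rule: finite_induct)
  case empty
  then show ?case using F_Env by simp
next
  case (insert i I)
  then have "F (A i \<inter> {e \<in> Env. \<forall>i\<in>I. e \<in> A i})" by (intro F_Int) auto
  then show ?case by (rule F_mono) auto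
qed

text \<open>Canonical index of the class of \<open>t\<close> modulo the filter. A least index in
  place of an equivalence class is a number, which \<open>h\<close> can carry into
  \<open>'m\<close>.\<close>

definition kap :: "'f tm \<Rightarrow> nat" where
  "kap t = (LEAST k. F {e \<in> Env. eval M e t = e k})"

lemma F_kap:
  assumes "tm_in L t" shows "F {e \<in> Env. eval M e t = e (kap t)}"
proof -
  \<comment> \<open>Universally quantified, this says that nothing equals \<open>t\<close>, which no
    environment satisfies; the counterexample given by \<open>F_witness\<close> is a constant equal
    to \<open>t\<close>.\<close>
  let ?\<phi> = "Neg (Eq (lift_tm t) (Var 0))"
  have "tm_in L (lift_tm t)" using assms by (simp add: lift_tm_def tm_in_subst)
  then have "fm_in L ?\<phi>" by simp
  moreover have "Sat (Forall ?\<phi>) = {}"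
    using eval_in_Dom[OF M assms] by (auto simp: Sat_def Env_def)
  ultimately obtain w where "F (Sat (Neg (subst (inst w) ?\<phi>)))"
    using F_witness F_not_empty by metis
  also have "Sat (Neg (subst (inst w) ?\<phi>)) = {e \<in> Env. eval M e t = e w}"
    by (auto simp: Sat_def lift_tm_def eval_subst_tm inst_def)
  finally show ?thesis unfolding kap_def by (rule LeastI)
qed

lemma kap_eq:
  assumes "tm_in L s" "tm_in L t"
  shows "kap s = kap t \<longleftrightarrow> F {e \<in> Env. eval M e s = eval M e t}"
proof
  assume "kap s = kap t"
  then show "F {e \<in> Env. eval M e s = eval M e t}"
    using F_Int[OF F_kap[OF assms(1)] F_kap[OF assms(2)]] by (elim F_mono) auto
next
  assume *: "F {e \<in> Env. eval M e s = eval M e t}"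
  have "F {e \<in> Env. eval M e s = e k} \<longleftrightarrow> F {e \<in> Env. eval M e t = e k}" for k
    by (rule F_cong[OF *]) auto
  then show "kap s = kap t" by (simp add: kap_def)
qed

lemma kap_Var_kap: "tm_in L t \<Longrightarrow> kap (Var (kap t)) = kap t"
  using F_kap[of t] kap_eq[of t "Var (kap t)"] by simp

definition name :: "'m \<Rightarrow> nat" where "name = inv h"

lemma name_h [simp]: "name (h k) = k"
  using h by (simp add: name_def)

text \<open>Elements are canonical indices moved into \<open>'m\<close> by \<open>h\<close>; the
  operations recover the indices by \<open>name\<close> and act on the constants
  \<open>Var k\<close>.\<close>

definition N :: "('f, 'r, 'm) struc" where
  "N = \<lparr>Dom = {h (kap t) | t. tm_in L t},
     zeroI = h (kap Zero), oneI = h (kap One),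
     addI = \<lambda>a b. h (kap (Add (Var (name a)) (Var (name b)))),
     mulI = \<lambda>a b. h (kap (Mul (Var (name a)) (Var (name b)))),
     lessI = \<lambda>a b. F {e \<in> Env. lessI M (e (name a)) (e (name b))},
     funI = \<lambda>f as. h (kap (Fun f (map (\<lambda>a. Var (name a)) as))),
     relI = \<lambda>r as. F {e \<in> Env. relI M r (map (\<lambda>a. e (name a)) as)}\<rparr>"

lemma N_sel [simp]:
  "Dom N = {h (kap t) | t. tm_in L t}"
  "zeroI N = h (kap Zero)" "oneI N = h (kap One)"
  "addI N a b = h (kap (Add (Var (name a)) (Var (name b))))"
  "mulI N a b = h (kap (Mul (Var (name a)) (Var (name b))))"
  "lessI N a b = F {e \<in> Env. lessI M (e (name a)) (e (name b))}"
  "funI N f as = h (kap (Fun f (map (\<lambda>a. Var (name a)) as)))"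
  "relI N r as = F {e \<in> Env. relI M r (map (\<lambda>a. e (name a)) as)}"
  by (simp_all add: N_def)

lemma structure_N: "structure_for L N"
proof -
  have "tm_in L (Fun f (map (\<lambda>a. Var (name a)) as))" if "(f, length as) \<in> Fsyms L" for f as
    using that by (auto simp: list_all_iff)
  then show ?thesis
    unfolding structure_for_def N_sel mem_Collect_eq by (fastforce intro: exI[of _ Zero] exI[of _ One])
qed

text \<open>The condition on \<open>\<rho>\<close> says that it takes canonical indices only, so
  that the element \<open>h (\<rho> i)\<close> is the one denoted by the constant
  \<open>Var (\<rho> i)\<close>.\<close>

lemma eval_N:
  assumes \<rho>: "\<And>i. kap (Var (\<rho> i)) = \<rho> i" and "tm_in L t"
  shows "eval N (\<lambda>i. h (\<rho> i)) t = h (kap (subst_tm (\<lambda>i. Var (\<rho> i)) t))"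
  using assms(2)
proof (induction t)
  case (Var i)
  then show ?case by (simp add: \<rho>)
next
  case (Add s t)
  let ?s = "subst_tm (\<lambda>i. Var (\<rho> i)) s" and ?t = "subst_tm (\<lambda>i. Var (\<rho> i)) t"
  have in_L: "tm_in L ?s" "tm_in L ?t" using Add.prems by (auto intro: tm_in_subst)
  from F_Int[OF F_kap[OF in_L(1)] F_kap[OF in_L(2)]]
  have "kap (Add (Var (kap ?s)) (Var (kap ?t))) = kap (Add ?s ?t)"
    by (subst kap_eq) (auto simp: in_L elim: F_mono)
  then show ?case using Add by simp
next
  case (Mul s t)
  let ?s = "subst_tm (\<lambda>i. Var (\<rho> i)) s" and ?t = "subst_tm (\<lambda>i. Var (\<rho> i)) t"
  have in_L: "tm_in L ?s" "tm_in L ?t" using Mul.prems by (auto intro: tm_in_subst)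
  from F_Int[OF F_kap[OF in_L(1)] F_kap[OF in_L(2)]]
  have "kap (Mul (Var (kap ?s)) (Var (kap ?t))) = kap (Mul ?s ?t)"
    by (subst kap_eq) (auto simp: in_L elim: F_mono)
  then show ?case using Mul by simp
next
  case (Fun f ts)
  let ?\<sigma> = "subst_tm (\<lambda>i. Var (\<rho> i))"
  have in_L: "tm_in L (?\<sigma> t)" if "t \<in> set ts" for t
    using Fun.prems that by (auto intro: tm_in_subst simp: list_all_iff)
  have "F {e \<in> Env. \<forall>t\<in>set ts. e \<in> {e \<in> Env. eval M e (?\<sigma> t) = e (kap (?\<sigma> t))}}"
    by (rule F_finite) (auto intro: F_kap in_L)
  then have "F {e \<in> Env. eval M e (Fun f (map (\<lambda>t. Var (kap (?\<sigma> t))) ts)) = eval M e (Fun f (map ?\<sigma> ts))}"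
    by (rule F_mono) (auto simp: comp_def intro!: arg_cong[of _ _ "funI M f"] map_cong)
  moreover have "tm_in L (Fun f (map (\<lambda>t. Var (kap (?\<sigma> t))) ts))" "tm_in L (Fun f (map ?\<sigma> ts))"
    using Fun.prems in_L by (auto simp: list_all_iff)
  ultimately have "kap (Fun f (map (\<lambda>t. Var (kap (?\<sigma> t))) ts)) = kap (Fun f (map ?\<sigma> ts))"
    using kap_eq by blast
  moreover have "map (eval N (\<lambda>i. h (\<rho> i))) ts = map (\<lambda>t. h (kap (?\<sigma> t))) ts"
    using Fun by (auto simp: list_all_iff)
  ultimately have "eval N (\<lambda>i. h (\<rho> i)) (Fun f ts) = funI N f (map (\<lambda>t. h (kap (?\<sigma> t))) ts)"
    "funI N f (map (\<lambda>t. h (kap (?\<sigma> t))) ts) = h (kap (Fun f (map ?\<sigma> ts)))"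
    by (simp_all only: eval.simps) (simp add: comp_def)
  then show ?case by simp
qed simp_all

text \<open>The analogue of the theorem of Los for the filter \<open>F\<close>: implication rests on
  \<open>F_decide\<close>, the universal quantifier on \<open>F_witness\<close>.\<close>

lemma sat_N:
  assumes "\<And>i. kap (Var (\<rho> i)) = \<rho> i" and "fm_in L \<phi>"
  shows "sat N (\<lambda>i. h (\<rho> i)) \<phi> \<longleftrightarrow> F {e \<in> Env. sat M (\<lambda>i. e (\<rho> i)) \<phi>}"
  using assms
proof (induction \<phi> arbitrary: \<rho>)
  case FF
  then show ?case using F_not_empty by simp
next
  case (Eq s t)
  then have "tm_in L (subst_tm (\<lambda>i. Var (\<rho> i)) s)" "tm_in L (subst_tm (\<lambda>i. Var (\<rho> i)) t)"
    by (auto intro: tm_in_subst)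
  from kap_eq[OF this] show ?case
    using Eq h by (simp add: eval_N eval_subst_tm inj_eq)
next
  case (Less s t)
  let ?s = "subst_tm (\<lambda>i. Var (\<rho> i)) s" and ?t = "subst_tm (\<lambda>i. Var (\<rho> i)) t"
  have in_L: "tm_in L ?s" "tm_in L ?t" using Less.prems by (auto intro: tm_in_subst)
  have "F {e \<in> Env. lessI M (e (kap ?s)) (e (kap ?t))} \<longleftrightarrow>
      F {e \<in> Env. lessI M (eval M e ?s) (eval M e ?t)}"
    by (rule F_cong[OF F_Int[OF F_kap[OF in_L(1)] F_kap[OF in_L(2)]]]) auto
  then show ?case using Less by (simp add: eval_N eval_subst_tm)
next
  case (Rel r ts)
  let ?\<sigma> = "subst_tm (\<lambda>i. Var (\<rho> i))"
  have in_L: "tm_in L (?\<sigma> t)" if "t \<in> set ts" for t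
    using Rel.prems that by (auto intro: tm_in_subst simp: list_all_iff)
  have *: "F {e \<in> Env. \<forall>t\<in>set ts. e \<in> {e \<in> Env. eval M e (?\<sigma> t) = e (kap (?\<sigma> t))}}"
    by (rule F_finite) (auto intro: F_kap in_L)
  have "map (eval N (\<lambda>i. h (\<rho> i))) ts = map (\<lambda>t. h (kap (?\<sigma> t))) ts"
    using Rel by (auto simp: list_all_iff eval_N)
  then have "sat N (\<lambda>i. h (\<rho> i)) (Rel r ts) \<longleftrightarrow> relI N r (map (\<lambda>t. h (kap (?\<sigma> t))) ts)"
    by (simp only: sat.simps)
  also have "\<dots> \<longleftrightarrow> F {e \<in> Env. relI M r (map (\<lambda>t. e (kap (?\<sigma> t))) ts)}"
    by (simp add: comp_def)
  also have "\<dots> \<longleftrightarrow> F {e \<in> Env. relI M r (map (\<lambda>t. eval M e (?\<sigma> t)) ts)}"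
  proof (rule F_cong[OF *])
    have eq: "map (\<lambda>t. e (kap (?\<sigma> t))) ts = map (\<lambda>t. eval M e (?\<sigma> t)) ts"
      if "e \<in> {e \<in> Env. \<forall>t\<in>set ts. e \<in> {e \<in> Env. eval M e (?\<sigma> t) = e (kap (?\<sigma> t))}}" for e
      using that by auto
    show "{e \<in> Env. \<forall>t\<in>set ts. e \<in> {e \<in> Env. eval M e (?\<sigma> t) = e (kap (?\<sigma> t))}} \<inter>
        {e \<in> Env. relI M r (map (\<lambda>t. e (kap (?\<sigma> t))) ts)} =
      {e \<in> Env. \<forall>t\<in>set ts. e \<in> {e \<in> Env. eval M e (?\<sigma> t) = e (kap (?\<sigma> t))}} \<inter>
        {e \<in> Env. relI M r (map (\<lambda>t. eval M e (?\<sigma> t)) ts)}" (is "?C \<inter> ?A = ?C \<inter> ?B")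
    proof (intro set_eqI)
      fix e
      show "e \<in> ?C \<inter> ?A \<longleftrightarrow> e \<in> ?C \<inter> ?B"
        unfolding Int_iff mem_Collect_eq[of e "\<lambda>e. e \<in> Env \<and> relI M r (_ e)"]
        using eq[of e] by (metis (no_types, lifting))
    qed
  qed
  also have "(\<lambda>e. map (\<lambda>t. eval M e (?\<sigma> t)) ts) = (\<lambda>e. map (eval M (\<lambda>i. e (\<rho> i))) ts)"
    by (simp add: eval_subst_tm)
  finally show ?case by (simp add: eval_subst_tm)
next
  case (Imp \<phi> \<psi>)
  let ?A = "\<lambda>\<phi>. {e \<in> Env. sat M (\<lambda>i. e (\<rho> i)) \<phi>}"
  have A: "?A \<theta> = Sat (subst (\<lambda>i. Var (\<rho> i)) \<theta>)" for \<theta> by (simp add: Sat_def sat_subst)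
  have "fm_in L (subst (\<lambda>i. Var (\<rho> i)) \<theta>)" if "fm_in L \<theta>" for \<theta>
    using that by (intro fm_in_subst) auto
  then have decide: "F (?A \<theta>) \<or> F (?A (Neg \<theta>))" if "fm_in L \<theta>" for \<theta>
    using F_decide[of "subst (\<lambda>i. Var (\<rho> i)) \<theta>"] that unfolding A by simp
  have "(F (?A \<phi>) \<longrightarrow> F (?A \<psi>)) \<longleftrightarrow> F (?A (Imp \<phi> \<psi>))"
  proof
    assume "F (?A \<phi>) \<longrightarrow> F (?A \<psi>)"
    then consider "F (?A (Neg \<phi>))" | "F (?A \<psi>)" using decide[of \<phi>] Imp.prems by auto
    then show "F (?A (Imp \<phi> \<psi>))" by cases (erule F_mono, auto)+
  next
    assume imp: "F (?A (Imp \<phi> \<psi>))"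
    show "F (?A \<phi>) \<longrightarrow> F (?A \<psi>)"
    proof
      assume "F (?A \<phi>)"
      from F_Int[OF imp this] show "F (?A \<psi>)" by (rule F_mono) auto
    qed
  qed
  then show ?case using Imp by simp
next
  case (Forall \<phi>)
  have h_case: "case_nat (h k) (\<lambda>i. h (\<rho> i)) = (\<lambda>i. h (case_nat k \<rho> i))" for k
    by (auto split: nat.split)
  have e_case: "(\<lambda>i. e (case_nat k \<rho> i)) = case_nat (e k) (\<lambda>i. e (\<rho> i))" for e :: "nat \<Rightarrow> 'm" and k
    by (auto split: nat.split)
  have IH: "sat N (case_nat (h (kap t)) (\<lambda>i. h (\<rho> i))) \<phi> \<longleftrightarrow>
      F {e \<in> Env. sat M (case_nat (e (kap t)) (\<lambda>i. e (\<rho> i))) \<phi>}" if "tm_in L t" for t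
  proof -
    have "kap (Var (case_nat (kap t) \<rho> i)) = case_nat (kap t) \<rho> i" for i
      using that by (auto simp: kap_Var_kap Forall.prems split: nat.split)
    from Forall.IH[OF this] have "sat N (case_nat (h (kap t)) (\<lambda>i. h (\<rho> i))) \<phi> \<longleftrightarrow>
        F {e \<in> Env. sat M (\<lambda>i. e (case_nat (kap t) \<rho> i)) \<phi>}"
      using Forall.prems by (simp only: h_case fm_in.simps)
    also have "{e \<in> Env. sat M (\<lambda>i. e (case_nat (kap t) \<rho> i)) \<phi>} =
        {e \<in> Env. sat M (case_nat (e (kap t)) (\<lambda>i. e (\<rho> i))) \<phi>}"
    proof (intro Collect_cong conj_cong refl)
      fix e
      show "sat M (\<lambda>i. e (case_nat (kap t) \<rho> i)) \<phi> = sat M (case_nat (e (kap t)) (\<lambda>i. e (\<rho> i))) \<phi>"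
        by (rule arg_cong[where f = "\<lambda>e. sat M e \<phi>", OF e_case])
    qed
    finally show ?thesis .
  qed
  show ?case
  proof
    assume *: "sat N (\<lambda>i. h (\<rho> i)) (Forall \<phi>)"
    \<comment> \<open>The free variables other than the quantified one are renamed to the constants
      given by \<open>\<rho>\<close>, so that \<open>F_witness\<close> applies to the renamed
      formula.\<close>
    let ?\<sigma> = "case_nat (Var 0) (\<lambda>i. Var (Suc (\<rho> i)))"
    have \<sigma>: "(\<lambda>i. eval M (case_nat a e) (?\<sigma> i)) = case_nat a (\<lambda>i. e (\<rho> i))" for a e
      by (auto split: nat.split)
    have "fm_in L (subst ?\<sigma> \<phi>)"
      using Forall.prems by (intro fm_in_subst) (auto split: nat.split)
    then consider "F (Sat (Forall (subst ?\<sigma> \<phi>)))" | w where "F (Sat (Neg (subst (inst w) (subst ?\<sigma> \<phi>))))"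
      using F_witness by blast
    then show "F {e \<in> Env. sat M (\<lambda>i. e (\<rho> i)) (Forall \<phi>)}"
    proof cases
      case 1
      then show ?thesis by (simp add: Sat_def sat_subst \<sigma>)
    next
      case (2 w)
      have "h (kap (Var w)) \<in> Dom N" by (auto intro!: exI[of _ "Var w"])
      with * have "sat N (case_nat (h (kap (Var w))) (\<lambda>i. h (\<rho> i))) \<phi>"
        unfolding sat.simps by (rule bspec)
      then have "F {e \<in> Env. sat M (case_nat (e (kap (Var w))) (\<lambda>i. e (\<rho> i))) \<phi>}"
        using IH[of "Var w"] by simp
      moreover have "F {e \<in> Env. \<not> sat M (case_nat (e w) (\<lambda>i. e (\<rho> i))) \<phi>}"
        using 2 unfolding Sat_def sat.simps sat_inst by (simp add: sat_subst \<sigma>)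
      ultimately have False
        using F_disjoint[OF F_Int[OF _ F_kap[of "Var w"]]] by fastforce
      then show ?thesis ..
    qed
  next
    assume *: "F {e \<in> Env. sat M (\<lambda>i. e (\<rho> i)) (Forall \<phi>)}"
    have "F {e \<in> Env. sat M (case_nat (e (kap t)) (\<lambda>i. e (\<rho> i))) \<phi>}" for t
      using * by (rule F_mono) (auto simp: Env_def)
    then show "sat N (\<lambda>i. h (\<rho> i)) (Forall \<phi>)" using IH by auto
  qed
qed

lemma env_N:
  assumes "range e \<subseteq> Dom N"
  obtains \<rho> where "e = (\<lambda>i. h (\<rho> i))" "\<And>i. kap (Var (\<rho> i)) = \<rho> i"
proof
  have "\<exists>t. tm_in L t \<and> e i = h (kap t)" for i
    using assms by (auto simp: image_subset_iff)
  then show "e = (\<lambda>i. h (name (e i)))" "\<And>i. kap (Var (name (e i))) = name (e i)"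
    by (metis name_h, metis name_h kap_Var_kap)
qed

text \<open>A formula valid in \<open>M\<close> is satisfied on all of \<open>Env\<close>, which
  lies in the filter, so \<open>sat_N\<close> transfers it. An element with index
  \<open>kap t\<close> does not realize the type, since the constant \<open>Var (kap t)\<close> was
  treated at its own stage.\<close>

theorem omitting_model:
  "\<exists>N :: ('f, 'r, 'm) struc. \<exists>c\<in>Dom N. structure_for L N \<and>
     (\<forall>\<phi>. fm_in L \<phi> \<and> (\<forall>e. range e \<subseteq> Dom M \<longrightarrow> sat M e \<phi>) \<longrightarrow> (\<forall>e. range e \<subseteq> Dom N \<longrightarrow> sat N e \<phi>)) \<and>
     (\<forall>b\<in>Dom N. \<exists>m. \<not> sat N (case_nat b (\<lambda>_. c)) (Q m))"
proof (intro exI[of _ N] bexI[of _ "h (kap (Var 0))"] conjI allI impI ballI)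
  show "structure_for L N" by (rule structure_N)
  show "h (kap (Var 0)) \<in> Dom N" by (auto intro!: exI[of _ "Var 0"])
  show "sat N e \<phi>" if \<phi>: "fm_in L \<phi> \<and> (\<forall>e. range e \<subseteq> Dom M \<longrightarrow> sat M e \<phi>)" and e: "range e \<subseteq> Dom N" for e \<phi>
  proof -
    obtain \<rho> where \<rho>: "e = (\<lambda>i. h (\<rho> i))" "\<And>i. kap (Var (\<rho> i)) = \<rho> i" using env_N[OF e] by blast
    have "F {e \<in> Env. sat M (\<lambda>i. e (\<rho> i)) \<phi>}"
      by (rule F_mono[OF F_Env]) (use \<phi> in \<open>auto simp: Env_def image_subset_iff\<close>)
    then show ?thesis using sat_N[OF \<rho>(2)] \<phi> \<rho>(1) by simp
  qed
  show "\<exists>m. \<not> sat N (case_nat b (\<lambda>_. h (kap (Var 0)))) (Q m)" if b: "b \<in> Dom N" for b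
  proof -
    obtain t where t: "tm_in L t" "b = h (kap t)" using b by auto
    let ?\<rho> = "case_nat (kap t) (\<lambda>_. kap (Var 0))"
    have \<rho>: "kap (Var (?\<rho> i)) = ?\<rho> i" for i
      using t by (auto simp: kap_Var_kap split: nat.split)
    obtain m where m: "F (Sat (omit (kap t) m))" using F_omit by blast
    have b_case: "case_nat b (\<lambda>_. h (kap (Var 0))) = (\<lambda>i. h (?\<rho> i))"
      by (auto simp: t split: nat.split)
    have "\<not> F {e \<in> Env. sat M (\<lambda>i. e (?\<rho> i)) (Q m)}"
    proof
      assume "F {e \<in> Env. sat M (\<lambda>i. e (?\<rho> i)) (Q m)}"
      \<comment> \<open>The distinguished element has index \<open>kap (Var 0)\<close>, whereas
        \<open>omit\<close> speaks of \<open>Var 0\<close>; by \<open>F_kap\<close> the two agree on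
        a set in the filter.\<close>
      from F_disjoint[OF F_Int[OF this F_kap[of "Var 0"]] m]
      obtain e where "sat M (\<lambda>i. e (?\<rho> i)) (Q m)" "e 0 = e (kap (Var 0))"
        "\<not> sat M (case_nat (e (kap t)) (\<lambda>_. e 0)) (Q m)"
        by (auto simp: Sat_def sat_omit)
      moreover have "(\<lambda>i. e (?\<rho> i)) = case_nat (e (kap t)) (\<lambda>_. e (kap (Var 0)))"
        by (auto split: nat.split)
      ultimately show False by simp
    qed
    then show ?thesis
      by (intro exI[of _ m]) (simp only: b_case sat_N[OF \<rho> Q] not_False_eq_True)
  qed
qed

end

section \<open>Primitive recursive functions on numbers\<close>

definition pr :: "(nat list \<Rightarrow> nat) \<Rightarrow> bool" where
  "pr F \<longleftrightarrow> F \<in> range pr_eval"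

lemma pr_arg: "pr (arg i)"
  unfolding pr_def by (rule range_eqI[of _ _ "PProj i"]) simp

lemma pr_comp: "pr F \<Longrightarrow> \<forall>G\<in>set Gs. pr G \<Longrightarrow> pr (\<lambda>xs. F (map (\<lambda>G. G xs) Gs))"
proof -
  assume F: "pr F" and Gs: "\<forall>G\<in>set Gs. pr G"
  from Gs have "\<exists>gs. Gs = map pr_eval gs"
  proof (induction Gs)
    case (Cons G Gs)
    then obtain gs g where "Gs = map pr_eval gs" "G = pr_eval g" by (auto simp: pr_def)
    then have "G # Gs = map pr_eval (g # gs)" by simp
    then show ?case by (rule exI)
  qed simp
  moreover obtain f where "F = pr_eval f" using F by (auto simp: pr_def)
  ultimately obtain gs where "F = pr_eval f" "Gs = map pr_eval gs" by blast
  then have "(\<lambda>xs. F (map (\<lambda>G. G xs) Gs)) = pr_eval (PComp f gs)"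
    by (simp add: comp_op_def fun_eq_iff)
  then show ?thesis unfolding pr_def by (rule range_eqI)
qed

lemma pr_comp1: "pr F \<Longrightarrow> pr G \<Longrightarrow> pr (\<lambda>xs. F [G xs])"
  using pr_comp[of F "[G]"] by simp

lemma pr_comp2: "pr F \<Longrightarrow> pr G \<Longrightarrow> pr H \<Longrightarrow> pr (\<lambda>xs. F [G xs, H xs])"
  using pr_comp[of F "[G, H]"] by simp

lemma arg_Cons [simp]: "arg 0 (x # xs) = x" "arg (Suc i) (x # xs) = arg i xs"
  by (simp_all add: arg_def)

lemma arg_Nil [simp]: "arg i [] = 0"
  by (simp add: arg_def)

lemma pr_Suc: "pr F \<Longrightarrow> pr (\<lambda>xs. Suc (F xs))"
proof -
  assume "pr F"
  moreover have "pr (\<lambda>xs. Suc (arg 0 xs))"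
    unfolding pr_def by (rule range_eqI[of _ _ PSucc]) simp
  ultimately show ?thesis using pr_comp1 by fastforce
qed

lemma pr_const: "pr (\<lambda>_. c)"
proof (induction c)
  case 0
  show ?case unfolding pr_def by (rule range_eqI[of _ _ PZero]) simp
qed (rule pr_Suc)

lemma pr_rec:
  assumes "pr a" "pr b" "pr K" "pr C"
  shows "pr (\<lambda>xs. rec_nat (a [C xs]) (\<lambda>m r. b [r, m, C xs]) (K xs))"
proof -
  obtain f g where "a = pr_eval f" "b = pr_eval g" using assms by (auto simp: pr_def)
  then have "prec_op a b = pr_eval (PRec f g)" by simp
  then have "pr (prec_op a b)" unfolding pr_def by (rule range_eqI)
  from pr_comp2[OF this assms(3,4)] show ?thesis by (simp add: prec_op_def)
qed

definition pr1 :: "(nat \<Rightarrow> nat) \<Rightarrow> bool" where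
  "pr1 f \<longleftrightarrow> pr (\<lambda>xs. f (arg 0 xs))"

definition pr2 :: "(nat \<Rightarrow> nat \<Rightarrow> nat) \<Rightarrow> bool" where
  "pr2 f \<longleftrightarrow> pr (\<lambda>xs. f (arg 0 xs) (arg 1 xs))"

lemma pr_pr1: "pr1 f \<Longrightarrow> pr G \<Longrightarrow> pr (\<lambda>xs. f (G xs))"
  using pr_comp1[of "\<lambda>xs. f (arg 0 xs)" G] by (simp add: pr1_def)

lemma pr_pr2: "pr2 f \<Longrightarrow> pr G \<Longrightarrow> pr H \<Longrightarrow> pr (\<lambda>xs. f (G xs) (H xs))"
  using pr_comp2[of "\<lambda>xs. f (arg 0 xs) (arg 1 xs)" G H] by (simp add: pr2_def)

lemma pr2_rec:
  assumes "pr (\<lambda>xs. A (arg 0 xs))" "pr (\<lambda>xs. B (arg 0 xs) (arg 1 xs) (arg 2 xs))"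
    and "\<And>n x. f n x = rec_nat (A x) (\<lambda>m r. B r m x) n"
  shows "pr2 f"
  using pr_rec[OF assms(1,2) pr_arg[of 0] pr_arg[of 1]]
  by (simp add: pr2_def assms(3) numeral_2_eq_2)

lemma pr2_swap: "pr2 (\<lambda>x y. f y x) \<Longrightarrow> pr2 f"
  using pr_pr2[of "\<lambda>x y. f y x" "arg 1" "arg 0"] by (simp add: pr2_def pr_arg)

lemma pr2_add: "pr2 (+)"
proof (rule pr2_rec)
  show "n + x = rec_nat x (\<lambda>m r. Suc r) n" for n x :: nat by (induction n) auto
qed (intro pr_arg pr_Suc pr_const)+

lemma pr1_pred: "pr1 (\<lambda>n. n - 1)"
proof -
  have "pr2 (\<lambda>n x. n - 1)"
  proof (rule pr2_rec)
    show "n - 1 = rec_nat 0 (\<lambda>m r. m) n" for n x :: nat by (cases n) auto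
  qed (intro pr_arg pr_const)+
  from pr_pr2[OF this pr_arg[of 0] pr_arg[of 0]] show ?thesis by (simp add: pr1_def)
qed

lemma pr2_minus: "pr2 (-)"
proof (rule pr2_swap, rule pr2_rec)
  show "x - n = rec_nat x (\<lambda>m r. r - 1) n" for n x :: nat by (induction n) auto
qed (intro pr_arg pr_pr1[OF pr1_pred])+

lemma pr2_times: "pr2 (*)"
proof (rule pr2_rec)
  show "n * x = rec_nat 0 (\<lambda>m r. r + x) n" for n x :: nat by (induction n) auto
qed (intro pr_arg pr_const pr_pr2[OF pr2_add])+

lemma pr1_triangle: "pr1 triangle"
proof -
  have "pr2 (\<lambda>n x. triangle n)"
  proof (rule pr2_rec)
    show "triangle n = rec_nat 0 (\<lambda>m r. r + Suc m) n" for n x :: nat by (induction n) auto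
  qed (intro pr_arg pr_const pr_Suc pr_pr2[OF pr2_add])+
  from pr_pr2[OF this pr_arg[of 0] pr_arg[of 0]] show ?thesis by (simp add: pr1_def)
qed

section \<open>Cantor pairing and its inverses\<close>

abbreviation pair :: "nat \<Rightarrow> nat \<Rightarrow> nat" where
  "pair a b \<equiv> prod_encode (a, b)"

definition pi1 :: "nat \<Rightarrow> nat" where "pi1 x = fst (prod_decode x)"
definition pi2 :: "nat \<Rightarrow> nat" where "pi2 x = snd (prod_decode x)"

lemma pi_pair [simp]: "pi1 (pair a b) = a" "pi2 (pair a b) = b"
  by (simp_all add: pi1_def pi2_def)

lemma pair_pi [simp]: "pair (pi1 x) (pi2 x) = x"
  by (simp add: pi1_def pi2_def)

lemma pr2_pair: "pr2 pair"
proof -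
  have "pr (\<lambda>xs. triangle (arg 0 xs + arg 1 xs) + arg 0 xs)"
    by (intro pr_pr2[OF pr2_add] pr_pr1[OF pr1_triangle] pr_arg)
  then show ?thesis by (simp add: pr2_def prod_encode_def)
qed

lemma pr_if_le:
  assumes "pr f" "pr g" "pr a" "pr b"
  shows "pr (\<lambda>xs. if f xs \<le> g xs then a xs else b xs)"
proof -
  \<comment> \<open>With truncated subtraction, \<open>1 - (f xs - g xs)\<close> is the truth value
    of \<open>f xs \<le> g xs\<close>.\<close>
  have "pr (\<lambda>xs. (1 - (f xs - g xs)) * a xs + (1 - (1 - (f xs - g xs))) * b xs)"
    by (intro pr_pr2[OF pr2_add] pr_pr2[OF pr2_times] pr_pr2[OF pr2_minus] pr_const assms)
  also have "(\<lambda>xs. (1 - (f xs - g xs)) * a xs + (1 - (1 - (f xs - g xs))) * b xs) =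
      (\<lambda>xs. if f xs \<le> g xs then a xs else b xs)"
    by (intro ext) (auto simp: not_le)
  finally show ?thesis .
qed

lemma pr1_pi1: "pr1 pi1"
  and pr1_pi2: "pr1 pi2"
proof -
  \<comment> \<open>\<open>s n\<close> is the diagonal on which \<open>n\<close> lies: it grows by
    one whenever the next triangular number is reached. The pair \<open>a, b\<close> has diagonal
    \<open>a + b\<close> and position \<open>a\<close> on it.\<close>
  define s where "s = rec_nat 0 (\<lambda>m r. if triangle (Suc r) \<le> Suc m then Suc r else r)"
  have s: "triangle (s n) \<le> n \<and> n < triangle (Suc (s n))" for n
    by (induction n) (auto simp: s_def)
  have "pr2 (\<lambda>n x. s n)"
    unfolding s_def
    by (rule pr2_rec[where A = "\<lambda>x. 0"
          and B = "\<lambda>r m x. if triangle (Suc r) \<le> Suc m then Suc r else r"])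
       (intro pr_const, intro pr_if_le pr_arg pr_Suc pr_pr1[OF pr1_triangle], rule refl)
  from pr_pr2[OF this pr_arg[of 0] pr_arg[of 0]] have "pr1 s" by (simp add: pr1_def)
  have s_pair: "s (pair a b) = a + b" for a b
  proof -
    have mono: "i \<le> j \<Longrightarrow> triangle i \<le> triangle j" for i j
      by (induction j) (auto simp: le_Suc_eq)
    have 1: "triangle (a + b) \<le> pair a b" "pair a b < triangle (Suc (a + b))"
      by (simp_all add: prod_encode_def)
    show ?thesis
    proof (rule antisym; rule ccontr)
      assume "\<not> s (pair a b) \<le> a + b"
      then have "triangle (Suc (a + b)) \<le> triangle (s (pair a b))" by (intro mono) simp
      then show False using 1 s[of "pair a b"] by linarith
    next
      assume "\<not> a + b \<le> s (pair a b)"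
      then have "triangle (Suc (s (pair a b))) \<le> triangle (a + b)" by (intro mono) simp
      then show False using 1 s[of "pair a b"] by linarith
    qed
  qed
  have 1: "pi1 x = x - triangle (s x)" for x
  proof -
    obtain a b where x: "x = pair a b" by (metis pair_pi)
    show ?thesis by (simp only: x s_pair pi_pair) (simp add: prod_encode_def)
  qed
  have 2: "pi2 x = s x - pi1 x" for x
  proof -
    obtain a b where x: "x = pair a b" by (metis pair_pi)
    show ?thesis by (simp only: x s_pair pi_pair)
  qed
  have "pr (\<lambda>xs. arg 0 xs - triangle (s (arg 0 xs)))"
    by (intro pr_pr2[OF pr2_minus] pr_pr1[OF pr1_triangle] pr_pr1[OF \<open>pr1 s\<close>] pr_arg)
  then show "pr1 pi1" by (simp add: pr1_def 1)
  then have "pr (\<lambda>xs. s (arg 0 xs) - pi1 (arg 0 xs))"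
    by (intro pr_pr2[OF pr2_minus] pr_pr1[OF \<open>pr1 pi1\<close>] pr_pr1[OF \<open>pr1 s\<close>] pr_arg)
  then show "pr1 pi2" by (simp add: pr1_def 2)
qed

section \<open>Closure rules for unary functions\<close>

named_theorems pr1_intros

lemma pr1_const [pr1_intros]: "pr1 (\<lambda>x. c)"
  by (simp add: pr1_def pr_const)

lemma pr1_id [pr1_intros]: "pr1 (\<lambda>x. x)"
  by (simp add: pr1_def pr_arg)

lemma pr1_comp: "pr1 f \<Longrightarrow> pr1 g \<Longrightarrow> pr1 (\<lambda>x. f (g x))"
  using pr_pr1[of f] by (simp add: pr1_def)

lemma pr1_comp2: "pr2 f \<Longrightarrow> pr1 g \<Longrightarrow> pr1 h \<Longrightarrow> pr1 (\<lambda>x. f (g x) (h x))"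
  using pr_pr2[of f] by (simp add: pr1_def)

lemma pr1_Suc [pr1_intros]: "pr1 f \<Longrightarrow> pr1 (\<lambda>x. Suc (f x))"
  by (simp add: pr1_def pr_Suc)

lemmas [pr1_intros] = pr1_comp[OF pr1_pi1] pr1_comp[OF pr1_pi2]
  pr1_comp2[OF pr2_pair] pr1_comp2[OF pr2_add] pr1_comp2[OF pr2_minus] pr1_comp2[OF pr2_times]

lemma pr1_if_le [pr1_intros]:
  "pr1 f \<Longrightarrow> pr1 g \<Longrightarrow> pr1 a \<Longrightarrow> pr1 b \<Longrightarrow> pr1 (\<lambda>x. if f x \<le> g x then a x else b x)"
  unfolding pr1_def by (rule pr_if_le)

lemma pr1_if_less [pr1_intros]:
  "pr1 f \<Longrightarrow> pr1 g \<Longrightarrow> pr1 a \<Longrightarrow> pr1 b \<Longrightarrow> pr1 (\<lambda>x. if f x < g x then a x else b x)"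
  using pr1_if_le[of "\<lambda>x. Suc (f x)"] by (simp add: pr1_Suc Suc_le_eq)

lemma pr1_if_eq [pr1_intros]:
  assumes "pr1 f" "pr1 g" "pr1 a" "pr1 b"
  shows "pr1 (\<lambda>x. if f x = g x then a x else b x)"
proof -
  have "pr1 (\<lambda>x. if f x \<le> g x then if g x \<le> f x then a x else b x else b x)"
    by (intro pr1_intros assms)
  also have "(\<lambda>x. if f x \<le> g x then if g x \<le> f x then a x else b x else b x) =
      (\<lambda>x. if f x = g x then a x else b x)"
    by auto
  finally show ?thesis .
qed

lemma pr1_if_conj [pr1_intros]:
  "pr1 (\<lambda>x. if P x then if Q x then a x else b x else b x) \<Longrightarrow>
     pr1 (\<lambda>x. if P x \<and> Q x then a x else b x)"
proof -
  have "(\<lambda>x. if P x then if Q x then a x else b x else b x) = (\<lambda>x. if P x \<and> Q x then a x else b x)"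
    by auto
  then show "pr1 (\<lambda>x. if P x then if Q x then a x else b x else b x) \<Longrightarrow> ?thesis" by simp
qed

text \<open>Accumulator, counter and parameter of the step function are packed into one number, in
  this order. Thus all later proofs of primitive recursiveness stay unary and follow the syntax of
  the definition.\<close>

lemma pr1_rec [pr1_intros]:
  assumes "pr1 A" "pr1 (\<lambda>z. B (pi1 z) (pi1 (pi2 z)) (pi2 (pi2 z)))" "pr1 K"
  shows "pr1 (\<lambda>x. rec_nat (A x) (\<lambda>n r. B r n x) (K x))"
proof -
  have "pr2 (\<lambda>n x. rec_nat (A x) (\<lambda>n r. B r n x) n)"
  proof (rule pr2_rec[where A = A and B = B])
    have "pr (\<lambda>xs. (\<lambda>z. B (pi1 z) (pi1 (pi2 z)) (pi2 (pi2 z)))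
        (pair (arg 0 xs) (pair (arg 1 xs) (arg 2 xs))))"
      by (rule pr_pr1[OF assms(2)]) (intro pr_pr2[OF pr2_pair] pr_arg)
    then show "pr (\<lambda>xs. B (arg 0 xs) (arg 1 xs) (arg 2 xs))" by simp
  qed (use assms in \<open>auto simp: pr1_def\<close>)
  from pr1_comp2[OF this assms(3) pr1_id] show ?thesis .
qed

subsection \<open>Codes of lists\<close>

text \<open>The value 0 on the empty list agrees with \<open>arg\<close>, which reads missing
  arguments as 0.\<close>

definition lhd :: "nat \<Rightarrow> nat" where "lhd x = (if x = 0 then 0 else pi1 (x - 1))"
definition ltl :: "nat \<Rightarrow> nat" where "ltl x = (if x = 0 then 0 else pi2 (x - 1))"
definition lcons :: "nat \<Rightarrow> nat \<Rightarrow> nat" where "lcons x y = Suc (pair x y)"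

lemma lhd_encode [simp]: "lhd (list_encode xs) = arg 0 xs"
  by (cases xs) (simp_all add: lhd_def)

lemma ltl_encode [simp]: "ltl (list_encode xs) = list_encode (tl xs)"
  by (cases xs) (simp_all add: ltl_def)

lemma lcons_encode: "lcons x (list_encode xs) = list_encode (x # xs)"
  by (simp add: lcons_def)

lemma lcons_sel [simp]: "lhd (lcons x y) = x" "ltl (lcons x y) = y" "lcons x y \<noteq> 0"
  by (simp_all add: lcons_def lhd_def ltl_def)

lemma pr1_lhd [pr1_intros]: "pr1 f \<Longrightarrow> pr1 (\<lambda>x. lhd (f x))"
  unfolding lhd_def by (intro pr1_intros)

lemma pr1_ltl [pr1_intros]: "pr1 f \<Longrightarrow> pr1 (\<lambda>x. ltl (f x))"
  unfolding ltl_def by (intro pr1_intros)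

lemma pr1_lcons [pr1_intros]: "pr1 f \<Longrightarrow> pr1 g \<Longrightarrow> pr1 (\<lambda>x. lcons (f x) (g x))"
  unfolding lcons_def by (intro pr1_intros)

definition lnth :: "nat \<Rightarrow> nat \<Rightarrow> nat" where
  "lnth x j = lhd (rec_nat x (\<lambda>_ r. ltl r) j)"

lemma lnth_encode: "lnth (list_encode xs) j = arg j xs"
proof -
  have "rec_nat (list_encode xs) (\<lambda>_ r. ltl r) j = list_encode (drop j xs)"
    by (induction j) (simp_all add: drop_Suc tl_drop)
  then show ?thesis by (simp add: lnth_def arg_def)
qed

lemma pr1_lnth [pr1_intros]: "pr1 f \<Longrightarrow> pr1 g \<Longrightarrow> pr1 (\<lambda>x. lnth (f x) (g x))"
  unfolding lnth_def by (intro pr1_intros)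

text \<open>Course-of-values recursion, by tabulating \<open>[e m, \<dots>, e 0]\<close>.\<close>

lemma pr1_tree_rec:
  assumes G: "pr1 G" and e0: "e 0 = 0"
    and eS: "\<And>m. e (Suc m) = G (pair (pi1 m) (pair (e (pi1 (pi2 m))) (e (pi2 (pi2 m)))))"
  shows "pr1 e"
proof -
  \<comment> \<open>The table runs downwards, so the value at \<open>i \<le> m\<close> stands at
    position \<open>m - i\<close>.\<close>
  define B where "B T m = lcons (G (pair (pi1 m)
      (pair (lnth T (m - pi1 (pi2 m))) (lnth T (m - pi2 (pi2 m)))))) T" for T m
  define T where "T m = rec_nat (list_encode [0]) (\<lambda>m r. B r m) m" for m
  have le: "pi1 (pi2 m) \<le> m" "pi2 (pi2 m) \<le> m" for m
    by (metis le_prod_encode_1 le_prod_encode_2 le_trans pair_pi)+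
  have arg_rev: "j \<le> m \<Longrightarrow> arg (m - j) (map e (rev [0..<Suc m])) = e j" for j m
    by (simp add: arg_def rev_nth less_Suc_eq_le del: upt_Suc)
  have T: "T m = list_encode (map e (rev [0..<Suc m]))" for m
  proof (induction m)
    case 0
    show ?case by (simp add: T_def e0)
  next
    case (Suc m)
    have "T (Suc m) = B (T m) m" by (simp add: T_def)
    also have "\<dots> = lcons (e (Suc m)) (T m)"
      by (simp add: B_def Suc lnth_encode arg_rev le eS del: upt_Suc)
    finally show ?case by (simp add: Suc lcons_def)
  qed
  have "pr1 T"
    unfolding T_def B_def by (intro pr1_intros pr1_comp[OF G])
  then have "pr1 (\<lambda>m. lhd (T m))" by (intro pr1_intros)
  also have "(\<lambda>m. lhd (T m)) = e" by (simp add: T del: list_encode.simps)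
  finally show ?thesis .
qed

subsection \<open>Recursive functions\<close>

lemma recursive_pr_eval: "recursive (pr_eval p)"
proof (induction p)
  case (PComp f gs)
  then show ?case using recursive.comp[of "pr_eval f" "map pr_eval gs"] by auto
qed (auto intro: recursive.intros)

text \<open>Growth bounds the search: \<open>n\<close> can only be the value at some
  \<open>m \<le> n\<close>.\<close>

lemma recursive_set_range:
  assumes g: "pr1 g" and ge: "\<And>m. m \<le> g m"
  shows "recursive_set (range g)"
proof -
  define c :: "nat \<Rightarrow> nat" where "c n = rec_nat 0 (\<lambda>m r. if g m = n then 1 else r) (Suc n)" for n
  have "pr1 c" unfolding c_def by (intro pr1_intros pr1_comp[OF g])
  then obtain p where p: "pr_eval p = (\<lambda>xs. c (arg 0 xs))" by (auto simp: pr1_def pr_def)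
  have "rec_nat 0 (\<lambda>m r. if g m = n then 1 else r) k = (if \<exists>m<k. g m = n then 1 else (0::nat))" for n k
    by (induction k) (auto simp: less_Suc_eq)
  then have "c n = (if \<exists>m<Suc n. g m = n then 1 else 0)" for n
    by (simp only: c_def)
  moreover have "(\<exists>m<Suc n. g m = n) \<longleftrightarrow> n \<in> range g" for n
    using ge by (auto simp: less_Suc_eq_le)
  ultimately have "c n = (if n \<in> range g then 1 else 0)" for n by simp
  then show ?thesis
    unfolding recursive_set_def using recursive_pr_eval[of p] p by auto
qed

text \<open>Primitive recursive evaluation with a time bound \<open>t\<close>: 0 means that no
  result is known yet, \<open>Suc v\<close> is the result \<open>v\<close>. An answer is never
  wrong, and it is given for all large \<open>t\<close>. This form passes through minimization
  without a normal form theorem.\<close>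

definition approximable :: "(nat list \<Rightarrow> nat) \<Rightarrow> bool" where
  "approximable F \<longleftrightarrow> (\<exists>f. pr1 f \<and>
     (\<forall>t xs. f (pair t (list_encode xs)) \<in> {0, Suc (F xs)}) \<and>
     (\<forall>xs. \<exists>t0. \<forall>t\<ge>t0. f (pair t (list_encode xs)) = Suc (F xs)))"

lemma approximable_primitive:
  assumes "pr1 f" "\<And>xs. f (list_encode xs) = F xs"
  shows "approximable F"
  unfolding approximable_def
  by (rule exI[of _ "\<lambda>x. Suc (f (pi2 x))"]) (use assms in \<open>auto intro!: pr1_intros pr1_comp[OF assms(1)]\<close>)

lemma approximable_map:
  assumes "\<forall>G\<in>set Gs. approximable G"
  shows "approximable (\<lambda>xs. list_encode (map (\<lambda>G. G xs) Gs))"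
  using assms
proof (induction Gs)
  case Nil
  show ?case by (rule approximable_primitive[of "\<lambda>_. 0"]) (auto intro: pr1_intros)
next
  case (Cons G Gs)
  then obtain f h where f: "pr1 f" "\<And>t xs. f (pair t (list_encode xs)) \<in> {0, Suc (G xs)}"
      "\<And>xs. \<exists>t0. \<forall>t\<ge>t0. f (pair t (list_encode xs)) = Suc (G xs)"
    and h: "pr1 h" "\<And>t xs. h (pair t (list_encode xs)) \<in> {0, Suc (list_encode (map (\<lambda>G. G xs) Gs))}"
      "\<And>xs. \<exists>t0. \<forall>t\<ge>t0. h (pair t (list_encode xs)) = Suc (list_encode (map (\<lambda>G. G xs) Gs))"
    unfolding approximable_def by force
  define k where "k x = (if f x = 0 then 0 else if h x = 0 then 0 else
      Suc (lcons (f x - 1) (h x - 1)))" for x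
  have "pr1 k" unfolding k_def by (intro pr1_intros pr1_comp[OF f(1)] pr1_comp[OF h(1)])
  moreover have "k (pair t (list_encode xs)) \<in> {0, Suc (list_encode (map (\<lambda>G. G xs) (G # Gs)))}" for t xs
    using f(2)[of t xs] h(2)[of t xs] by (auto simp: k_def lcons_def)
  moreover have "\<exists>t0. \<forall>t\<ge>t0. k (pair t (list_encode xs)) = Suc (list_encode (map (\<lambda>G. G xs) (G # Gs)))" for xs
  proof -
    obtain t1 t2 where "\<forall>t\<ge>t1. f (pair t (list_encode xs)) = Suc (G xs)"
      "\<forall>t\<ge>t2. h (pair t (list_encode xs)) = Suc (list_encode (map (\<lambda>G. G xs) Gs))"
      using f(3) h(3) by blast
    then show ?thesis by (intro exI[of _ "max t1 t2"]) (simp add: k_def lcons_def)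
  qed
  ultimately show ?case unfolding approximable_def by blast
qed

lemma approximable_comp:
  assumes "approximable F" and "\<forall>G\<in>set Gs. approximable G"
  shows "approximable (comp_op F Gs)"
proof -
  let ?G = "\<lambda>xs. list_encode (map (\<lambda>G. G xs) Gs)"
  obtain f h where f: "pr1 f" "\<And>t xs. f (pair t (list_encode xs)) \<in> {0, Suc (F xs)}"
      "\<And>xs. \<exists>t0. \<forall>t\<ge>t0. f (pair t (list_encode xs)) = Suc (F xs)"
    and h: "pr1 h" "\<And>t xs. h (pair t (list_encode xs)) \<in> {0, Suc (?G xs)}"
      "\<And>xs. \<exists>t0. \<forall>t\<ge>t0. h (pair t (list_encode xs)) = Suc (?G xs)"
    using assms(1) approximable_map[OF assms(2)] unfolding approximable_def by force
  define k where "k x = (if h x = 0 then 0 else f (pair (pi1 x) (h x - 1)))" for x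
  have "pr1 k" unfolding k_def by (intro pr1_intros pr1_comp[OF f(1)] pr1_comp[OF h(1)])
  moreover have "k (pair t (list_encode xs)) \<in> {0, Suc (comp_op F Gs xs)}" for t xs
    using h(2)[of t xs] f(2)[of t "map (\<lambda>G. G xs) Gs"] by (auto simp: k_def comp_op_def)
  moreover have "\<exists>t0. \<forall>t\<ge>t0. k (pair t (list_encode xs)) = Suc (comp_op F Gs xs)" for xs
  proof -
    obtain t1 t2 where "\<forall>t\<ge>t1. f (pair t (?G xs)) = Suc (F (map (\<lambda>G. G xs) Gs))"
      "\<forall>t\<ge>t2. h (pair t (list_encode xs)) = Suc (?G xs)"
      using f(3) h(3) by blast
    then show ?thesis by (intro exI[of _ "max t1 t2"]) (simp add: k_def comp_op_def)
  qed
  ultimately show ?thesis unfolding approximable_def by blast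
qed

lemma approximable_prec:
  assumes "approximable F" and "approximable G"
  shows "approximable (prec_op F G)"
proof -
  obtain f g where f: "pr1 f" "\<And>t xs. f (pair t (list_encode xs)) \<in> {0, Suc (F xs)}"
      "\<And>xs. \<exists>t0. \<forall>t\<ge>t0. f (pair t (list_encode xs)) = Suc (F xs)"
    and g: "pr1 g" "\<And>t xs. g (pair t (list_encode xs)) \<in> {0, Suc (G xs)}"
      "\<And>xs. \<exists>t0. \<forall>t\<ge>t0. g (pair t (list_encode xs)) = Suc (G xs)"
    using assms unfolding approximable_def by force
  \<comment> \<open>An intermediate value that has not converged is 0 and makes all later ones
    0.\<close>
  define a where "a t y n = rec_nat (f (pair t y))
      (\<lambda>n r. if r = 0 then 0 else g (pair t (lcons (r - 1) (lcons n y)))) n" for t y n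
  define k where "k x = a (pi1 x) (ltl (pi2 x)) (lhd (pi2 x))" for x
  define H where "H xs n = rec_nat (F xs) (\<lambda>n r. G (r # n # xs)) n" for xs n
  have kH: "k (pair t (list_encode xs)) = a t (list_encode (tl xs)) (arg 0 xs)"
    "prec_op F G xs = H (tl xs) (arg 0 xs)" for t xs
    by (simp_all add: k_def prec_op_def H_def)
  have "pr1 k" unfolding k_def a_def by (intro pr1_intros pr1_comp[OF f(1)] pr1_comp[OF g(1)])
  moreover have "a t (list_encode xs) n \<in> {0, Suc (H xs n)}" for t xs n
  proof (induction n)
    case 0
    show ?case using f(2)[of t xs] by (simp add: a_def H_def)
  next
    case (Suc n)
    have "a t (list_encode xs) (Suc n) = (if a t (list_encode xs) n = 0 then 0 else
        g (pair t (list_encode ((a t (list_encode xs) n - 1) # n # xs))))"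
      by (simp add: a_def lcons_def)
    moreover have "H xs (Suc n) = G (H xs n # n # xs)" by (simp add: H_def)
    ultimately show ?case using g(2)[of t "H xs n # n # xs"] Suc by auto
  qed
  moreover have "\<exists>t0. \<forall>t\<ge>t0. a t (list_encode xs) n = Suc (H xs n)" for xs n
  proof (induction n)
    case 0
    show ?case using f(3)[of xs] by (simp add: a_def H_def)
  next
    case (Suc n)
    then obtain t1 t2 where "\<forall>t\<ge>t1. a t (list_encode xs) n = Suc (H xs n)"
      "\<forall>t\<ge>t2. g (pair t (list_encode (H xs n # n # xs))) = Suc (G (H xs n # n # xs))"
      using g(3) by blast
    then show ?case
      by (intro exI[of _ "max t1 t2"]) (simp add: a_def H_def lcons_def)
  qed
  ultimately show ?thesis unfolding approximable_def
    by (intro exI[of _ k]) (simp only: kH, blast)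
qed

lemma approximable_mu:
  assumes "approximable F" and total: "\<forall>xs. \<exists>n. F (n # xs) = 0"
  shows "approximable (\<lambda>xs. LEAST n. F (n # xs) = 0)"
proof -
  obtain f where f: "pr1 f" "\<And>t xs. f (pair t (list_encode xs)) \<in> {0, Suc (F xs)}"
      "\<And>xs. \<exists>t0. \<forall>t\<ge>t0. f (pair t (list_encode xs)) = Suc (F xs)"
    using assms unfolding approximable_def by force
  \<comment> \<open>State of the bounded search: 0 while searching, 1 if a value has not converged,
    \<open>n + 2\<close> if \<open>n\<close> has been found.\<close>
  define s where "s t y j = rec_nat 0 (\<lambda>j r. if r = 0 then
      (if f (pair t (lcons j y)) = 0 then 1 else if f (pair t (lcons j y)) = 1 then j + 2 else 0)
      else r) j" for t y j
  define k where "k x = s (pi1 x) (pi2 x) (pi1 x) - 1" for x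
  have "pr1 k" unfolding k_def s_def by (intro pr1_intros pr1_comp[OF f(1)])
  have s0: "s t y 0 = 0" for t y by (simp add: s_def)
  have sS: "s t (list_encode xs) (Suc j) = (if s t (list_encode xs) j = 0 then
      (if f (pair t (list_encode (j # xs))) = 0 then 1
       else if f (pair t (list_encode (j # xs))) = 1 then j + 2 else 0)
      else s t (list_encode xs) j)" for t xs j
    by (simp add: s_def lcons_def)
  have inv: "(s t (list_encode xs) j = 0 \<longrightarrow> (\<forall>i<j. F (i # xs) \<noteq> 0)) \<and>
      (s t (list_encode xs) j \<ge> 2 \<longrightarrow> s t (list_encode xs) j - 2 = (LEAST n. F (n # xs) = 0))" for t xs j
  proof (induction j)
    case (Suc j)
    let ?s = "s t (list_encode xs) j" and ?f = "f (pair t (list_encode (j # xs)))"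
    consider "?s \<noteq> 0" | "?s = 0" "?f = 0" | "?s = 0" "?f = 1" | "?s = 0" "?f \<noteq> 0" "?f \<noteq> 1"
      by blast
    then show ?case
    proof cases
      case 3
      then have "F (j # xs) = 0" using f(2)[of t "j # xs"] by simp
      then have "(LEAST n. F (n # xs) = 0) = j"
        using Suc 3 by (intro Least_equality) (auto simp: not_less[symmetric])
      then show ?thesis using 3 by (simp add: sS)
    next
      case 4
      then have "F (j # xs) \<noteq> 0" using f(2)[of t "j # xs"] by auto
      then show ?thesis using 4 Suc by (auto simp: sS less_Suc_eq)
    qed (use Suc in \<open>simp_all add: sS\<close>)
  qed (simp add: s0)
  have "k (pair t (list_encode xs)) \<in> {0, Suc (LEAST n. F (n # xs) = 0)}" for t xs
  proof (cases "s t (list_encode xs) t \<ge> 2")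
    case True
    then show ?thesis using inv[of t xs t] by (auto simp: k_def)
  qed (auto simp: k_def)
  moreover have "\<exists>t0. \<forall>t\<ge>t0. k (pair t (list_encode xs)) = Suc (LEAST n. F (n # xs) = 0)" for xs
  proof -
    let ?n = "LEAST n. F (n # xs) = 0"
    have n: "F (?n # xs) = 0" using total[rule_format, of xs] by (rule LeastI_ex)
    have "\<forall>j. \<exists>t0. \<forall>t\<ge>t0. f (pair t (list_encode (j # xs))) = Suc (F (j # xs))"
      using f(3) by blast
    from choice[OF this] obtain T where
      T: "\<And>j t. t \<ge> T j \<Longrightarrow> f (pair t (list_encode (j # xs))) = Suc (F (j # xs))"
      by blast
    \<comment> \<open>The bound \<open>t\<close> is used twice: it must exceed the convergence times
      of all arguments up to the least zero, and it is the length of the search, which has to pass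
      that zero.\<close>
    define t0 where "t0 = Max (T ` {..?n}) + Suc ?n"
    show ?thesis
    proof (intro exI allI impI)
      fix t assume t: "t \<ge> t0"
      have "T j \<le> t" if "j \<le> ?n" for j
      proof -
        have "T j \<le> Max (T ` {..?n})" using that by (intro Max_ge) auto
        then show ?thesis using t unfolding t0_def by linarith
      qed
      then have conv: "f (pair t (list_encode (j # xs))) = Suc (F (j # xs))" if "j \<le> ?n" for j
        using T that by blast
      have "j \<le> ?n \<Longrightarrow> s t (list_encode xs) j = 0" for j
      proof (induction j)
        case (Suc j)
        moreover have "F (j # xs) \<noteq> 0"
          using Suc.prems not_less_Least[of j "\<lambda>n. F (n # xs) = 0"] by simp
        ultimately show ?case by (simp add: sS conv del: list_encode.simps)
      qed (simp add: s0)
      then have "s t (list_encode xs) (Suc ?n) = ?n + 2" by (simp add: sS conv n del: list_encode.simps)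
      then have "s t (list_encode xs) (Suc ?n + d) = ?n + 2" for d
        by (induction d) (simp_all add: sS)
      moreover have "t = Suc ?n + (t - Suc ?n)" using t unfolding t0_def by simp
      ultimately have "s t (list_encode xs) t = ?n + 2" by metis
      then show "k (pair t (list_encode xs)) = Suc ?n" by (simp add: k_def)
    qed
  qed
  ultimately show ?thesis unfolding approximable_def using \<open>pr1 k\<close> by blast
qed

lemma recursive_approximable: "recursive F \<Longrightarrow> approximable F"
proof (induction rule: recursive.induct)
  case zero
  show ?case by (rule approximable_primitive[of "\<lambda>_. 0"]) (auto intro: pr1_intros)
next
  case succ
  show ?case by (rule approximable_primitive[of "\<lambda>x. Suc (lhd x)"]) (intro pr1_intros, simp)
next
  case (proj i)
  show ?case
    by (rule approximable_primitive[of "\<lambda>x. lnth x i"]) (auto intro: pr1_intros simp: lnth_encode)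
next
  case (comp F Gs)
  then show ?case by (intro approximable_comp) auto
next
  case (prec F G)
  then show ?case by (intro approximable_prec)
next
  case (mu F)
  then show ?case by (intro approximable_mu)
qed

text \<open>The argument is read as a time bound and a candidate. The candidate is returned once its
  membership is confirmed, a fixed member otherwise. The condition \<open>i \<ge> 1\<close> fits OP,
  whose conjunctions begin with the formula of index 1.\<close>

lemma recursive_set_enumeration:
  assumes "recursive_set A" "A \<noteq> {}"
  shows "\<exists>p. (\<forall>i. pr_eval p [i] \<in> A) \<and> (\<forall>a\<in>A. \<exists>i\<ge>1. pr_eval p [i] = a)"
proof -
  obtain F where F: "recursive F" "\<And>n. F [n] = (if n \<in> A then 1 else 0)"
    using assms(1) by (auto simp: recursive_set_def)
  obtain a0 where a0: "a0 \<in> A" using assms(2) by blast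
  obtain f where f: "pr1 f" "\<And>t xs. f (pair t (list_encode xs)) \<in> {0, Suc (F xs)}"
      "\<And>xs. \<exists>t0. \<forall>t\<ge>t0. f (pair t (list_encode xs)) = Suc (F xs)"
    using recursive_approximable[OF F(1)] unfolding approximable_def by force
  define h where "h x = (if f (pair (pi1 x) (lcons (pi2 x) 0)) = 2 then pi2 x else a0)" for x
  have h_pair: "h (pair t n) = (if f (pair t (list_encode [n])) = 2 then n else a0)" for t n
    by (simp add: h_def lcons_def)
  have "pr1 h" unfolding h_def by (intro pr1_intros pr1_comp[OF f(1)])
  then obtain p where p: "pr_eval p = (\<lambda>xs. h (arg 0 xs))" by (auto simp: pr1_def pr_def)
  have "h x \<in> A" for x
  proof -
    obtain t n where x: "x = pair t n" by (metis pair_pi)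
    show ?thesis
      using f(2)[of t "[n]"] a0 F(2)[of n] unfolding x h_pair by (auto split: if_splits)
  qed
  moreover have "\<exists>i\<ge>1. h i = a" if "a \<in> A" for a
  proof -
    obtain t0 where t0: "\<forall>t\<ge>t0. f (pair t (list_encode [a])) = Suc (F [a])" using f(3) by blast
    \<comment> \<open>Waiting for \<open>Suc t0\<close> instead of \<open>t0\<close> makes the index
      positive.\<close>
    have "h (pair (Suc t0) a) = a" using t0 F(2)[of a] that by (simp only: h_pair) simp
    moreover have "pair (Suc t0) a \<ge> 1" using le_prod_encode_1[of "Suc t0" a] by linarith
    ultimately show ?thesis by blast
  qed
  ultimately have "\<forall>i. pr_eval p [i] \<in> A" "\<forall>a\<in>A. \<exists>i\<ge>1. pr_eval p [i] = a"
    by (simp_all add: p)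
  then show ?thesis by blast
qed

section \<open>Enumeration of the types of RSAT\<close>

lemma LPA_sel: "Fsyms LPA = {}" "Rsyms LPA = {}"
  by (simp_all add: LPA_def)

lemma tm_code_inj: "tm_in LPA s \<Longrightarrow> tm_in LPA t \<Longrightarrow> tm_code s = tm_code t \<Longrightarrow> s = t"
proof (induction s arbitrary: t)
  case (Var i) then show ?case by (cases t) (auto simp: LPA_def)
next
  case Zero then show ?case by (cases t) (auto simp: LPA_def)
next
  case One then show ?case by (cases t) (auto simp: LPA_def)
next
  case (Add s1 s2) then show ?case by (cases t) (auto simp: LPA_def)
next
  case (Mul s1 s2) then show ?case by (cases t) (auto simp: LPA_def)
next
  case (Fun f ts) then show ?case by (auto simp: LPA_def)
qed

lemma fm_code_inj: "fm_in LPA \<phi> \<Longrightarrow> fm_in LPA \<psi> \<Longrightarrow> fm_code \<phi> = fm_code \<psi> \<Longrightarrow> \<phi> = \<psi>"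
proof (induction \<phi> arbitrary: \<psi>)
  case FF then show ?case by (cases \<psi>) (auto simp: LPA_def)
next
  case (Eq s t) then show ?case by (cases \<psi>) (auto dest: tm_code_inj simp: LPA_sel)
next
  case (Less s t) then show ?case by (cases \<psi>) (auto dest: tm_code_inj simp: LPA_sel)
next
  case (Imp \<phi>1 \<phi>2) then show ?case by (cases \<psi>) (auto simp: LPA_def)
next
  case (Forall \<phi>) then show ?case by (cases \<psi>) (auto simp: LPA_def)
next
  case (Rel r ts) then show ?case by (auto simp: LPA_def)
qed

lemma pr_code_inj: "pr_code f = pr_code g \<Longrightarrow> f = g"
proof (induction f arbitrary: g)
  case PZero then show ?case by (cases g) auto
next
  case PSucc then show ?case by (cases g) auto
next
  case (PProj i) then show ?case by (cases g) auto
next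
  case (PRec f1 f2) then show ?case by (cases g) auto
next
  case (PComp f gs)
  then obtain f' gs' where g: "g = PComp f' gs'" "pr_code f = pr_code f'" "map pr_code gs = map pr_code gs'"
    by (cases g) (auto simp: list_encode_eq)
  from g(3) have "gs = gs'"
    using PComp.IH(2)
  proof (induction gs arbitrary: gs')
    case (Cons x xs)
    then obtain y ys where "gs' = y # ys" "pr_code x = pr_code y" "map pr_code xs = map pr_code ys"
      by auto
    with Cons show ?case by auto
  qed simp
  with g PComp.IH(1) show ?case by simp
qed

text \<open>Nested to the left, unlike \<open>Conjs\<close>, so that a longer conjunction arises
  from a shorter one by a single rule of the calculus below.\<close>

primrec conjseq :: "(nat \<Rightarrow> ('f, 'r) fm) \<Rightarrow> nat \<Rightarrow> ('f, 'r) fm" where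
  "conjseq \<phi> 0 = Neg FF"
| "conjseq \<phi> (Suc n) = Conj (conjseq \<phi> n) (\<phi> (Suc n))"

lemma sat_conjseq: "sat M e (conjseq \<phi> n) \<longleftrightarrow> (\<forall>i\<in>{1..n}. sat M e (\<phi> i))"
  by (induction n) (auto simp: atLeastAtMostSuc_conv)

lemma conjseq_in: "(\<And>i. 1 \<le> i \<Longrightarrow> i \<le> n \<Longrightarrow> fm_in L (\<phi> i)) \<Longrightarrow> fm_in L (conjseq \<phi> n)"
  by (induction n) auto

lemma fv_conjseq: "(\<And>i. 1 \<le> i \<Longrightarrow> i \<le> n \<Longrightarrow> fv (\<phi> i) \<subseteq> A) \<Longrightarrow> fv (conjseq \<phi> n) \<subseteq> A"
  by (induction n) auto

lemma conjseq_cong: "(\<And>i. 1 \<le> i \<Longrightarrow> i \<le> n \<Longrightarrow> \<phi> i = \<phi>' i) \<Longrightarrow> conjseq \<phi> n = conjseq \<phi>' n"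
  by (induction n) auto

text \<open>
  A calculus deriving codes of judgements. A judgement \<open>pair t c\<close> with tag \<open>t\<close> is about
  1: the value of a program at an argument list, 2: the values of a list of programs,
  3 and 4: terms and formulas of arithmetic with free variables below a bound,
  5: the conjunction of the first formulas enumerated by a program,
  6: a formula enumerated by a program. The number 0 stands for a failed derivation.
  The argument of \<open>rule_step\<close> codes the name of a rule with a parameter and its two premises.
\<close>

definition rule_step :: "nat \<Rightarrow> nat" where
  "rule_step z = (let r = pi1 (pi1 z); d = pi2 (pi1 z);
      t1 = pi1 (pi1 (pi2 z)); a1 = pi1 (pi2 (pi1 (pi2 z))); b1 = pi2 (pi2 (pi1 (pi2 z)));
      t2 = pi1 (pi2 (pi2 z)); a2 = pi1 (pi2 (pi2 (pi2 z))); b2 = pi2 (pi2 (pi2 (pi2 z))) in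
    if r = 0 then pair 1 (pair (pair 0 0) (pair d 0))
    else if r = 1 then pair 1 (pair (pair 1 0) (pair d (Suc (lhd d))))
    else if r = 2 then pair 1 (pair (pair 2 (pi1 d)) (pair (pi2 d) (lnth (pi2 d) (pi1 d))))
    else if r = 3 then
      (if t1 = 1 \<and> t2 = 2 \<and> pi1 b1 = pi2 b2
       then pair 1 (pair (pair 3 (pair a1 a2)) (pair (pi1 b2) (pi2 b1))) else 0)
    else if r = 4 then pair 2 (pair 0 (pair d 0))
    else if r = 5 then
      (if t1 = 1 \<and> t2 = 2 \<and> pi1 b1 = pi1 b2
       then pair 2 (pair (lcons a1 a2) (pair (pi1 b1) (lcons (pi2 b1) (pi2 b2)))) else 0)
    else if r = 6 then
      (if t1 = 1 \<and> t2 = 1 \<and> lhd d = 0 \<and> ltl d = pi1 b1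
       then pair 1 (pair (pair 4 (pair a1 a2)) (pair d (pi2 b1))) else 0)
    else if r = 7 then
      (if t1 = 1 \<and> t2 = 1 \<and> pi1 a1 = 4 \<and> pi2 (pi2 a1) = a2 \<and>
          pi1 b2 = lcons (pi2 b1) (lcons (lhd (pi1 b1)) (ltl (pi1 b1)))
       then pair 1 (pair a1 (pair (lcons (Suc (lhd (pi1 b1))) (ltl (pi1 b1))) (pi2 b2))) else 0)
    else if r = 8 then (if pi1 d < pi2 d then pair 3 (pair (pi2 d) (pair 0 (pi1 d))) else 0)
    else if r = 9 then pair 3 (pair d (pair 1 0))
    else if r = 10 then pair 3 (pair d (pair 2 0))
    else if r = 11 then
      (if t1 = 3 \<and> t2 = 3 \<and> a1 = a2 then pair 3 (pair a1 (pair 3 (pair b1 b2))) else 0)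
    else if r = 12 then
      (if t1 = 3 \<and> t2 = 3 \<and> a1 = a2 then pair 3 (pair a1 (pair 4 (pair b1 b2))) else 0)
    else if r = 13 then pair 4 (pair d (pair 0 0))
    else if r = 14 then
      (if t1 = 3 \<and> t2 = 3 \<and> a1 = a2 then pair 4 (pair a1 (pair 1 (pair b1 b2))) else 0)
    else if r = 15 then
      (if t1 = 3 \<and> t2 = 3 \<and> a1 = a2 then pair 4 (pair a1 (pair 2 (pair b1 b2))) else 0)
    else if r = 16 then
      (if t1 = 4 \<and> t2 = 4 \<and> a1 = a2 then pair 4 (pair a1 (pair 3 (pair b1 b2))) else 0)
    else if r = 17 then (if t1 = 4 then pair 4 (pair (a1 - 1) (pair 4 b1)) else 0)
    else if r = 18 then
      (if t1 = 1 \<and> t2 = 4 \<and> pi1 b1 = lcons (lhd (pi1 b1)) 0 \<and> pi2 b1 = b2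
       then pair 6 (pair a1 (pair (a2 - 1) (pair (lhd (pi1 b1)) b2))) else 0)
    else if r = 19 then
      (if t1 = 1 then pair 5 (pair a1 (pair d (pair 0 (fm_code (Neg FF :: (nat, nat) fm))))) else 0)
    else
      (if t1 = 5 \<and> t2 = 6 \<and> a1 = a2 \<and> pi1 b1 = pi1 b2 \<and> Suc (pi1 (pi2 b1)) = pi1 (pi2 b2)
       then pair 5 (pair a1 (pair (pi1 b1) (pair (pi1 (pi2 b2))
         (pair 3 (pair (pair 3 (pair (pi2 (pi2 b1)) (pair 3 (pair (pi2 (pi2 b2)) (pair 0 0)))))
           (pair 0 0)))))) else 0))"

lemma pr1_rule_step: "pr1 rule_step"
  unfolding rule_step_def Let_def by (intro pr1_intros)

text \<open>Every number is read as a derivation tree: \<open>Suc m\<close> names a rule with its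
  parameter and two smaller trees. Thus the conclusions are enumerated by a primitive recursive
  function although evaluation of programs is not primitive recursive. The comparison with
  \<open>m\<close> makes the recursion visibly terminating.\<close>

fun derivation :: "nat \<Rightarrow> nat" where
  "derivation 0 = 0"
| "derivation (Suc m) = (let a = pi1 (pi2 m); b = pi2 (pi2 m) in
     if a \<le> m \<and> b \<le> m then rule_step (pair (pi1 m) (pair (derivation a) (derivation b))) else 0)"

declare derivation.simps [simp del]

lemma derivation_Suc:
  "derivation (Suc m) =
     rule_step (pair (pi1 m) (pair (derivation (pi1 (pi2 m))) (derivation (pi2 (pi2 m)))))"
proof -
  have "pi1 (pi2 m) \<le> m" "pi2 (pi2 m) \<le> m"
    by (metis le_prod_encode_1 le_prod_encode_2 le_trans pair_pi)+
  then show ?thesis by (simp add: derivation.simps)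
qed

lemma pr1_derivation: "pr1 derivation"
  by (rule pr1_tree_rec[OF pr1_rule_step]) (simp_all add: derivation_Suc derivation.simps)

lemma derivation_closed:
  assumes "J1 \<in> range derivation" "J2 \<in> range derivation"
  shows "rule_step (pair i (pair J1 J2)) \<in> range derivation"
proof -
  obtain a b where "J1 = derivation a" "J2 = derivation b" using assms by blast
  then have "rule_step (pair i (pair J1 J2)) = derivation (Suc (pair i (pair a b)))"
    by (simp add: derivation_Suc)
  then show ?thesis by blast
qed

lemma derivation_0: "0 \<in> range derivation"
  by (rule range_eqI[of _ _ 0]) (simp add: derivation.simps)

subsection \<open>Soundness\<close>

text \<open>Tag 0 counts as true and so covers the failed derivation 0. For tag 5, formulas are
  demanded at 1 to \<open>n\<close> only, since a program may enumerate something else afterwards.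
  The argument \<open>ty\<close> fixes the symbol types of the formulas.\<close>

definition true_judgement :: "('f, 'r) fm itself \<Rightarrow> nat \<Rightarrow> bool" where
  "true_judgement ty J \<longleftrightarrow>
     (case pi1 J of 0 \<Rightarrow> True | Suc t \<Rightarrow>
       ([\<lambda>c. \<exists>f xs. c = pair (pr_code f) (pair (list_encode xs) (pr_eval f xs)),
        \<lambda>c. \<exists>fs xs. c = pair (list_encode (map pr_code fs))
          (pair (list_encode xs) (list_encode (map (\<lambda>f. pr_eval f xs) fs))),
        \<lambda>c. \<exists>b (t :: 'f tm). tm_in (LPA :: ('f, 'r) lang) t \<and> fv_tm t \<subseteq> {..<b} \<and> c = pair b (tm_code t),
        \<lambda>c. \<exists>b (\<phi> :: ('f, 'r) fm). fm_in LPA \<phi> \<and> fv \<phi> \<subseteq> {..<b} \<and> c = pair b (fm_code \<phi>),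
        \<lambda>c. \<exists>f k n (\<phi> :: nat \<Rightarrow> ('f, 'r) fm).
          (\<forall>i. 1 \<le> i \<longrightarrow> i \<le> n \<longrightarrow> fm_in LPA (\<phi> i) \<and> fv (\<phi> i) \<subseteq> {..k} \<and> pr_eval f [i] = fm_code (\<phi> i)) \<and>
          c = pair (pr_code f) (pair k (pair n (fm_code (conjseq \<phi> n)))),
        \<lambda>c. \<exists>f k i (\<phi> :: ('f, 'r) fm). fm_in LPA \<phi> \<and> fv \<phi> \<subseteq> {..k} \<and> pr_eval f [i] = fm_code \<phi> \<and>
          c = pair (pr_code f) (pair k (pair i (fm_code \<phi>)))] ! t) (pi2 J))"

lemma list_encode_cases: obtains xs where "x = list_encode xs"
  by (metis list_decode_inverse)

lemma pi_0 [simp]: "pi1 0 = 0" "pi2 0 = 0"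
proof -
  have "pair 0 0 = 0" by (simp add: prod_encode_def)
  with pi_pair[of 0 0] show "pi1 0 = 0" "pi2 0 = 0" by simp_all
qed

lemma true_judgement_0: "true_judgement TYPE(('f, 'r) fm) 0"
  by (simp add: true_judgement_def)

lemma true_judgement_pair [simp]:
  "true_judgement TYPE(('f, 'r) fm) (pair 1 c) \<longleftrightarrow>
     (\<exists>f xs. c = pair (pr_code f) (pair (list_encode xs) (pr_eval f xs)))"
  "true_judgement TYPE(('f, 'r) fm) (pair (Suc 0) c) \<longleftrightarrow>
     (\<exists>f xs. c = pair (pr_code f) (pair (list_encode xs) (pr_eval f xs)))"
  "true_judgement TYPE(('f, 'r) fm) (pair 2 c) \<longleftrightarrow>
     (\<exists>fs xs. c = pair (list_encode (map pr_code fs))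
          (pair (list_encode xs) (list_encode (map (\<lambda>f. pr_eval f xs) fs))))"
  "true_judgement TYPE(('f, 'r) fm) (pair 3 c) \<longleftrightarrow>
     (\<exists>b (t :: 'f tm). tm_in (LPA :: ('f, 'r) lang) t \<and> fv_tm t \<subseteq> {..<b} \<and> c = pair b (tm_code t))"
  "true_judgement TYPE(('f, 'r) fm) (pair 4 c) \<longleftrightarrow>
     (\<exists>b (\<phi> :: ('f, 'r) fm). fm_in LPA \<phi> \<and> fv \<phi> \<subseteq> {..<b} \<and> c = pair b (fm_code \<phi>))"
  "true_judgement TYPE(('f, 'r) fm) (pair 5 c) \<longleftrightarrow>
     (\<exists>f k n (\<phi> :: nat \<Rightarrow> ('f, 'r) fm).
       (\<forall>i. 1 \<le> i \<longrightarrow> i \<le> n \<longrightarrow> fm_in LPA (\<phi> i) \<and> fv (\<phi> i) \<subseteq> {..k} \<and> pr_eval f [i] = fm_code (\<phi> i)) \<and>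
       c = pair (pr_code f) (pair k (pair n (fm_code (conjseq \<phi> n)))))"
  "true_judgement TYPE(('f, 'r) fm) (pair 6 c) \<longleftrightarrow>
     (\<exists>f k i (\<phi> :: ('f, 'r) fm). fm_in LPA \<phi> \<and> fv \<phi> \<subseteq> {..k} \<and> pr_eval f [i] = fm_code \<phi> \<and>
       c = pair (pr_code f) (pair k (pair i (fm_code \<phi>))))"
  by (simp_all add: true_judgement_def eval_nat_numeral)

lemma prec_op_0: "arg 0 xs = 0 \<Longrightarrow> prec_op F G xs = F (tl xs)"
  by (simp add: prec_op_def)

lemma prec_op_Suc: "prec_op F G (Suc n # ys) = G (prec_op F G (n # ys) # n # ys)"
  by (simp add: prec_op_def)

lemma prec_op_hd: "prec_op F G xs = prec_op F G (arg 0 xs # tl xs)"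
  by (simp add: prec_op_def)

text \<open>One case per rule. The side conditions compare codes, and injectivity of
  \<open>list_encode\<close> and \<open>pr_code\<close> turns them into equality of argument lists
  and programs.\<close>

lemma rule_step_sound:
  assumes "true_judgement TYPE(('f, 'r) fm) J1" "true_judgement TYPE(('f, 'r) fm) J2"
  shows "true_judgement TYPE(('f, 'r) fm) (rule_step (pair (pair r d) (pair J1 J2)))"
proof -
  obtain t1 c1 t2 c2 where J: "J1 = pair t1 c1" "J2 = pair t2 c2"
    by (metis pair_pi)
  obtain ds where ds: "d = list_encode ds" by (rule list_encode_cases)
  let ?T = "true_judgement TYPE(('f, 'r) fm)"
  let ?g = "?T (rule_step (pair (pair r d) (pair J1 J2)))"
  have r0: ?g if "r = 0"
    using that by (auto simp: rule_step_def Let_def ds intro!: exI[of _ PZero])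
  have r1: ?g if "r = 1"
    using that by (auto simp: rule_step_def Let_def ds intro!: exI[of _ PSucc])
  have r2: ?g if "r = 2"
  proof -
    obtain i ys where "d = pair i (list_encode ys)" by (metis pair_pi list_decode_inverse)
    then show ?thesis
      using that by (auto simp: rule_step_def Let_def lnth_encode intro!: exI[of _ "PProj i"])
  qed
  have r3: ?g if "r = 3"
  proof (cases "t1 = 1 \<and> t2 = 2 \<and> pi1 (pi2 c1) = pi2 (pi2 c2)")
    case True
    then obtain f vs fs xs where "c1 = pair (pr_code f) (pair (list_encode vs) (pr_eval f vs))"
      "c2 = pair (list_encode (map pr_code fs))
          (pair (list_encode xs) (list_encode (map (\<lambda>f. pr_eval f xs) fs)))"
      using assms by (auto simp: J)
    moreover from this True have "vs = map (\<lambda>f. pr_eval f xs) fs" by (simp add: list_encode_eq)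
    moreover have "pr_eval (PComp f fs) xs = pr_eval f (map (\<lambda>f. pr_eval f xs) fs)"
      by (simp add: comp_op_def comp_def)
    ultimately show ?thesis
      using that True
      by (auto simp: J rule_step_def Let_def intro!: exI[of _ "PComp f fs"] exI[of _ xs])
  qed (use that in \<open>auto simp: J rule_step_def Let_def true_judgement_0\<close>)
  have r4: ?g if "r = 4"
    using that by (auto simp: rule_step_def Let_def ds intro!: exI[of _ "[] :: prim_rec list"] exI[of _ ds])
  have r5: ?g if "r = 5"
  proof (cases "t1 = 1 \<and> t2 = 2 \<and> pi1 (pi2 c1) = pi1 (pi2 c2)")
    case True
    then obtain f vs fs xs where "c1 = pair (pr_code f) (pair (list_encode vs) (pr_eval f vs))"
      "c2 = pair (list_encode (map pr_code fs))
          (pair (list_encode xs) (list_encode (map (\<lambda>f. pr_eval f xs) fs)))"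
      using assms by (auto simp: J)
    moreover from this True have "vs = xs" by (simp add: list_encode_eq)
    ultimately show ?thesis
      using that True
      by (auto simp: J rule_step_def Let_def lcons_encode simp del: list_encode.simps
          intro!: exI[of _ "f # fs"] exI[of _ xs])
  qed (use that in \<open>auto simp: J rule_step_def Let_def true_judgement_0\<close>)
  have r6: ?g if "r = 6"
  proof (cases "t1 = 1 \<and> t2 = 1 \<and> lhd d = 0 \<and> ltl d = pi1 (pi2 c1)")
    case True
    then obtain f ys g zs where "c1 = pair (pr_code f) (pair (list_encode ys) (pr_eval f ys))"
      "c2 = pair (pr_code g) (pair (list_encode zs) (pr_eval g zs))"
      using assms by (auto simp: J)
    \<comment> \<open>\<open>lhd d = 0\<close> also admits the empty list, whose missing first
      argument reads as 0.\<close>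
    moreover from this True have "tl ds = ys" "arg 0 ds = 0" by (simp_all add: ds list_encode_eq)
    ultimately show ?thesis
      using that True
      by (auto simp: J rule_step_def Let_def ds prec_op_0 intro!: exI[of _ "PRec f g"] exI[of _ ds])
  qed (use that in \<open>auto simp: J rule_step_def Let_def true_judgement_0\<close>)
  have r7: ?g if "r = 7"
  proof (cases "t1 = 1 \<and> t2 = 1 \<and> pi1 (pi1 c1) = 4 \<and> pi2 (pi2 (pi1 c1)) = pi1 c2 \<and>
      pi1 (pi2 c2) = lcons (pi2 (pi2 c1)) (lcons (lhd (pi1 (pi2 c1))) (ltl (pi1 (pi2 c1))))")
    case True
    then obtain h ys g zs where c: "c1 = pair (pr_code h) (pair (list_encode ys) (pr_eval h ys))"
      "c2 = pair (pr_code g) (pair (list_encode zs) (pr_eval g zs))"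
      using assms by (auto simp: J)
    \<comment> \<open>Tag 4 in the code of \<open>h\<close> identifies a primitive recursion; by
      injectivity its step program is the \<open>g\<close> of the second premise.\<close>
    obtain f g' where h: "h = PRec f g'" using True by (cases h) (auto simp: c)
    have "g' = g" using True by (auto simp: c h dest: pr_code_inj)
    moreover have "zs = pr_eval h ys # arg 0 ys # tl ys"
      using True by (simp add: c lcons_encode list_encode_eq del: list_encode.simps)
    ultimately have "pr_eval h (Suc (arg 0 ys) # tl ys) = pr_eval g zs"
      using prec_op_hd[of "pr_eval f" "pr_eval g" ys] by (simp add: h prec_op_Suc)
    then show ?thesis
      using that True
      by (auto simp: J c rule_step_def Let_def lcons_encode simp del: list_encode.simps
          intro!: exI[of _ h] exI[of _ "Suc (arg 0 ys) # tl ys"])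
  qed (use that in \<open>auto simp: J rule_step_def Let_def true_judgement_0\<close>)
  have r8: ?g if "r = 8"
    using that
    by (auto simp: J rule_step_def Let_def true_judgement_0 intro!: exI[of _ "Var (pi1 d)"])
  have r9: ?g if "r = 9"
    using that by (auto simp: rule_step_def Let_def intro!: exI[of _ Zero])
  have r10: ?g if "r = 10"
    using that by (auto simp: rule_step_def Let_def intro!: exI[of _ One])
  have tms: "\<exists>b (s :: 'f tm) t. tm_in (LPA :: ('f, 'r) lang) s \<and> fv_tm s \<subseteq> {..<b} \<and> tm_in (LPA :: ('f, 'r) lang) t \<and> fv_tm t \<subseteq> {..<b} \<and>
      c1 = pair b (tm_code s) \<and> c2 = pair b (tm_code t)"
    if tags: "t1 = 3 \<and> t2 = 3 \<and> pi1 c1 = pi1 c2"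
  proof -
    obtain b1 and s :: "'f tm" where "tm_in (LPA :: ('f, 'r) lang) s" "fv_tm s \<subseteq> {..<b1}"
      "c1 = pair b1 (tm_code s)"
      using tags assms(1) by (auto simp: J)
    moreover obtain b2 and t :: "'f tm" where "tm_in (LPA :: ('f, 'r) lang) t" "fv_tm t \<subseteq> {..<b2}"
      "c2 = pair b2 (tm_code t)"
      using tags assms(2) by (auto simp: J)
    moreover have "b1 = b2" using calculation tags by simp
    ultimately show ?thesis by blast
  qed
  have r11: ?g if "r = 11"
  proof (cases "t1 = 3 \<and> t2 = 3 \<and> pi1 c1 = pi1 c2")
    case True
    from tms[OF this] obtain b and s t :: "'f tm" where "tm_in (LPA :: ('f, 'r) lang) s" "fv_tm s \<subseteq> {..<b}" "tm_in (LPA :: ('f, 'r) lang) t"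
      "fv_tm t \<subseteq> {..<b}" "c1 = pair b (tm_code s)" "c2 = pair b (tm_code t)" by blast
    then show ?thesis using True that
      by (auto simp: J rule_step_def Let_def intro!: exI[of _ "Add s t"])
  qed (use that in \<open>auto simp: J rule_step_def Let_def true_judgement_0\<close>)
  have r12: ?g if "r = 12"
  proof (cases "t1 = 3 \<and> t2 = 3 \<and> pi1 c1 = pi1 c2")
    case True
    from tms[OF this] obtain b and s t :: "'f tm" where "tm_in (LPA :: ('f, 'r) lang) s" "fv_tm s \<subseteq> {..<b}" "tm_in (LPA :: ('f, 'r) lang) t"
      "fv_tm t \<subseteq> {..<b}" "c1 = pair b (tm_code s)" "c2 = pair b (tm_code t)" by blast
    then show ?thesis using True that
      by (auto simp: J rule_step_def Let_def intro!: exI[of _ "Mul s t"])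
  qed (use that in \<open>auto simp: J rule_step_def Let_def true_judgement_0\<close>)
  have r13: ?g if "r = 13"
    using that by (auto simp: rule_step_def Let_def intro!: exI[of _ FF])
  have r14: ?g if "r = 14"
  proof (cases "t1 = 3 \<and> t2 = 3 \<and> pi1 c1 = pi1 c2")
    case True
    from tms[OF this] obtain b and s t :: "'f tm" where "tm_in (LPA :: ('f, 'r) lang) s" "fv_tm s \<subseteq> {..<b}" "tm_in (LPA :: ('f, 'r) lang) t"
      "fv_tm t \<subseteq> {..<b}" "c1 = pair b (tm_code s)" "c2 = pair b (tm_code t)" by blast
    then show ?thesis using True that
      by (auto simp: J rule_step_def Let_def intro!: exI[of _ "Eq s t"])
  qed (use that in \<open>auto simp: J rule_step_def Let_def true_judgement_0\<close>)
  have r15: ?g if "r = 15"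
  proof (cases "t1 = 3 \<and> t2 = 3 \<and> pi1 c1 = pi1 c2")
    case True
    from tms[OF this] obtain b and s t :: "'f tm" where "tm_in (LPA :: ('f, 'r) lang) s" "fv_tm s \<subseteq> {..<b}" "tm_in (LPA :: ('f, 'r) lang) t"
      "fv_tm t \<subseteq> {..<b}" "c1 = pair b (tm_code s)" "c2 = pair b (tm_code t)" by blast
    then show ?thesis using True that
      by (auto simp: J rule_step_def Let_def intro!: exI[of _ "Less s t"])
  qed (use that in \<open>auto simp: J rule_step_def Let_def true_judgement_0\<close>)
  have r16: ?g if "r = 16"
  proof (cases "t1 = 4 \<and> t2 = 4 \<and> pi1 c1 = pi1 c2")
    case True
    then obtain b and \<phi> :: "('f, 'r) fm" where "fm_in LPA \<phi>" "fv \<phi> \<subseteq> {..<b}" "c1 = pair b (fm_code \<phi>)"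
      using assms(1) by (auto simp: J)
    moreover obtain b' and \<psi> :: "('f, 'r) fm" where
      "fm_in LPA \<psi>" "fv \<psi> \<subseteq> {..<b'}" "c2 = pair b' (fm_code \<psi>)"
      using True assms(2) by (auto simp: J)
    moreover have "b' = b" using calculation True by simp
    ultimately have "fm_in LPA \<phi>" "fv \<phi> \<subseteq> {..<b}" "fm_in LPA \<psi>"
      "fv \<psi> \<subseteq> {..<b}" "c1 = pair b (fm_code \<phi>)" "c2 = pair b (fm_code \<psi>)" by simp_all
    then show ?thesis using True that
      by (auto simp: J rule_step_def Let_def intro!: exI[of _ "Imp \<phi> \<psi>"])
  qed (use that in \<open>auto simp: J rule_step_def Let_def true_judgement_0\<close>)
  have r17: ?g if "r = 17"
  proof (cases "t1 = 4")
    case True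
    then obtain b and \<phi> :: "('f, 'r) fm" where \<phi>: "fm_in LPA \<phi>" "fv \<phi> \<subseteq> {..<b}" "c1 = pair b (fm_code \<phi>)"
      using assms by (force simp: J)
    have "fv (Forall \<phi>) \<subseteq> {..<b - 1}" using \<phi>(2) by auto
    then show ?thesis using True that \<phi>
      by (auto simp: J rule_step_def Let_def intro!: exI[of _ "Forall \<phi>"])
  qed (use that in \<open>auto simp: J rule_step_def Let_def true_judgement_0\<close>)
  have r18: ?g if "r = 18"
  proof (cases "t1 = 1 \<and> t2 = 4 \<and> pi1 (pi2 c1) = lcons (lhd (pi1 (pi2 c1))) 0 \<and> pi2 (pi2 c1) = pi2 c2")
    case True
    then obtain f ys where c: "c1 = pair (pr_code f) (pair (list_encode ys) (pr_eval f ys))"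
      using assms(1) by (auto simp: J)
    obtain b and \<phi> :: "('f, 'r) fm" where
      \<phi>: "fm_in LPA \<phi>" "fv \<phi> \<subseteq> {..<b}" "c2 = pair b (fm_code \<phi>)"
      using True assms(2) by (auto simp: J)
    have "list_encode ys = list_encode [arg 0 ys]" using True by (simp add: c lcons_def)
    then have ys: "ys = [arg 0 ys]" using list_encode_eq by blast
    \<comment> \<open>The bound changes from strict to weak, as a type with \<open>k\<close>
      parameters uses the variables 0 to \<open>k\<close>.\<close>
    have "fv \<phi> \<subseteq> {..b - 1}" using \<phi>(2) by auto
    moreover have "pr_eval f [arg 0 ys] = fm_code \<phi>" using True ys by (simp add: c \<phi>)
    ultimately show ?thesis using True that \<phi>
      by (auto simp: J c rule_step_def Let_def intro!: exI[of _ f] exI[of _ \<phi>])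
  qed (use that in \<open>auto simp: J rule_step_def Let_def true_judgement_0\<close>)
  have r19: ?g if "r = 19"
    using that assms(1)
    by (auto simp: J rule_step_def Let_def true_judgement_0, blast)
  have r20: ?g if "r > 19"
  proof (cases "t1 = 5 \<and> t2 = 6 \<and> pi1 c1 = pi1 c2 \<and> pi1 (pi2 c1) = pi1 (pi2 c2) \<and>
      Suc (pi1 (pi2 (pi2 c1))) = pi1 (pi2 (pi2 c2))")
    case True
    then obtain f k n and \<phi> :: "nat \<Rightarrow> ('f, 'r) fm" where
      1: "\<forall>i. 1 \<le> i \<longrightarrow> i \<le> n \<longrightarrow> fm_in LPA (\<phi> i) \<and> fv (\<phi> i) \<subseteq> {..k} \<and> pr_eval f [i] = fm_code (\<phi> i)"
        "c1 = pair (pr_code f) (pair k (pair n (fm_code (conjseq \<phi> n))))"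
      using assms(1) unfolding J by (elim conjE) (simp, blast)
    obtain g k' i and \<chi> :: "('f, 'r) fm" where
      2: "fm_in LPA \<chi>" "fv \<chi> \<subseteq> {..k'}" "pr_eval g [i] = fm_code \<chi>"
        "c2 = pair (pr_code g) (pair k' (pair i (fm_code \<chi>)))"
      using True assms(2) by (auto simp: J)
    have "g = f" "k' = k" "i = Suc n" using True by (auto simp: 1 2 dest: pr_code_inj)
    define \<phi>' where "\<phi>' = \<phi>(Suc n := \<chi>)"
    have "conjseq \<phi>' n = conjseq \<phi> n" by (rule conjseq_cong) (simp add: \<phi>'_def)
    moreover have "\<forall>i. 1 \<le> i \<longrightarrow> i \<le> Suc n \<longrightarrow>
        fm_in LPA (\<phi>' i) \<and> fv (\<phi>' i) \<subseteq> {..k} \<and> pr_eval f [i] = fm_code (\<phi>' i)"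
      using 1(1) 2(1-3) \<open>g = f\<close> \<open>k' = k\<close> \<open>i = Suc n\<close> by (auto simp: \<phi>'_def)
    moreover have "\<phi>' (Suc n) = \<chi>" by (simp add: \<phi>'_def)
    ultimately show ?thesis using True that \<open>g = f\<close> \<open>k' = k\<close> \<open>i = Suc n\<close> unfolding J 1(2) 2(4)
      by (simp add: rule_step_def Let_def)
         (intro exI[of _ f] exI[of _ k] exI[of _ "Suc n"] exI[of _ \<phi>'], simp)
  qed (use that in \<open>auto simp: J rule_step_def Let_def true_judgement_0\<close>)
  have "r \<in> {..19} \<or> r > 19" by auto
  then have "r = 0 \<or> r = 1 \<or> r = 2 \<or> r = 3 \<or> r = 4 \<or> r = 5 \<or> r = 6 \<or> r = 7 \<or> r = 8 \<or> r = 9 \<or> r = 10 \<or>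
      r = 11 \<or> r = 12 \<or> r = 13 \<or> r = 14 \<or> r = 15 \<or> r = 16 \<or> r = 17 \<or> r = 18 \<or> r = 19 \<or> r > 19"
    by (simp add: eval_nat_numeral atMost_Suc, blast)
  then show ?thesis
    using r0 r1 r2 r3 r4 r5 r6 r7 r8 r9 r10 r11 r12 r13 r14 r15 r16 r17 r18 r19 r20 by (elim disjE)
qed

lemma derivation_sound: "true_judgement TYPE(('f, 'r) fm) (derivation m)"
proof (induction m rule: less_induct)
  case (less m)
  show ?case
  proof (cases m)
    case (Suc m')
    have "pi1 (pi2 m') \<le> m'" "pi2 (pi2 m') \<le> m'"
      by (metis le_prod_encode_1 le_prod_encode_2 le_trans pair_pi)+
    then show ?thesis
      using rule_step_sound[OF less less, of "pi1 (pi2 m')" "pi2 (pi2 m')" "pi1 (pi1 m')" "pi2 (pi1 m')"]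
      by (simp add: Suc derivation_Suc)
  qed (simp add: derivation.simps true_judgement_0)
qed

subsection \<open>Completeness\<close>

lemma derive0: "rule_step (pair (pair r d) (pair 0 0)) = J \<Longrightarrow> J \<in> range derivation"
  using derivation_closed[OF derivation_0 derivation_0] by blast

lemma derive1:
  "J1 \<in> range derivation \<Longrightarrow> rule_step (pair (pair r d) (pair J1 0)) = J \<Longrightarrow> J \<in> range derivation"
  using derivation_closed[OF _ derivation_0] by blast

lemma derive2:
  "J1 \<in> range derivation \<Longrightarrow> J2 \<in> range derivation \<Longrightarrow>
     rule_step (pair (pair r d) (pair J1 J2)) = J \<Longrightarrow> J \<in> range derivation"
  using derivation_closed by blast

lemma derive_eval:
  "pair 1 (pair (pr_code f) (pair (list_encode xs) (pr_eval f xs))) \<in> range derivation"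
proof (induction f arbitrary: xs)
  case PZero
  show ?case by (rule derive0[of 0 "list_encode xs"]) (simp add: rule_step_def Let_def)
next
  case PSucc
  show ?case by (rule derive0[of 1 "list_encode xs"]) (simp add: rule_step_def Let_def)
next
  case (PProj i)
  show ?case
    by (rule derive0[of 2 "pair i (list_encode xs)"]) (simp add: rule_step_def Let_def lnth_encode)
next
  case (PComp f gs)
  have "pair 2 (pair (list_encode (map pr_code gs)) (pair (list_encode xs)
      (list_encode (map (\<lambda>f. pr_eval f xs) gs)))) \<in> range derivation"
    using PComp.IH(2)
  proof (induction gs)
    case Nil
    show ?case by (rule derive0[of 4 "list_encode xs"]) (simp add: rule_step_def Let_def)
  next
    case (Cons g gs)
    have 1: "pair 1 (pair (pr_code g) (pair (list_encode xs) (pr_eval g xs))) \<in> range derivation"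
      by (rule Cons.prems) simp
    have 2: "pair 2 (pair (list_encode (map pr_code gs)) (pair (list_encode xs)
      (list_encode (map (\<lambda>f. pr_eval f xs) gs)))) \<in> range derivation"
      by (rule Cons.IH, rule Cons.prems) simp
    show ?case by (rule derive2[OF 1 2, of 5 0]) (simp add: rule_step_def Let_def lcons_def)
  qed
  from derive2[OF PComp.IH(1)[of "map (\<lambda>f. pr_eval f xs) gs"] this, of 3 0] show ?case
    by (simp add: rule_step_def Let_def comp_op_def comp_def)
next
  case (PRec f g)
  \<comment> \<open>The second premise of rule 6 certifies that \<open>pr_code g\<close> codes a
    program; the value at the empty list serves this purpose.\<close>
  have zero: "pair 1 (pair (pr_code (PRec f g)) (pair (list_encode xs) (pr_eval (PRec f g) xs)))
      \<in> range derivation" if "arg 0 xs = 0" for xs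
    by (rule derive2[OF PRec.IH(1)[of "tl xs"] PRec.IH(2)[of "[]"], of 6 "list_encode xs"])
       (use that in \<open>simp add: rule_step_def Let_def prec_op_0\<close>)
  have *: "pair 1 (pair (pr_code (PRec f g)) (pair (list_encode (n # ys)) (pr_eval (PRec f g) (n # ys))))
      \<in> range derivation" for n ys
  proof (induction n)
    case 0
    show ?case using zero[of "0 # ys"] by simp
  next
    case (Suc n)
    show ?case
      by (rule derive2[OF Suc PRec.IH(2)[of "pr_eval (PRec f g) (n # ys) # n # ys"], of 7 0])
         (simp add: rule_step_def Let_def prec_op_Suc lcons_encode del: list_encode.simps)
  qed
  show ?case
  proof (cases xs)
    case Nil
    then show ?thesis using zero[of xs] by simp
  next
    case (Cons n ys)
    then show ?thesis using *[of n ys] by simp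
  qed
qed

lemma derive_tm:
  "tm_in LPA t \<Longrightarrow> fv_tm t \<subseteq> {..<b} \<Longrightarrow> pair 3 (pair b (tm_code t)) \<in> range derivation"
proof (induction t)
  case (Var i)
  then show ?case by (intro derive0[of 8 "pair i b"]) (simp add: rule_step_def Let_def)
next
  case Zero
  show ?case by (rule derive0[of 9 b]) (simp add: rule_step_def Let_def)
next
  case One
  show ?case by (rule derive0[of 10 b]) (simp add: rule_step_def Let_def)
next
  case (Add s t)
  then have "pair 3 (pair b (tm_code s)) \<in> range derivation" "pair 3 (pair b (tm_code t)) \<in> range derivation"
    by simp_all
  from derive2[OF this, of 11 0] show ?case by (simp add: rule_step_def Let_def)
next
  case (Mul s t)
  then have "pair 3 (pair b (tm_code s)) \<in> range derivation" "pair 3 (pair b (tm_code t)) \<in> range derivation"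
    by simp_all
  from derive2[OF this, of 12 0] show ?case by (simp add: rule_step_def Let_def)
next
  case (Fun f ts)
  then show ?case by (simp add: LPA_def)
qed

lemma derive_fm:
  "fm_in LPA \<phi> \<Longrightarrow> fv \<phi> \<subseteq> {..<b} \<Longrightarrow> pair 4 (pair b (fm_code \<phi>)) \<in> range derivation"
proof (induction \<phi> arbitrary: b)
  case FF
  show ?case by (rule derive0[of 13 b]) (simp add: rule_step_def Let_def)
next
  case (Eq s t)
  then have "pair 3 (pair b (tm_code s)) \<in> range derivation" "pair 3 (pair b (tm_code t)) \<in> range derivation"
    by (auto intro: derive_tm)
  from derive2[OF this, of 14 0] show ?case by (simp add: rule_step_def Let_def)
next
  case (Less s t)
  then have "pair 3 (pair b (tm_code s)) \<in> range derivation" "pair 3 (pair b (tm_code t)) \<in> range derivation"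
    by (auto intro: derive_tm)
  from derive2[OF this, of 15 0] show ?case by (simp add: rule_step_def Let_def)
next
  case (Rel r ts)
  then show ?case by (simp add: LPA_def)
next
  case (Imp \<phi> \<psi>)
  then have "pair 4 (pair b (fm_code \<phi>)) \<in> range derivation" "pair 4 (pair b (fm_code \<psi>)) \<in> range derivation"
    by simp_all
  from derive2[OF this, of 16 0] show ?case by (simp add: rule_step_def Let_def)
next
  case (Forall \<phi>)
  have "fv \<phi> \<subseteq> {..<Suc b}"
  proof
    fix i assume "i \<in> fv \<phi>"
    then show "i \<in> {..<Suc b}" using Forall.prems by (cases i) auto
  qed
  with Forall have "pair 4 (pair (Suc b) (fm_code \<phi>)) \<in> range derivation" by simp
  from derive1[OF this, of 17 0] show ?case by (simp add: rule_step_def Let_def)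
qed

lemma derive_conjseq:
  fixes \<phi> :: "nat \<Rightarrow> ('f, 'r) fm"
  assumes "codes_formulas k p \<phi>"
  shows "pair 5 (pair p (pair k (pair n (fm_code (conjseq \<phi> n))))) \<in> range derivation"
proof -
  obtain f where p: "p = pr_code f" and f: "\<And>i. pr_eval f [i] = fm_code (\<phi> i)"
    and \<phi>: "\<And>i. fm_in LPA (\<phi> i)" "\<And>i. fv (\<phi> i) \<subseteq> {..k}"
    using assms by (auto simp: codes_formulas_def)
  have 6: "pair 6 (pair p (pair k (pair i (fm_code (\<phi> i))))) \<in> range derivation" for i
  proof -
    have "fv (\<phi> i) \<subseteq> {..<Suc k}" using \<phi>(2)[of i] by auto
    from derive2[OF derive_eval[of f "[i]"] derive_fm[OF \<phi>(1) this], of 18 0]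
    show ?thesis by (simp add: rule_step_def Let_def f p lcons_def lhd_def)
  qed
  show ?thesis
  proof (induction n)
    case 0
    show ?case
      by (rule derive1[OF derive_eval[of f "[]"], of 19 k]) (simp add: rule_step_def Let_def p)
  next
    case (Suc n)
    from derive2[OF this 6[of "Suc n"], of 20 0] show ?case by (simp add: rule_step_def Let_def)
  qed
qed

text \<open>Substitution into \<open>C\<close> is avoided, so that the code of the whole depends on
  that of \<open>C\<close> by plain pairing: \<open>x\<close> enters through a quantified
  \<open>Var 0\<close> equal to it, and likewise \<open>s\<close> enters \<open>seq_fm\<close>.
  Below the \<open>k\<close> quantifiers and one more, \<open>x\<close>, \<open>p\<close>,
  \<open>s\<close> are \<open>Var (k + 1)\<close>, \<open>Var (k + 2)\<close>,
  \<open>Var (k + 3)\<close>.\<close>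

definition body :: "nat \<Rightarrow> nat \<Rightarrow> ('f, 'r) fm \<Rightarrow> ('f, 'r) fm" where
  "body p k C = Imp (Eq (Var 1) (numeral_tm p)) ((Forall ^^ k)
     (Imp (Exists (Conj (Eq (Var 0) (Var (k + 3))) (seq_fm 1 k 0)))
       (Imp (Exists C) (Forall (Imp (Eq (Var 0) (Var (k + 1))) C)))))"

definition decode_fm :: "nat \<Rightarrow> ('f, 'r) fm" where
  "decode_fm c = (SOME \<chi>. fm_in LPA \<chi> \<and> fm_code \<chi> = c)"

text \<open>
  The formula \<open>psi m\<close> in the variables \<open>x, p, s\<close> says, if the \<open>m\<close>-th derivation ends with
  \<open>p\<^sub>0, k, n, C\<close>: if \<open>p = p\<^sub>0\<close>, \<open>s\<close> codes \<open>y\<^sub>1, \<dots>, y\<^sub>k\<close> and \<open>C\<close> has a solution, then \<open>x\<close> is one.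
  The vacuous premise makes the code of \<open>psi m\<close> at least \<open>m\<close>, whence the set of codes is recursive.
\<close>

definition psi :: "nat \<Rightarrow> ('f, 'r) fm" where
  "psi m = Imp (Eq (numeral_tm m) (numeral_tm m))
     (let c = pi2 (derivation m) in
      if pi1 (derivation m) = 5 then body (pi1 c) (pi1 (pi2 c)) (decode_fm (pi2 (pi2 (pi2 c))))
      else Neg FF)"

lemma decode_fm_code: "fm_in LPA \<phi> \<Longrightarrow> decode_fm (fm_code \<phi>) = \<phi>"
  unfolding decode_fm_def by (rule some_equality) (auto intro: fm_code_inj)

text \<open>Soundness of derivations recovers, from the code in the conclusion, actual formulas with
  the wanted types of symbols.\<close>

lemma psi_cases:
  obtains (trivial) "(psi m :: ('f, 'r) fm) = Imp (Eq (numeral_tm m) (numeral_tm m)) (Neg FF)"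
      "pi1 (derivation m) \<noteq> 5"
  | (body) f k n and \<phi> :: "nat \<Rightarrow> ('f, 'r) fm" where
    "psi m = Imp (Eq (numeral_tm m) (numeral_tm m)) (body (pr_code f) k (conjseq \<phi> n))"
    "derivation m = pair 5 (pair (pr_code f) (pair k (pair n (fm_code (conjseq \<phi> n)))))"
    "\<And>i. 1 \<le> i \<Longrightarrow> i \<le> n \<Longrightarrow> fm_in LPA (\<phi> i)" "\<And>i. 1 \<le> i \<Longrightarrow> i \<le> n \<Longrightarrow> fv (\<phi> i) \<subseteq> {..k}"
    "\<And>i. 1 \<le> i \<Longrightarrow> i \<le> n \<Longrightarrow> pr_eval f [i] = fm_code (\<phi> i)"
proof (cases "pi1 (derivation m) = 5")
  case True
  then have "derivation m = pair 5 (pi2 (derivation m))" by (metis pair_pi)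
  moreover from this have "true_judgement TYPE(('f, 'r) fm) (pair 5 (pi2 (derivation m)))"
    using derivation_sound[of m] by simp
  ultimately obtain f k n and \<phi> :: "nat \<Rightarrow> ('f, 'r) fm" where
    \<phi>: "\<forall>i. 1 \<le> i \<longrightarrow> i \<le> n \<longrightarrow> fm_in LPA (\<phi> i) \<and> fv (\<phi> i) \<subseteq> {..k} \<and> pr_eval f [i] = fm_code (\<phi> i)"
    and d: "derivation m = pair 5 (pair (pr_code f) (pair k (pair n (fm_code (conjseq \<phi> n)))))"
    unfolding true_judgement_pair by metis
  have "fm_in LPA (conjseq \<phi> n)" using \<phi> by (intro conjseq_in) auto
  then show ?thesis
    using \<phi> by (intro body[OF _ d]) (auto simp: psi_def d decode_fm_code)
next
  case False
  then show ?thesis by (intro trivial) (auto simp: psi_def)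
qed

lemma fm_in_seq_fm: "fm_in L (seq_fm i k j)"
  by (induction k arbitrary: i j) (auto simp: Let_def)

lemma fv_seq_fm: "fv (seq_fm i k j :: ('f, 'r) fm) \<subseteq> insert j {i..<i + k}"
proof (induction k arbitrary: i j)
  case (Suc k)
  have "i \<le> x \<and> x < Suc (i + k)" if "Suc x \<in> fv (seq_fm (Suc (Suc i)) k 0 :: ('f, 'r) fm)" for x
    using subsetD[OF Suc that] by auto
  then show ?case unfolding seq_fm.simps Let_def by (auto; blast)
qed (simp)

lemma fm_in_psi: "fm_in LPA (psi m :: ('f, 'r) fm)"
proof (cases m rule: psi_cases[where ?'f = 'f and ?'r = 'r])
  case (body f k n \<phi>)
  have "fm_in LPA (conjseq \<phi> n)" using body by (intro conjseq_in) auto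
  then show ?thesis by (simp add: body body_def fm_in_seq_fm)
qed simp

lemma fv_psi: "fv (psi m :: ('f, 'r) fm) \<subseteq> {..2}"
proof (cases m rule: psi_cases[where ?'f = 'f and ?'r = 'r])
  case (body f k n \<phi>)
  have 1: "fv (conjseq \<phi> n) \<subseteq> {..k}" using body by (intro fv_conjseq) auto
  have "i \<le> 2" if "i + k \<in> fv (Imp (Exists (Conj (Eq (Var 0) (Var (k + 3))) (seq_fm 1 k 0)))
       (Imp (Exists (conjseq \<phi> n)) (Forall (Imp (Eq (Var 0) (Var (k + 1))) (conjseq \<phi> n)))))" for i
    using that 1 fv_seq_fm[of 1 k 0, where ?'f = 'f and ?'r = 'r] by auto
  then have "fv ((Forall ^^ k) (Imp (Exists (Conj (Eq (Var 0) (Var (k + 3))) (seq_fm 1 k 0)))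
       (Imp (Exists (conjseq \<phi> n)) (Forall (Imp (Eq (Var 0) (Var (k + 1))) (conjseq \<phi> n)))))) \<subseteq> {..2}"
    by (auto simp only: fv_Forall_pow mem_Collect_eq atMost_iff)
  then show ?thesis by (simp add: body body_def)
qed simp

section \<open>Codes of the enumerated formulas as numerical functions\<close>

definition code_numeral :: "nat \<Rightarrow> nat" where
  "code_numeral n = rec_nat (pair 1 0) (\<lambda>_ r. pair 3 (pair r (pair 2 0))) n"

lemma tm_code_numeral [simp]: "tm_code (numeral_tm n) = code_numeral n"
  by (induction n) (auto simp: code_numeral_def)

lemma pr1_code_numeral [pr1_intros]: "pr1 f \<Longrightarrow> pr1 (\<lambda>x. code_numeral (f x))"
  unfolding code_numeral_def by (intro pr1_intros)

lemma add_le_pair: "a + b \<le> pair a b"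
proof -
  have "n \<le> triangle n" for n by (induction n) auto
  from this[of "a + b"] show ?thesis by (simp add: prod_encode_def)
qed

lemma code_numeral_ge: "n \<le> code_numeral n"
proof (induction n)
  case (Suc n)
  have "code_numeral (Suc n) = pair 3 (pair (code_numeral n) (pair 2 0))" by (simp add: code_numeral_def)
  moreover have "3 + pair (code_numeral n) (pair 2 0) \<le> \<dots>" by (metis add_le_pair calculation)
  moreover have "code_numeral n \<le> pair (code_numeral n) (pair 2 0)" by (rule le_prod_encode_1)
  ultimately show ?case using Suc by linarith
qed simp

definition code_Forall_pow :: "nat \<Rightarrow> nat \<Rightarrow> nat" where
  "code_Forall_pow k c = rec_nat c (\<lambda>_ r. pair 4 r) k"

lemma fm_code_Forall_pow [simp]: "fm_code ((Forall ^^ k) \<phi>) = code_Forall_pow k (fm_code \<phi>)"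
  by (induction k) (auto simp: code_Forall_pow_def)

lemma pr1_code_Forall_pow [pr1_intros]:
  "pr1 f \<Longrightarrow> pr1 g \<Longrightarrow> pr1 (\<lambda>x. code_Forall_pow (f x) (g x))"
  unfolding code_Forall_pow_def by (intro pr1_intros)

definition code_seq_step :: "nat \<Rightarrow> nat \<Rightarrow> nat" where
  "code_seq_step v c = (let
       imp = \<lambda>a b. pair 3 (pair a b); neg = \<lambda>a. pair 3 (pair a (pair 0 0));
       add = \<lambda>a b. pair 3 (pair a b);
       z = pair 0 1; y = pair 0 v; w = pair 0 0; one = pair 2 0;
       e = pair 1 (pair (add z z) (add (pair 4 (pair (add y w) (add (add y w) one)))
         (add (add y y) (add one one))))
     in neg (pair 4 (neg (neg (imp e (neg c))))))"

lemma pr1_code_seq_step [pr1_intros]: "pr1 f \<Longrightarrow> pr1 g \<Longrightarrow> pr1 (\<lambda>x. code_seq_step (f x) (g x))"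
  unfolding code_seq_step_def Let_def by (intro pr1_intros)

lemma fm_code_seq_fm_Suc:
  "fm_code (seq_fm i (Suc k) 0 :: ('f, 'r) fm) =
     code_seq_step (Suc i) (fm_code (seq_fm (Suc (Suc i)) k 0 :: ('f, 'r) fm))"
  by (simp add: code_seq_step_def Let_def)

text \<open>Unfolding \<open>seq_fm\<close> raises its first index by two per level, whereas
  primitive recursion builds from the innermost level outwards. With \<open>d\<close> levels built,
  the next one has its entry at the variable \<open>(k - d) + (k - d)\<close>.\<close>

definition code_seq :: "nat \<Rightarrow> nat" where
  "code_seq k = rec_nat (pair 1 (pair (pair 0 0) (pair 1 0)))
     (\<lambda>d r. code_seq_step ((k - d) + (k - d)) r) k"

lemma pr1_code_seq [pr1_intros]: "pr1 f \<Longrightarrow> pr1 (\<lambda>x. code_seq (f x))"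
proof -
  have "pr1 code_seq" unfolding code_seq_def by (intro pr1_intros)
  then show "pr1 f \<Longrightarrow> pr1 (\<lambda>x. code_seq (f x))" by (rule pr1_comp)
qed

lemma fm_code_seq_fm [simp]: "fm_code (seq_fm (Suc 0) k 0 :: ('f, 'r) fm) = code_seq k"
proof -
  have "d \<le> k \<Longrightarrow> rec_nat (pair 1 (pair (pair 0 0) (pair 1 0)))
     (\<lambda>d r. code_seq_step ((k - d) + (k - d)) r) d =
     fm_code (seq_fm (Suc ((k - d) + (k - d))) d 0 :: ('f, 'r) fm)" for d
  proof (induction d)
    case (Suc d)
    have k: "k - d = Suc (k - Suc d)" using Suc.prems by simp
    have "fm_code (seq_fm (Suc ((k - Suc d) + (k - Suc d))) (Suc d) 0 :: ('f, 'r) fm) =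
        code_seq_step ((k - d) + (k - d)) (fm_code (seq_fm (Suc ((k - d) + (k - d))) d 0 :: ('f, 'r) fm))"
      unfolding fm_code_seq_fm_Suc by (simp add: k)
    then show ?case using Suc by simp
  qed simp
  from this[of k] show ?thesis by (simp add: code_seq_def)
qed

lemma fm_code_body:
  "fm_code (body p k C :: ('f, 'r) fm) = (let
       imp = \<lambda>a b. pair 3 (pair a b); neg = \<lambda>a. pair 3 (pair a (pair 0 0)); c = fm_code C in
     imp (pair 1 (pair (pair 0 1) (code_numeral p))) (code_Forall_pow k
       (imp (neg (pair 4 (neg (neg (imp (pair 1 (pair (pair 0 0) (pair 0 (k + 3)))) (neg (code_seq k)))))))
         (imp (neg (pair 4 (neg c))) (pair 4 (imp (pair 1 (pair (pair 0 0) (pair 0 (k + 1)))) c))))))"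
  by (simp add: body_def Let_def)

definition code_psi :: "nat \<Rightarrow> nat" where
  "code_psi m = pair 3 (pair (pair 1 (pair (code_numeral m) (code_numeral m)))
     (if pi1 (derivation m) = 5 then
       (let imp = \<lambda>a b. pair 3 (pair a b); neg = \<lambda>a. pair 3 (pair a (pair 0 0));
          p = pi1 (pi2 (derivation m)); k = pi1 (pi2 (pi2 (derivation m)));
          c = pi2 (pi2 (pi2 (pi2 (derivation m)))) in
        imp (pair 1 (pair (pair 0 1) (code_numeral p))) (code_Forall_pow k
          (imp (neg (pair 4 (neg (neg (imp (pair 1 (pair (pair 0 0) (pair 0 (k + 3)))) (neg (code_seq k)))))))
            (imp (neg (pair 4 (neg c))) (pair 4 (imp (pair 1 (pair (pair 0 0) (pair 0 (k + 1)))) c))))))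
      else pair 3 (pair (pair 0 0) (pair 0 0))))"

lemma pr1_code_psi [pr1_intros]: "pr1 f \<Longrightarrow> pr1 (\<lambda>x. code_psi (f x))"
  unfolding code_psi_def Let_def by (intro pr1_intros pr1_comp[OF pr1_derivation])

lemma fm_code_psi [simp]: "fm_code (psi m :: ('f, 'r) fm) = code_psi m"
proof (cases m rule: psi_cases[where ?'f = 'f and ?'r = 'r])
  case (body f k n \<phi>)
  show ?thesis by (simp add: body(1) code_psi_def fm_code_body Let_def) (simp add: body(2))
qed (simp add: code_psi_def)

lemma le_pair1: "m \<le> a \<Longrightarrow> m \<le> pair a b"
  and le_pair2: "m \<le> b \<Longrightarrow> m \<le> pair a b"
  by (meson le_prod_encode_1 le_prod_encode_2 le_trans)+

lemma code_psi_ge: "m \<le> code_psi m"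
  unfolding code_psi_def
  by (rule le_pair2, rule le_pair1, rule le_pair2, rule le_pair1, rule code_numeral_ge)

lemma recursive_psi: "recursive_set (fm_code ` range (psi :: nat \<Rightarrow> ('f, 'r) fm))"
proof -
  have "recursive_set (range code_psi)"
    by (rule recursive_set_range) (auto intro: pr1_intros code_psi_ge)
  then show ?thesis by (simp add: image_image)
qed

subsection \<open>Coding of truth values by divisibility\<close>

text \<open>
  \<open>pair_tm\<close> is twice the Cantor pairing function. \<open>divs_fm d c\<close>: \<open>c\<close> is nonzero and divisible by
  \<open>1, \<dots>, d\<close>. \<open>bit_fm a c v\<close>: \<open>1 + (v + 1) c\<close> divides \<open>a\<close>, as in the beta function.
\<close>

definition pair_tm :: "'f tm \<Rightarrow> 'f tm \<Rightarrow> 'f tm" where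
  "pair_tm s t = Add (Mul (Add s t) (Add (Add s t) One)) (Add s s)"

definition divs_fm :: "'f tm \<Rightarrow> 'f tm \<Rightarrow> ('f, 'r) fm" where
  "divs_fm d c = Conj (Neg (Eq c Zero))
     (Forall (Forall (Imp (Eq (lift_tm (lift_tm d)) (Add (Add (Var 1) One) (Var 0)))
       (Exists (Eq (Mul (Add (Var 2) One) (Var 0)) (lift_tm (lift_tm (lift_tm c))))))))"

definition bit_fm :: "'f tm \<Rightarrow> 'f tm \<Rightarrow> 'f tm \<Rightarrow> ('f, 'r) fm" where
  "bit_fm a c v = Exists (Eq (Mul (Add One (Mul (Add (lift_tm v) One) (lift_tm c))) (Var 0)) (lift_tm a))"

definition index_tm :: "'f tm \<Rightarrow> 'f tm \<Rightarrow> 'f tm \<Rightarrow> 'f tm \<Rightarrow> 'f tm" where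
  "index_tm m x p s = pair_tm m (pair_tm x (pair_tm p s))"

text \<open>Below the three quantifiers, \<open>Var 3\<close> is the type variable \<open>a\<close>
  and \<open>Var 4\<close> the parameter \<open>c\<close>. The restriction to
  \<open>divs v c\<close> keeps the moduli \<open>1 + (v + 1) c\<close> coprime to each
  other.\<close>

definition Q :: "nat \<Rightarrow> ('f, 'r) fm" where
  "Q m = (let v = index_tm (numeral_tm m) (Var 0) (Var 1) (Var 2) in
     Forall (Forall (Forall (Imp (divs_fm v (Var 4)) (Iff (bit_fm (Var 3) (Var 4) v) (psi m))))))"

lemma lift_simps [simp]:
  "lift_tm (Var i) = Var (Suc i)" "lift_tm Zero = Zero" "lift_tm One = One"
  "lift_tm (Add s t) = Add (lift_tm s) (lift_tm t)" "lift_tm (Mul s t) = Mul (lift_tm s) (lift_tm t)"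
  "lift_tm (numeral_tm n) = numeral_tm n"
proof -
  show "lift_tm (numeral_tm n) = numeral_tm n"
    by (induction n) (simp_all add: lift_tm_def)
qed (simp_all add: lift_tm_def)

lemma fv_lift_tm [simp]: "fv_tm (lift_tm t) = Suc ` fv_tm t"
  by (induction t) (auto simp: lift_tm_def)

lemma tm_in_lift [simp]: "tm_in L t \<Longrightarrow> tm_in L (lift_tm t)"
  by (simp add: lift_tm_def tm_in_subst)

lemma fm_in_coding [simp]:
  "tm_in L s \<Longrightarrow> tm_in L t \<Longrightarrow> tm_in L (pair_tm s t)"
  "tm_in L s \<Longrightarrow> tm_in L t \<Longrightarrow> tm_in L u \<Longrightarrow> tm_in L v \<Longrightarrow> tm_in L (index_tm s t u v)"
  "tm_in L s \<Longrightarrow> tm_in L t \<Longrightarrow> fm_in L (divs_fm s t)"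
  "tm_in L s \<Longrightarrow> tm_in L t \<Longrightarrow> tm_in L u \<Longrightarrow> fm_in L (bit_fm s t u)"
  by (simp_all add: pair_tm_def index_tm_def divs_fm_def bit_fm_def)

lemma fm_in_Q: "fm_in LPA (Q m)"
  by (simp add: Q_def Let_def fm_in_psi)

lemma fv_Q: "fv (Q m :: ('f, 'r) fm) \<subseteq> {..1}"
  using fv_psi[of m, where ?'f = 'f and ?'r = 'r]
  by (auto simp: Q_def Let_def divs_fm_def bit_fm_def index_tm_def pair_tm_def)

lemma pr1_code_Q: "pr1 (\<lambda>m. fm_code (Q m :: ('f, 'r) fm))"
  unfolding Q_def Let_def divs_fm_def bit_fm_def index_tm_def pair_tm_def
  by (simp only: lift_simps fm_code.simps tm_code.simps fm_code_psi tm_code_numeral)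
     (intro pr1_intros)

lemma code_Forall_ge: "m \<le> fm_code \<phi> \<Longrightarrow> m \<le> fm_code (Forall \<phi>)"
  and code_Imp_ge1: "m \<le> fm_code \<phi> \<Longrightarrow> m \<le> fm_code (Imp \<phi> \<psi>)"
  and code_Imp_ge2: "m \<le> fm_code \<psi> \<Longrightarrow> m \<le> fm_code (Imp \<phi> \<psi>)"
  by (simp_all add: le_pair1 le_pair2)

lemma code_Q_ge: "m \<le> fm_code (Q m)"
  unfolding Q_def Let_def
  by (intro code_Forall_ge, rule code_Imp_ge2, rule code_Imp_ge1, rule code_Imp_ge1,
      rule code_Imp_ge2) (simp add: code_psi_ge)

lemma recursive_Q: "recursive_set (fm_code ` range (Q :: nat \<Rightarrow> ('f, 'r) fm))"
  using recursive_set_range[OF pr1_code_Q code_Q_ge] by (simp add: image_image)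

section \<open>Arithmetic in models of PA\<close>

lemma prepend_Cons_numeral [simp]: "prepend (x # xs) e (numeral v) = prepend xs e (pred_numeral v)"
  by (simp add: numeral_eq_Suc)

locale pa =
  fixes M :: "('f, 'r, 'm) struc"
  assumes zero_closed [simp]: "zeroI M \<in> Dom M" and one_closed [simp]: "oneI M \<in> Dom M"
    and add_closed [simp]: "a \<in> Dom M \<Longrightarrow> b \<in> Dom M \<Longrightarrow> addI M a b \<in> Dom M"
    and mul_closed [simp]: "a \<in> Dom M \<Longrightarrow> b \<in> Dom M \<Longrightarrow> mulI M a b \<in> Dom M"
    and PA: "\<phi> \<in> PA \<Longrightarrow> range e \<subseteq> Dom M \<Longrightarrow> sat M e \<phi>"
begin

abbreviation "D \<equiv> Dom M"
abbreviation zero ("\<zero>") where "\<zero> \<equiv> zeroI M"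
abbreviation one ("\<one>") where "\<one> \<equiv> oneI M"
abbreviation add (infixl "\<oplus>" 65) where "a \<oplus> b \<equiv> addI M a b"
abbreviation mul (infixl "\<otimes>" 70) where "a \<otimes> b \<equiv> mulI M a b"

lemma zero_env: "range (\<lambda>_. \<zero>) \<subseteq> D"
  by auto

lemma succ_nonzero: "a \<in> D \<Longrightarrow> a \<oplus> \<one> \<noteq> \<zero>"
  using PA[of "Forall (Neg (Eq (Add (Var 0) One) Zero))", OF _ zero_env] by (simp add: PA_def)

lemma succ_inj: "a \<in> D \<Longrightarrow> b \<in> D \<Longrightarrow> a \<oplus> \<one> = b \<oplus> \<one> \<Longrightarrow> a = b"
  using PA[of "Forall (Forall (Imp (Eq (Add (Var 1) One) (Add (Var 0) One)) (Eq (Var 1) (Var 0))))",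
      OF _ zero_env]
  by (simp add: PA_def)

lemma add_zero [simp]: "a \<in> D \<Longrightarrow> a \<oplus> \<zero> = a"
  using PA[of "Forall (Eq (Add (Var 0) Zero) (Var 0))", OF _ zero_env] by (simp add: PA_def)

lemma add_succ: "a \<in> D \<Longrightarrow> b \<in> D \<Longrightarrow> a \<oplus> (b \<oplus> \<one>) = a \<oplus> b \<oplus> \<one>"
  using PA[of "Forall (Forall (Eq (Add (Var 1) (Add (Var 0) One)) (Add (Add (Var 1) (Var 0)) One)))",
      OF _ zero_env]
  by (simp add: PA_def)

lemma mul_zero [simp]: "a \<in> D \<Longrightarrow> a \<otimes> \<zero> = \<zero>"
  using PA[of "Forall (Eq (Mul (Var 0) Zero) Zero)", OF _ zero_env] by (simp add: PA_def)

lemma mul_succ: "a \<in> D \<Longrightarrow> b \<in> D \<Longrightarrow> a \<otimes> (b \<oplus> \<one>) = a \<otimes> b \<oplus> a"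
  using PA[of "Forall (Forall (Eq (Mul (Var 1) (Add (Var 0) One)) (Add (Mul (Var 1) (Var 0)) (Var 1))))",
      OF _ zero_env]
  by (simp add: PA_def)

text \<open>The parameters come from an arbitrary environment; finitely many of them occur in
  \<open>\<phi>\<close>, and these are fed to the closing quantifiers of the axiom.\<close>

lemma induct_fm:
  assumes \<phi>: "fm_in LPA \<phi>" and e: "range e \<subseteq> D"
    and 0: "sat M (case_nat \<zero> e) \<phi>"
    and S: "\<And>a. a \<in> D \<Longrightarrow> sat M (case_nat a e) \<phi> \<Longrightarrow> sat M (case_nat (a \<oplus> \<one>) e) \<phi>"
    and b: "b \<in> D"
  shows "sat M (case_nat b e) \<phi>"
proof -
  obtain k where k: "fv \<phi> \<subseteq> {..<k}" using fv_bounded by blast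
  then have "fv \<phi> \<subseteq> {..k}" by auto
  with \<phi> have "(Forall ^^ k) (induction_axiom \<phi>) \<in> PA" unfolding PA_def by blast
  from PA[OF this e] have "sat M (prepend (map e [0..<k]) e) (induction_axiom \<phi>)"
    using e unfolding sat_Forall_pow by (auto simp: image_subset_iff)
  moreover define e' where "e' = prepend (map e [0..<k]) e"
  ultimately have ind: "sat M e' (induction_axiom \<phi>)" by simp
  have e': "sat M (case_nat a e') \<phi> \<longleftrightarrow> sat M (case_nat a e) \<phi>" for a
    by (rule sat_cong) (use k in \<open>auto simp: e'_def prepend_def split: nat.split\<close>)
  have env: "(\<lambda>i. eval M e' (case_nat Zero Var i)) = case_nat \<zero> e'"
    "(\<lambda>i. eval M (case_nat a e') (case_nat (Add (Var 0) One) (\<lambda>i. Var (Suc i)) i)) = case_nat (a \<oplus> \<one>) e'" for a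
    by (auto simp: fun_eq_iff split: nat.split)
  show ?thesis
    using ind 0 S b unfolding induction_axiom_def sat.simps sat_subst env e' by blast
qed

text \<open>Induction for a predicate of the metatheory, once an arithmetical formula defining it
  from the listed parameters is exhibited.\<close>

lemma induct_formula:
  assumes "fm_in LPA \<phi>" "set ps \<subseteq> D"
    and P: "\<And>a. a \<in> D \<Longrightarrow> sat M (prepend (a # ps) (\<lambda>_. \<zero>)) \<phi> \<longleftrightarrow> P a"
    and "P \<zero>" and "\<And>a. a \<in> D \<Longrightarrow> P a \<Longrightarrow> P (a \<oplus> \<one>)" and "b \<in> D"
  shows "P b"
proof -
  have "range (prepend ps (\<lambda>_. \<zero>)) \<subseteq> D" by (rule range_prepend[OF assms(2) zero_env])
  from induct_fm[OF assms(1) this, of b] show ?thesis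
    using assms by (simp add: case_nat_prepend)
qed

section \<open>Semiring laws\<close>

lemma zero_add [simp]: "a \<in> D \<Longrightarrow> \<zero> \<oplus> a = a"
  by (rule induct_formula[where \<phi> = "Eq (Add Zero (Var 0)) (Var 0)" and ps = "[]"])
     (simp_all add: add_succ)

lemma succ_add: "a \<in> D \<Longrightarrow> b \<in> D \<Longrightarrow> a \<oplus> \<one> \<oplus> b = a \<oplus> b \<oplus> \<one>"
  by (rule induct_formula[where \<phi> = "Eq (Add (Add (Var 1) One) (Var 0)) (Add (Add (Var 1) (Var 0)) One)"
        and ps = "[a]" and P = "\<lambda>b. a \<oplus> \<one> \<oplus> b = a \<oplus> b \<oplus> \<one>"])
     (simp_all add: add_succ)

lemma add_comm: "a \<in> D \<Longrightarrow> b \<in> D \<Longrightarrow> a \<oplus> b = b \<oplus> a"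
  by (rule induct_formula[where \<phi> = "Eq (Add (Var 1) (Var 0)) (Add (Var 0) (Var 1))" and ps = "[a]"
        and P = "\<lambda>b. a \<oplus> b = b \<oplus> a"])
     (simp_all add: add_succ succ_add)

lemma add_assoc: "a \<in> D \<Longrightarrow> b \<in> D \<Longrightarrow> c \<in> D \<Longrightarrow> a \<oplus> b \<oplus> c = a \<oplus> (b \<oplus> c)"
  by (rule induct_formula[where ps = "[a, b]" and P = "\<lambda>c. a \<oplus> b \<oplus> c = a \<oplus> (b \<oplus> c)"
        and \<phi> = "Eq (Add (Add (Var 1) (Var 2)) (Var 0)) (Add (Var 1) (Add (Var 2) (Var 0)))"])
     (simp_all add: add_succ)

lemma add_left_comm: "a \<in> D \<Longrightarrow> b \<in> D \<Longrightarrow> c \<in> D \<Longrightarrow> a \<oplus> (b \<oplus> c) = b \<oplus> (a \<oplus> c)"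
  by (metis add_assoc add_comm)

lemma succ_eq: "a \<in> D \<Longrightarrow> b \<in> D \<Longrightarrow> a \<oplus> \<one> = b \<oplus> \<one> \<longleftrightarrow> a = b"
  using succ_inj by blast

lemma add_cancel: "a \<in> D \<Longrightarrow> b \<in> D \<Longrightarrow> c \<in> D \<Longrightarrow> a \<oplus> c = b \<oplus> c \<longleftrightarrow> a = b"
  by (rule induct_formula[where ps = "[a, b]" and P = "\<lambda>c. a \<oplus> c = b \<oplus> c \<longleftrightarrow> a = b"
        and \<phi> = "Iff (Eq (Add (Var 1) (Var 0)) (Add (Var 2) (Var 0))) (Eq (Var 1) (Var 2))"])
     (auto simp: add_succ succ_eq)

lemma add_cancel_left: "a \<in> D \<Longrightarrow> b \<in> D \<Longrightarrow> c \<in> D \<Longrightarrow> c \<oplus> a = c \<oplus> b \<longleftrightarrow> a = b"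
  by (metis add_cancel add_comm)

lemma zero_mul [simp]: "a \<in> D \<Longrightarrow> \<zero> \<otimes> a = \<zero>"
  by (rule induct_formula[where \<phi> = "Eq (Mul Zero (Var 0)) Zero" and ps = "[]"])
     (simp_all add: mul_succ)

lemma succ_mul: "a \<in> D \<Longrightarrow> b \<in> D \<Longrightarrow> (a \<oplus> \<one>) \<otimes> b = a \<otimes> b \<oplus> b"
  by (rule induct_formula[where ps = "[a]" and P = "\<lambda>b. (a \<oplus> \<one>) \<otimes> b = a \<otimes> b \<oplus> b"
        and \<phi> = "Eq (Mul (Add (Var 1) One) (Var 0)) (Add (Mul (Var 1) (Var 0)) (Var 0))"])
     (simp_all add: mul_succ add_assoc add_comm add_left_comm)

lemma mul_comm: "a \<in> D \<Longrightarrow> b \<in> D \<Longrightarrow> a \<otimes> b = b \<otimes> a"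
  by (rule induct_formula[where \<phi> = "Eq (Mul (Var 1) (Var 0)) (Mul (Var 0) (Var 1))" and ps = "[a]"
        and P = "\<lambda>b. a \<otimes> b = b \<otimes> a"])
     (simp_all add: mul_succ succ_mul)

lemma distrib_left: "a \<in> D \<Longrightarrow> b \<in> D \<Longrightarrow> c \<in> D \<Longrightarrow> a \<otimes> (b \<oplus> c) = a \<otimes> b \<oplus> a \<otimes> c"
  by (rule induct_formula[where ps = "[a, b]" and P = "\<lambda>c. a \<otimes> (b \<oplus> c) = a \<otimes> b \<oplus> a \<otimes> c"
        and \<phi> = "Eq (Mul (Var 1) (Add (Var 2) (Var 0))) (Add (Mul (Var 1) (Var 2)) (Mul (Var 1) (Var 0)))"])
     (simp_all add: mul_succ add_succ add_assoc[of "a \<otimes> b" _ a])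

lemma distrib_right: "a \<in> D \<Longrightarrow> b \<in> D \<Longrightarrow> c \<in> D \<Longrightarrow> (b \<oplus> c) \<otimes> a = b \<otimes> a \<oplus> c \<otimes> a"
  by (simp add: mul_comm[of _ a] distrib_left)

lemma mul_one [simp]: "a \<in> D \<Longrightarrow> a \<otimes> \<one> = a" "a \<in> D \<Longrightarrow> \<one> \<otimes> a = a"
  using mul_succ[of a \<zero>] succ_mul[of \<zero> a] by simp_all

lemma mul_assoc: "a \<in> D \<Longrightarrow> b \<in> D \<Longrightarrow> c \<in> D \<Longrightarrow> a \<otimes> b \<otimes> c = a \<otimes> (b \<otimes> c)"
  by (rule induct_formula[where ps = "[a, b]" and P = "\<lambda>c. a \<otimes> b \<otimes> c = a \<otimes> (b \<otimes> c)"
        and \<phi> = "Eq (Mul (Mul (Var 1) (Var 2)) (Var 0)) (Mul (Var 1) (Mul (Var 2) (Var 0)))"])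
     (simp_all add: mul_succ distrib_left)

lemma mul_left_comm: "a \<in> D \<Longrightarrow> b \<in> D \<Longrightarrow> c \<in> D \<Longrightarrow> a \<otimes> (b \<otimes> c) = b \<otimes> (a \<otimes> c)"
  by (metis mul_assoc mul_comm)

lemmas semiring = add_assoc add_comm add_left_comm mul_assoc mul_comm mul_left_comm
  distrib_left distrib_right

section \<open>Order and the least number principle\<close>

lemma zero_or_succ: "a \<in> D \<Longrightarrow> a = \<zero> \<or> (\<exists>b\<in>D. a = b \<oplus> \<one>)"
  by (rule induct_formula[where ps = "[]" and P = "\<lambda>a. a = \<zero> \<or> (\<exists>b\<in>D. a = b \<oplus> \<one>)"
        and \<phi> = "Imp (Neg (Eq (Var 0) Zero)) (Exists (Eq (Var 1) (Add (Var 0) One)))"])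
     (auto simp: case_nat_prepend)

lemma add_eq_zero: "a \<in> D \<Longrightarrow> b \<in> D \<Longrightarrow> a \<oplus> b = \<zero> \<longleftrightarrow> a = \<zero> \<and> b = \<zero>"
  using zero_or_succ[of b] by (auto simp: succ_nonzero add_assoc[symmetric])

lemma mul_eq_zero: "a \<in> D \<Longrightarrow> b \<in> D \<Longrightarrow> a \<otimes> b = \<zero> \<longleftrightarrow> a = \<zero> \<or> b = \<zero>"
  using zero_or_succ[of b] by (auto simp: mul_succ add_eq_zero)

lemma one_nonzero: "\<one> \<noteq> \<zero>"
  using succ_nonzero[of \<zero>] by simp

lemma linear: "a \<in> D \<Longrightarrow> b \<in> D \<Longrightarrow> (\<exists>c\<in>D. a \<oplus> c = b) \<or> (\<exists>c\<in>D. b \<oplus> c = a)"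
proof (rule induct_formula[where ps = "[b]" and b = a
      and P = "\<lambda>a. (\<exists>c\<in>D. a \<oplus> c = b) \<or> (\<exists>c\<in>D. b \<oplus> c = a)"
      and \<phi> = "Imp (Neg (Exists (Eq (Add (Var 1) (Var 0)) (Var 2)))) (Exists (Eq (Add (Var 2) (Var 0)) (Var 1)))"])
  fix a assume b: "b \<in> D" and a: "a \<in> D" and "(\<exists>c\<in>D. a \<oplus> c = b) \<or> (\<exists>c\<in>D. b \<oplus> c = a)"
  then consider c where "c \<in> D" "a \<oplus> c = b" | c where "c \<in> D" "b \<oplus> c = a" by blast
  then show "(\<exists>c\<in>D. a \<oplus> \<one> \<oplus> c = b) \<or> (\<exists>c\<in>D. b \<oplus> c = a \<oplus> \<one>)"
  proof cases
    case (1 c)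
    from zero_or_succ[OF 1(1)] show ?thesis
    proof
      assume "c = \<zero>"
      then have "b \<oplus> \<one> = a \<oplus> \<one>" using 1 a by simp
      then show ?thesis by (intro disjI2 bexI[of _ \<one>]) simp_all
    next
      assume "\<exists>d\<in>D. c = d \<oplus> \<one>"
      then obtain d where "d \<in> D" "c = d \<oplus> \<one>" by blast
      then have "a \<oplus> \<one> \<oplus> d = b" using 1 a by (simp add: semiring)
      then show ?thesis using \<open>d \<in> D\<close> by blast
    qed
  next
    case (2 c)
    then have "b \<oplus> (c \<oplus> \<one>) = a \<oplus> \<one>" using b by (simp add: add_succ)
    then show ?thesis using 2(1) by (intro disjI2 bexI[of _ "c \<oplus> \<one>"]) simp_all
  qed
qed (auto simp: case_nat_prepend)

lemma trichotomy:
  assumes "a \<in> D" "b \<in> D"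
  obtains "a = b" | c where "c \<in> D" "b = a \<oplus> c \<oplus> \<one>" | c where "c \<in> D" "a = b \<oplus> c \<oplus> \<one>"
proof -
  consider c where "c \<in> D" "a \<oplus> c = b" | c where "c \<in> D" "b \<oplus> c = a"
    using linear[OF assms] by blast
  then show thesis
  proof cases
    case (1 c)
    then show ?thesis using zero_or_succ[of c] that(1,2) assms by (auto simp: add_succ)
  next
    case (2 c)
    then show ?thesis using zero_or_succ[of c] that(1,3) assms by (auto simp: add_succ)
  qed
qed

lemma not_less_self: "a \<in> D \<Longrightarrow> c \<in> D \<Longrightarrow> a \<oplus> c \<oplus> \<one> \<noteq> a"
  using add_cancel_left[of "c \<oplus> \<one>" \<zero> a] succ_nonzero[of c] by (simp add: add_assoc)

lemma double_inj: assumes "a \<in> D" "b \<in> D" "a \<oplus> a = b \<oplus> b" shows "a = b"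
proof -
  have *: "a \<oplus> c \<oplus> \<one> \<oplus> (a \<oplus> c \<oplus> \<one>) \<noteq> a \<oplus> a" if "a \<in> D" "c \<in> D" for a c
  proof -
    have "a \<oplus> c \<oplus> \<one> \<oplus> (a \<oplus> c \<oplus> \<one>) = a \<oplus> a \<oplus> (c \<oplus> c \<oplus> \<one>) \<oplus> \<one>"
      using that by (simp add: add_assoc add_comm add_left_comm)
    then show ?thesis using not_less_self[of "a \<oplus> a" "c \<oplus> c \<oplus> \<one>"] that by simp
  qed
  from assms(1,2) show ?thesis
  proof (cases rule: trichotomy)
    case (2 c)
    then show ?thesis using *[of a c] assms by simp
  next
    case (3 c)
    then show ?thesis using *[of b c] assms by simp
  qed simp
qed

lemma least_formula:
  assumes \<phi>: "fm_in LPA \<phi>" and e: "range e \<subseteq> D" and b: "b \<in> D" "sat M (case_nat b e) \<phi>"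
  shows "\<exists>a\<in>D. sat M (case_nat a e) \<phi> \<and> (\<forall>b\<in>D. sat M (case_nat b e) \<phi> \<longrightarrow> (\<exists>c\<in>D. a \<oplus> c = b))"
proof (rule ccontr)
  assume none: "\<not> ?thesis"
  \<comment> \<open>At \<open>a\<close> this says that no \<open>b \<le> a\<close> satisfies
    \<open>\<phi>\<close>. The parameters are shifted past the two quantifiers and \<open>a\<close>
    itself, hence by 3.\<close>
  let ?\<psi> = "Forall (Forall (Imp (Eq (Add (Var 1) (Var 0)) (Var 2))
    (Neg (subst (case_nat (Var 1) (\<lambda>i. Var (i + 3))) \<phi>))))"
  have env: "(\<lambda>i. eval M (case_nat x (case_nat b (case_nat a e))) (case_nat (Var 1) (\<lambda>i. Var (i + 3)) i)) =
      case_nat b e" for a b x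
    by (auto simp: fun_eq_iff eval_nat_numeral split: nat.split)
  have \<psi>: "sat M (case_nat a e) ?\<psi> \<longleftrightarrow> (\<forall>b\<in>D. \<forall>x\<in>D. b \<oplus> x = a \<longrightarrow> \<not> sat M (case_nat b e) \<phi>)" for a
    unfolding sat.simps sat_subst env by (auto simp: numeral_2_eq_2)
  have "sat M (case_nat b e) ?\<psi>"
  proof (rule induct_fm)
    show "fm_in LPA ?\<psi>" using \<phi> by (auto intro!: fm_in_subst split: nat.split)
    show "sat M (case_nat \<zero> e) ?\<psi>"
      unfolding \<psi> using none zero_closed zero_add by (metis add_eq_zero)
  next
    fix a assume a: "a \<in> D" and "sat M (case_nat a e) ?\<psi>"
    then have IH: "\<not> sat M (case_nat b e) \<phi>" if "b \<in> D" "x \<in> D" "b \<oplus> x = a" for b x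
      using that unfolding \<psi> by blast
    have below: "b = a \<oplus> \<one>" if "b \<in> D" "x \<in> D" "b \<oplus> x = a \<oplus> \<one>" "sat M (case_nat b e) \<phi>" for b x
    proof (cases "x = \<zero>")
      case False
      then obtain y where "y \<in> D" "x = y \<oplus> \<one>" using zero_or_succ \<open>x \<in> D\<close> by blast
      moreover from this have "b \<oplus> y = a" using that a by (simp add: add_succ succ_eq)
      ultimately show ?thesis using IH that by blast
    qed (use that in simp)
    have "\<not> sat M (case_nat (a \<oplus> \<one>) e) \<phi>"
    proof
      assume *: "sat M (case_nat (a \<oplus> \<one>) e) \<phi>"
      have "\<exists>c\<in>D. a \<oplus> \<one> \<oplus> c = b" if b: "b \<in> D" "sat M (case_nat b e) \<phi>" for b
      proof -
        have "a \<oplus> \<one> \<in> D" using a by simp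
        from linear[OF this b(1)] show ?thesis
        proof
          assume "\<exists>c\<in>D. b \<oplus> c = a \<oplus> \<one>"
          then have "b = a \<oplus> \<one>" using below b by blast
          then show ?thesis using a by (intro bexI[of _ \<zero>]) simp_all
        qed
      qed
      then show False using none * a by (meson add_closed one_closed)
    qed
    then show "sat M (case_nat (a \<oplus> \<one>) e) ?\<psi>" unfolding \<psi> using below by blast
  qed (use e b in auto)
  then show False unfolding \<psi> using b add_zero zero_closed by blast
qed

section \<open>Twice the Cantor pairing\<close>

definition T :: "'m \<Rightarrow> 'm \<Rightarrow> 'm" where
  "T a b = (a \<oplus> b) \<otimes> (a \<oplus> b \<oplus> \<one>) \<oplus> (a \<oplus> a)"

lemma T_closed [simp]: "a \<in> D \<Longrightarrow> b \<in> D \<Longrightarrow> T a b \<in> D"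
  by (simp add: T_def)

text \<open>Every value on a later diagonal is larger: with \<open>n = a + b\<close>, it is at least
  \<open>(n + 1)(n + 2) = n(n + 1) + 2n + 2\<close>, while \<open>T a b\<close> is at most
  \<open>n(n + 1) + 2n\<close>.\<close>

lemma T_less:
  assumes "a \<in> D" "b \<in> D" "c \<in> D" "d \<in> D" "x \<in> D" "c \<oplus> d = a \<oplus> b \<oplus> x \<oplus> \<one>"
  shows "T c d \<noteq> T a b"
proof -
  define n where "n = a \<oplus> b"
  have n: "n \<in> D" using assms by (simp add: n_def)
  have "T c d = (n \<oplus> x \<oplus> \<one>) \<otimes> (n \<oplus> x \<oplus> \<one> \<oplus> \<one>) \<oplus> (c \<oplus> c)"
    using assms by (simp add: T_def n_def)
  also have "\<dots> = (n \<otimes> (n \<oplus> \<one>) \<oplus> (n \<oplus> n)) \<oplus>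
      (n \<otimes> x \<oplus> x \<otimes> (n \<oplus> x \<oplus> \<one> \<oplus> \<one>) \<oplus> x \<oplus> \<one> \<oplus> (c \<oplus> c)) \<oplus> \<one>"
    using assms n by (simp add: semiring)
  also have "n \<otimes> (n \<oplus> \<one>) \<oplus> (n \<oplus> n) = T a b \<oplus> (b \<oplus> b)"
    using assms by (simp add: T_def n_def semiring)
  finally have "T c d = T a b \<oplus> (b \<oplus> b \<oplus>
      (n \<otimes> x \<oplus> x \<otimes> (n \<oplus> x \<oplus> \<one> \<oplus> \<one>) \<oplus> x \<oplus> \<one> \<oplus> (c \<oplus> c))) \<oplus> \<one>"
    using assms n by (simp add: add_assoc)
  then show ?thesis using not_less_self assms n by simp
qed

lemma T_inj:
  assumes "a \<in> D" "b \<in> D" "c \<in> D" "d \<in> D" "T a b = T c d"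
  shows "a = c \<and> b = d"
proof -
  have "a \<oplus> b \<in> D" "c \<oplus> d \<in> D" using assms by simp_all
  then have "a \<oplus> b = c \<oplus> d"
  proof (cases rule: trichotomy)
    case (2 x)
    then show ?thesis using T_less[OF assms(1-4) 2(1)] assms by simp
  next
    case (3 x)
    then show ?thesis using T_less[OF assms(3,4,1,2) 3(1)] assms by simp
  qed
  then have "a \<oplus> a = c \<oplus> c"
    using assms add_cancel_left[of "a \<oplus> a" "c \<oplus> c" "(a \<oplus> b) \<otimes> (a \<oplus> b \<oplus> \<one>)"] by (simp add: T_def)
  then have "a = c" using double_inj assms by blast
  then show ?thesis using \<open>a \<oplus> b = c \<oplus> d\<close> assms add_cancel_left by blast
qed

subsection \<open>Codes of sequences\<close>

text \<open>The meaning of \<open>seq_fm\<close>. The equation is the double of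
  \<open>z = pair y w + 1\<close>, which spares a division by two.\<close>

primrec seq_code :: "'m list \<Rightarrow> 'm \<Rightarrow> bool" where
  "seq_code [] z \<longleftrightarrow> z = \<zero>"
| "seq_code (y # ys) z \<longleftrightarrow> (\<exists>w\<in>D. z \<oplus> z = T y w \<oplus> (\<one> \<oplus> \<one>) \<and> seq_code ys w)"

lemma sat_seq_fm:
  "range e \<subseteq> D \<Longrightarrow> sat M e (seq_fm i k j) \<longleftrightarrow> seq_code (map (\<lambda>l. e (i + l)) [0..<k]) (e j)"
proof (induction k arbitrary: e i j)
  case (Suc k)
  have e: "e i \<in> D" for i using Suc.prems by auto
  have "map (\<lambda>l. e (i + l)) [0..<Suc k] = e i # map (\<lambda>l. e (Suc i + l)) [0..<k]"
    by (simp add: map_upt_Suc del: upt_Suc)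
  moreover have "sat M (case_nat w e) (seq_fm (Suc (Suc i)) k 0) \<longleftrightarrow>
      seq_code (map (\<lambda>l. e (Suc i + l)) [0..<k]) w" if "w \<in> D" for w
    using Suc.IH[of "case_nat w e" "Suc (Suc i)" 0] Suc.prems that by (simp add: range_case_nat)
  moreover have "T (e i) w \<oplus> (\<one> \<oplus> \<one>) =
      (e i \<oplus> w) \<otimes> (e i \<oplus> w \<oplus> \<one>) \<oplus> (e i \<oplus> e i \<oplus> (\<one> \<oplus> \<one>))" if "w \<in> D" for w
    using that e by (simp add: T_def add_assoc)
  ultimately show ?case by (auto simp: Let_def)
qed simp

lemma seq_code_unique:
  "set xs \<subseteq> D \<Longrightarrow> set ys \<subseteq> D \<Longrightarrow> z \<in> D \<Longrightarrow> seq_code xs z \<Longrightarrow> seq_code ys z \<Longrightarrow> xs = ys"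
proof (induction xs arbitrary: ys z)
  case Nil
  then show ?case
    by (cases ys) (auto simp: add_eq_zero one_nonzero dest!: sym[of \<zero>])
next
  case (Cons x xs)
  then obtain w where w: "w \<in> D" "z \<oplus> z = T x w \<oplus> (\<one> \<oplus> \<one>)" "seq_code xs w" by auto
  show ?case
  proof (cases ys)
    case Nil
    then show ?thesis using Cons.prems w by (simp add: add_eq_zero one_nonzero eq_commute[of \<zero>])
  next
    case (Cons y ys')
    then obtain v where v: "v \<in> D" "z \<oplus> z = T y v \<oplus> (\<one> \<oplus> \<one>)" "seq_code ys' v"
      using Cons.prems by auto
    have "T x w = T y v"
      using w(1,2) v(1,2) Cons.prems add_cancel[of "T x w" "T y v" "\<one> \<oplus> \<one>"] Cons by simp
    then have "x = y \<and> w = v" using T_inj[of x w y v] w(1) v(1) Cons Cons.prems by simp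
    then show ?thesis using Cons.IH[of ys' w] Cons.prems w v Cons by simp
  qed
qed

text \<open>Supplies the halves: \<open>seq_code\<close> fixes only the double of a code, so the
  existence of codes depends on parity.\<close>

lemma even_product: "n \<in> D \<Longrightarrow> \<exists>z\<in>D. z \<oplus> z = n \<otimes> (n \<oplus> \<one>)"
proof (rule induct_formula[where ps = "[]" and b = n and P = "\<lambda>n. \<exists>z\<in>D. z \<oplus> z = n \<otimes> (n \<oplus> \<one>)"
      and \<phi> = "Exists (Eq (Add (Var 0) (Var 0)) (Mul (Var 1) (Add (Var 1) One)))"])
  show "\<exists>z\<in>D. z \<oplus> z = \<zero> \<otimes> (\<zero> \<oplus> \<one>)" by (intro bexI[of _ \<zero>]) simp_all
next
  fix n assume n: "n \<in> D" and "\<exists>z\<in>D. z \<oplus> z = n \<otimes> (n \<oplus> \<one>)"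
  then obtain z where z: "z \<in> D" "z \<oplus> z = n \<otimes> (n \<oplus> \<one>)" by blast
  have "(z \<oplus> (n \<oplus> \<one>)) \<oplus> (z \<oplus> (n \<oplus> \<one>)) = (z \<oplus> z) \<oplus> (n \<oplus> \<one>) \<oplus> (n \<oplus> \<one>)"
    using z(1) n by (simp add: add_assoc add_comm add_left_comm)
  also have "\<dots> = (n \<oplus> \<one>) \<otimes> (n \<oplus> \<one> \<oplus> \<one>)"
    using z n by (simp add: semiring)
  finally show "\<exists>z\<in>D. z \<oplus> z = (n \<oplus> \<one>) \<otimes> (n \<oplus> \<one> \<oplus> \<one>)"
    using z n by (intro bexI[of _ "z \<oplus> (n \<oplus> \<one>)"]) simp_all
qed (auto simp: case_nat_prepend)

lemma seq_code_exists: "set ys \<subseteq> D \<Longrightarrow> \<exists>z\<in>D. seq_code ys z"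
proof (induction ys)
  case (Cons y ys)
  then obtain w where w: "w \<in> D" "seq_code ys w" by auto
  have y: "y \<in> D" using Cons.prems by simp
  obtain z where z: "z \<in> D" "z \<oplus> z = (y \<oplus> w) \<otimes> (y \<oplus> w \<oplus> \<one>)"
    using even_product[of "y \<oplus> w"] w y by auto
  have "(z \<oplus> (y \<oplus> \<one>)) \<oplus> (z \<oplus> (y \<oplus> \<one>)) = (z \<oplus> z) \<oplus> (y \<oplus> y) \<oplus> (\<one> \<oplus> \<one>)"
    using z(1) y by (simp add: add_assoc add_comm add_left_comm)
  then have "(z \<oplus> (y \<oplus> \<one>)) \<oplus> (z \<oplus> (y \<oplus> \<one>)) = T y w \<oplus> (\<one> \<oplus> \<one>)"
    by (simp add: T_def z(2))
  then show ?case using w z(1) y by (intro bexI[of _ "z \<oplus> (y \<oplus> \<one>)"]) auto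
qed simp

subsection \<open>Numerals\<close>

definition num :: "nat \<Rightarrow> 'm" where "num n = eval M (\<lambda>_. \<zero>) (numeral_tm n)"

lemma num_simps [simp]: "num 0 = \<zero>" "num (Suc n) = num n \<oplus> \<one>"
  by (simp_all add: num_def)

lemma num_closed [simp]: "num n \<in> D"
  by (induction n) simp_all

lemma eval_numeral_tm [simp]: "eval M e (numeral_tm n) = num n"
  by (induction n) simp_all

lemma num_inj: "num m = num n \<longleftrightarrow> m = n"
proof
  show "num m = num n \<Longrightarrow> m = n"
  proof (induction m arbitrary: n)
    case 0
    then show ?case using succ_nonzero by (cases n) (auto dest: sym)
  next
    case (Suc m)
    then show ?case using succ_nonzero by (cases n) (auto dest: succ_inj[rotated 2])
  qed
qed simp

lemma below_num: "a \<in> D \<Longrightarrow> c \<in> D \<Longrightarrow> a \<oplus> c \<oplus> \<one> = num n \<Longrightarrow> \<exists>m<n. a = num m"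
proof (induction n arbitrary: c)
  case 0
  then show ?case using succ_nonzero by simp
next
  case (Suc n)
  then have "a \<oplus> c = num n" by (auto dest: succ_inj[rotated 2])
  moreover have "\<exists>m<n. a = num m" if "d \<in> D" "c = d \<oplus> \<one>" for d
    using Suc.IH[OF Suc.prems(1) that(1)] that Suc.prems calculation by (simp add: add_succ)
  ultimately show ?case using zero_or_succ[OF Suc.prems(2)] Suc.prems by (auto intro: less_SucI)
qed

lemma above_num: "a \<in> D \<Longrightarrow> a \<notin> range num \<Longrightarrow> \<exists>c\<in>D. num n \<oplus> c \<oplus> \<one> = a"
proof -
  assume a: "a \<in> D" "a \<notin> range num"
  have "num n \<in> D" by simp
  from a(1) this show ?thesis
  proof (cases rule: trichotomy)
    case (2 c)
    then show ?thesis using below_num[of a c n] a by auto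
  qed (use a in auto)
qed

subsection \<open>Coding of definable bounded sets\<close>

definition dvdM :: "'m \<Rightarrow> 'm \<Rightarrow> bool" where "dvdM a b \<longleftrightarrow> (\<exists>z\<in>D. a \<otimes> z = b)"
definition divs :: "'m \<Rightarrow> 'm \<Rightarrow> bool" where
  "divs d c \<longleftrightarrow> c \<noteq> \<zero> \<and> (\<forall>j\<in>D. \<forall>w\<in>D. d = j \<oplus> \<one> \<oplus> w \<longrightarrow> dvdM (j \<oplus> \<one>) c)"
definition g :: "'m \<Rightarrow> 'm \<Rightarrow> 'm" where "g c v = \<one> \<oplus> (v \<oplus> \<one>) \<otimes> c"
definition bit :: "'m \<Rightarrow> 'm \<Rightarrow> 'm \<Rightarrow> bool" where "bit a c v \<longleftrightarrow> dvdM (g c v) a"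
definition index :: "'m \<Rightarrow> 'm \<Rightarrow> 'm \<Rightarrow> 'm \<Rightarrow> 'm" where "index m x p s = T m (T x (T p s))"

lemma sat_divs_fm [simp]: "sat M e (divs_fm s t) \<longleftrightarrow> divs (eval M e s) (eval M e t)"
  by (auto simp: divs_fm_def divs_def dvdM_def case_nat_prepend)

lemma sat_bit_fm [simp]: "sat M e (bit_fm s t u) \<longleftrightarrow> bit (eval M e s) (eval M e t) (eval M e u)"
  by (auto simp: bit_fm_def bit_def dvdM_def g_def)

lemma eval_index_tm [simp]:
  "eval M e (index_tm s t u v) = index (eval M e s) (eval M e t) (eval M e u) (eval M e v)"
  by (simp add: index_tm_def pair_tm_def index_def T_def)

lemma g_closed [simp]: "c \<in> D \<Longrightarrow> v \<in> D \<Longrightarrow> g c v \<in> D"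
  by (simp add: g_def)

lemma g_nonzero: "c \<in> D \<Longrightarrow> v \<in> D \<Longrightarrow> g c v \<noteq> \<zero>"
  by (simp add: g_def add_eq_zero one_nonzero)

section \<open>Divisibility and coprime moduli\<close>

lemma dvdM_mul1: "a \<in> D \<Longrightarrow> b \<in> D \<Longrightarrow> c \<in> D \<Longrightarrow> dvdM a b \<Longrightarrow> dvdM a (b \<otimes> c)"
  and dvdM_mul2: "a \<in> D \<Longrightarrow> b \<in> D \<Longrightarrow> c \<in> D \<Longrightarrow> dvdM a b \<Longrightarrow> dvdM a (c \<otimes> b)"
proof -
  assume D: "a \<in> D" "b \<in> D" "c \<in> D" and "dvdM a b"
  then obtain z where z: "z \<in> D" "a \<otimes> z = b" by (auto simp: dvdM_def)
  then have "a \<otimes> (z \<otimes> c) = b \<otimes> c" using D by (simp add: mul_assoc[symmetric])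
  then show "dvdM a (b \<otimes> c)" unfolding dvdM_def using z D by (intro bexI[of _ "z \<otimes> c"]) simp_all
  then show "dvdM a (c \<otimes> b)" using D by (simp add: mul_comm)
qed

lemma dvdM_refl: "a \<in> D \<Longrightarrow> dvdM a a"
  unfolding dvdM_def by (intro bexI[of _ \<one>]) simp_all

lemma dvdM_add_cancel:
  assumes D: "a \<in> D" "x \<in> D" "y \<in> D" and "dvdM a x" "dvdM a (x \<oplus> y)"
  shows "dvdM a y"
proof -
  obtain p q where p: "p \<in> D" "a \<otimes> p = x" and q: "q \<in> D" "a \<otimes> q = x \<oplus> y"
    using assms by (auto simp: dvdM_def)
  consider r where "r \<in> D" "p \<oplus> r = q" | r where "r \<in> D" "q \<oplus> r = p"
    using linear[OF p(1) q(1)] by blast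
  then show ?thesis
  proof cases
    case (1 r)
    then have "x \<oplus> a \<otimes> r = x \<oplus> y" using p q D by (auto simp: distrib_left)
    then have "a \<otimes> r = y" using add_cancel_left[of "a \<otimes> r" y x] 1 D by simp
    then show ?thesis using 1 by (auto simp: dvdM_def)
  next
    case (2 r)
    have "a \<otimes> p = a \<otimes> q \<oplus> a \<otimes> r" unfolding 2(2)[symmetric] using 2(1) q(1) D by (simp add: distrib_left)
    then have "x \<oplus> (y \<oplus> a \<otimes> r) = x \<oplus> \<zero>" unfolding p(2) q(2) using 2 D by (simp add: add_assoc)
    then have "y \<oplus> a \<otimes> r = \<zero>" using add_cancel_left[of "y \<oplus> a \<otimes> r" \<zero> x] 2 D by simp
    then have "y = \<zero>" using 2 D by (simp add: add_eq_zero)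
    then show ?thesis using D unfolding dvdM_def by (intro bexI[of _ \<zero>]) simp_all
  qed
qed

lemma divs_mono: "d \<in> D \<Longrightarrow> x \<in> D \<Longrightarrow> divs (d \<oplus> x) c \<Longrightarrow> divs d c"
  unfolding divs_def by (metis add_assoc add_closed one_closed)

lemma divs_exists: "d \<in> D \<Longrightarrow> \<exists>c\<in>D. divs d c"
proof (rule induct_formula[where ps = "[]" and b = d and P = "\<lambda>d. \<exists>c\<in>D. divs d c"
      and \<phi> = "Exists (divs_fm (Var 1) (Var 0))"])
  have "divs \<zero> \<one>" by (auto simp: divs_def one_nonzero succ_nonzero add_eq_zero eq_commute[of \<zero>])
  then show "\<exists>c\<in>D. divs \<zero> c" by auto
next
  fix d assume d: "d \<in> D" and "\<exists>c\<in>D. divs d c"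
  then obtain c where c: "c \<in> D" "divs d c" by blast
  \<comment> \<open>The witness follows the recursion of the factorial: multiplying by
    \<open>d \<oplus> \<one>\<close> adds the one new divisor and keeps the old ones.\<close>
  have "dvdM (j \<oplus> \<one>) (c \<otimes> (d \<oplus> \<one>))" if j: "j \<in> D" "w \<in> D" "d \<oplus> \<one> = j \<oplus> \<one> \<oplus> w" for j w
  proof (cases "w = \<zero>")
    case True
    then show ?thesis using j c d by (auto intro!: dvdM_mul2 dvdM_refl)
  next
    case False
    then obtain v where v: "v \<in> D" "w = v \<oplus> \<one>" using zero_or_succ[OF j(2)] by blast
    then have "d \<oplus> \<one> = j \<oplus> \<one> \<oplus> v \<oplus> \<one>" using j by (simp add: add_succ)
    then have "d = j \<oplus> \<one> \<oplus> v" using succ_inj[of d "j \<oplus> \<one> \<oplus> v"] d v j by simp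
    then have "dvdM (j \<oplus> \<one>) c" using c j v by (auto simp: divs_def)
    then show ?thesis using c d j by (intro dvdM_mul1) simp_all
  qed
  then have "divs (d \<oplus> \<one>) (c \<otimes> (d \<oplus> \<one>))"
    using c d by (auto simp: divs_def mul_eq_zero succ_nonzero)
  then show "\<exists>c\<in>D. divs (d \<oplus> \<one>) c" using c d by (intro bexI[of _ "c \<otimes> (d \<oplus> \<one>)"]) simp_all
qed (auto simp: case_nat_prepend)

lemma divs_le:
  assumes "v \<in> D" "c \<in> D" "divs v c" shows "\<exists>x\<in>D. v \<oplus> x = c"
proof (cases "v = \<zero>")
  case False
  then obtain j where j: "j \<in> D" "v = j \<oplus> \<one>" using zero_or_succ assms by blast
  then have "v = j \<oplus> \<one> \<oplus> \<zero>" by simp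
  then have "dvdM v c" using assms j unfolding divs_def by (metis zero_closed)
  then obtain z where z: "z \<in> D" "v \<otimes> z = c" by (auto simp: dvdM_def)
  have "z \<noteq> \<zero>" using z assms by (auto simp: divs_def)
  then obtain y where y: "y \<in> D" "z = y \<oplus> \<one>" using zero_or_succ z by blast
  then have "v \<oplus> v \<otimes> y = c" using z assms by (simp add: mul_succ add_comm)
  then show ?thesis using y assms by (intro bexI[of _ "v \<otimes> y"]) simp_all
qed (use assms in auto)

text \<open>The modulus is 1 modulo \<open>c\<close>, hence prime to every divisor of
  \<open>c\<close>. Explicitly, a multiple of \<open>\<delta> \<otimes> a\<close> is
  \<open>(u + 1) c a\<close>, and adding \<open>a\<close> to it gives
  \<open>g c u \<otimes> a\<close>.\<close>

lemma coprime_aux: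
  assumes D: "u \<in> D" "c \<in> D" "\<delta> \<in> D" "a \<in> D" and "dvdM \<delta> c" and "dvdM (g c u) (\<delta> \<otimes> a)"
  shows "dvdM (g c u) a"
proof -
  obtain q where q: "q \<in> D" "\<delta> \<otimes> q = c" using assms by (auto simp: dvdM_def)
  have "dvdM (g c u) (q \<otimes> (u \<oplus> \<one>) \<otimes> (\<delta> \<otimes> a))"
    using assms q by (intro dvdM_mul2[of _ "\<delta> \<otimes> a"]) simp_all
  also have "q \<otimes> (u \<oplus> \<one>) \<otimes> (\<delta> \<otimes> a) = (u \<oplus> \<one>) \<otimes> (\<delta> \<otimes> q) \<otimes> a"
    using D q(1) by (simp add: mul_assoc mul_comm mul_left_comm)
  finally have "dvdM (g c u) ((u \<oplus> \<one>) \<otimes> c \<otimes> a)" by (simp add: q(2))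
  moreover have "dvdM (g c u) ((u \<oplus> \<one>) \<otimes> c \<otimes> a \<oplus> a)"
  proof -
    have "(u \<oplus> \<one>) \<otimes> c \<otimes> a \<oplus> a = g c u \<otimes> a"
      using D by (simp add: g_def distrib_right add_comm)
    then show ?thesis using D by (auto simp: dvdM_def)
  qed
  ultimately show ?thesis using dvdM_add_cancel[of "g c u" "(u \<oplus> \<one>) \<otimes> c \<otimes> a" a] D by simp
qed

text \<open>For \<open>u < v\<close> one has \<open>(u + 1) g c v + (v - u) = (v + 1) g c u\<close>.
  So \<open>g c u\<close> divides \<open>(v - u) a\<close>, and \<open>v - u\<close> divides
  \<open>c\<close> because it is at most \<open>v\<close>; the other order is symmetric.\<close>

lemma g_coprime:
  assumes D: "u \<in> D" "v \<in> D" "c \<in> D" "a \<in> D" and "u \<noteq> v" "divs u c" "divs v c"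
    and dvd: "dvdM (g c u) (g c v \<otimes> a)"
  shows "dvdM (g c u) a"
  using D(1,2)
proof (cases rule: trichotomy)
  case (2 x)
  have "v = x \<oplus> \<one> \<oplus> u" using 2 D by (simp add: semiring)
  then have "dvdM (x \<oplus> \<one>) c" using assms 2 by (auto simp: divs_def)
  moreover have "dvdM (g c u) ((x \<oplus> \<one>) \<otimes> a)"
  proof (rule dvdM_add_cancel)
    show "dvdM (g c u) ((u \<oplus> \<one>) \<otimes> (g c v \<otimes> a))" using dvd D by (intro dvdM_mul2[of _ "g c v \<otimes> a"]) simp_all
    have "(u \<oplus> \<one>) \<otimes> (g c v \<otimes> a) \<oplus> (x \<oplus> \<one>) \<otimes> a = g c u \<otimes> ((v \<oplus> \<one>) \<otimes> a)"
      using D 2(1) unfolding 2(2) g_def by (simp add: semiring)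
    then show "dvdM (g c u) ((u \<oplus> \<one>) \<otimes> (g c v \<otimes> a) \<oplus> (x \<oplus> \<one>) \<otimes> a)"
      unfolding dvdM_def using D by (intro bexI[of _ "(v \<oplus> \<one>) \<otimes> a"]) simp_all
  qed (use D 2 in simp_all)
  ultimately show ?thesis using coprime_aux[of u c "x \<oplus> \<one>" a] D 2 by simp
next
  case (3 x)
  have "u = x \<oplus> \<one> \<oplus> v" using 3 D by (simp add: semiring)
  then have "dvdM (x \<oplus> \<one>) c" using assms 3 by (auto simp: divs_def)
  moreover have "dvdM (g c u) ((x \<oplus> \<one>) \<otimes> a)"
  proof (rule dvdM_add_cancel)
    show "dvdM (g c u) (g c u \<otimes> ((v \<oplus> \<one>) \<otimes> a))" using D by (intro dvdM_mul1 dvdM_refl) simp_all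
    have "g c u \<otimes> ((v \<oplus> \<one>) \<otimes> a) \<oplus> (x \<oplus> \<one>) \<otimes> a = (u \<oplus> \<one>) \<otimes> (g c v \<otimes> a)"
      using D 3(1) unfolding 3(2) g_def by (simp add: semiring)
    then show "dvdM (g c u) (g c u \<otimes> ((v \<oplus> \<one>) \<otimes> a) \<oplus> (x \<oplus> \<one>) \<otimes> a)"
      using dvd D by (simp add: dvdM_mul2)
  qed (use D 3 in simp_all)
  ultimately show ?thesis using coprime_aux[of u c "x \<oplus> \<one>" a] D 3 by simp
qed (use assms in simp)

lemma common_multiple:
  "c \<in> D \<Longrightarrow> w \<in> D \<Longrightarrow> \<exists>a\<in>D. a \<noteq> \<zero> \<and> (\<forall>u\<in>D. \<forall>x\<in>D. u \<oplus> x = w \<longrightarrow> bit a c u)"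
proof (rule induct_formula[where ps = "[c]" and b = w
      and P = "\<lambda>w. \<exists>a\<in>D. a \<noteq> \<zero> \<and> (\<forall>u\<in>D. \<forall>x\<in>D. u \<oplus> x = w \<longrightarrow> bit a c u)"
      and \<phi> = "Exists (Conj (Neg (Eq (Var 0) Zero)) (Forall (Forall
        (Imp (Eq (Add (Var 1) (Var 0)) (Var 3)) (bit_fm (Var 2) (Var 4) (Var 1))))))"])
  assume "c \<in> D"
  then have "bit (g c \<zero>) c \<zero>" "g c \<zero> \<noteq> \<zero>" by (simp_all add: bit_def dvdM_refl g_nonzero)
  then show "\<exists>a\<in>D. a \<noteq> \<zero> \<and> (\<forall>u\<in>D. \<forall>x\<in>D. u \<oplus> x = \<zero> \<longrightarrow> bit a c u)"
    using \<open>c \<in> D\<close> by (intro bexI[of _ "g c \<zero>"]) (auto simp: add_eq_zero)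
next
  fix w assume c: "c \<in> D" and w: "w \<in> D"
    and "\<exists>a\<in>D. a \<noteq> \<zero> \<and> (\<forall>u\<in>D. \<forall>x\<in>D. u \<oplus> x = w \<longrightarrow> bit a c u)"
  then obtain a where a: "a \<in> D" "a \<noteq> \<zero>" "\<And>u x. u \<in> D \<Longrightarrow> x \<in> D \<Longrightarrow> u \<oplus> x = w \<Longrightarrow> bit a c u"
    by blast
  have "bit (a \<otimes> g c (w \<oplus> \<one>)) c u" if u: "u \<in> D" "x \<in> D" "u \<oplus> x = w \<oplus> \<one>" for u x
  proof (cases "x = \<zero>")
    case True
    then show ?thesis using u a c w by (simp add: bit_def dvdM_mul2 dvdM_refl)
  next
    case False
    then obtain y where y: "y \<in> D" "x = y \<oplus> \<one>" using zero_or_succ[OF u(2)] by blast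
    then have "u \<oplus> y = w" using succ_inj[of "u \<oplus> y" w] u w by (simp add: add_succ)
    then show ?thesis using a(3)[of u y] a(1) u y c w by (simp add: bit_def dvdM_mul1)
  qed
  then show "\<exists>a\<in>D. a \<noteq> \<zero> \<and> (\<forall>u\<in>D. \<forall>x\<in>D. u \<oplus> x = w \<oplus> \<one> \<longrightarrow> bit a c u)"
    using a c w by (intro bexI[of _ "a \<otimes> g c (w \<oplus> \<one>)"]) (auto simp: mul_eq_zero g_nonzero)
qed (auto simp: case_nat_prepend)

text \<open>The code is the least nonzero common multiple of the wanted moduli. If it were also
  divisible by an unwanted one, dividing this out would leave a smaller common multiple, by
  coprimality.\<close>

lemma comprehension:
  assumes \<chi>: "fm_in LPA \<chi>" and e: "range e \<subseteq> D" and c: "c \<in> D"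
  shows "\<exists>a\<in>D. \<forall>v\<in>D. divs v c \<longrightarrow> (bit a c v \<longleftrightarrow> sat M (case_nat v e) \<chi>)"
proof (cases "c = \<zero>")
  case True
  then show ?thesis by (auto simp: divs_def intro: zero_closed)
next
  case False
  define mult where "mult a \<longleftrightarrow> a \<noteq> \<zero> \<and> (\<forall>v\<in>D. divs v c \<and> sat M (case_nat v e) \<chi> \<longrightarrow> bit a c v)" for a
  let ?\<phi> = "Conj (Neg (Eq (Var 0) Zero)) (Forall (Imp (divs_fm (Var 0) (Var 2))
    (Imp (subst (case_nat (Var 0) (\<lambda>i. Var (i + 3))) \<chi>) (bit_fm (Var 1) (Var 2) (Var 0)))))"
  have env: "(\<lambda>i. eval M (case_nat v (case_nat a (case_nat c e))) (case_nat (Var 0) (\<lambda>i. Var (i + 3)) i)) =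
      case_nat v e" for v a
    by (auto simp: fun_eq_iff eval_nat_numeral split: nat.split)
  have \<phi>: "sat M (case_nat a (case_nat c e)) ?\<phi> \<longleftrightarrow> mult a" if "a \<in> D" for a
    unfolding sat.simps sat_subst env by (auto simp: mult_def numeral_2_eq_2)
  have "fm_in LPA ?\<phi>"
    using \<chi> by (auto intro!: fm_in_subst split: nat.split)
  moreover have "range (case_nat c e) \<subseteq> D" using c e by (simp add: range_case_nat)
  moreover obtain b where "b \<in> D" "mult b"
  proof -
    \<comment> \<open>By \<open>divs_le\<close> every relevant \<open>v\<close> is at most
      \<open>c\<close>, so a common multiple of all moduli up to \<open>c\<close> is enough.\<close>
    obtain b where b: "b \<in> D" "b \<noteq> \<zero>" "\<forall>u\<in>D. \<forall>x\<in>D. u \<oplus> x = c \<longrightarrow> bit b c u"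
      using common_multiple[OF c c] by blast
    have "mult b" unfolding mult_def using b divs_le c by blast
    with b(1) that show ?thesis by blast
  qed
  ultimately obtain a where a: "a \<in> D" "mult a" "\<And>b. b \<in> D \<Longrightarrow> mult b \<Longrightarrow> \<exists>x\<in>D. a \<oplus> x = b"
    using least_formula[of ?\<phi> "case_nat c e" b] \<phi> by blast
  have "sat M (case_nat v e) \<chi>" if v: "v \<in> D" "divs v c" "bit a c v" for v
  proof (rule ccontr)
    assume not: "\<not> sat M (case_nat v e) \<chi>"
    obtain a' where a': "a' \<in> D" "g c v \<otimes> a' = a" using v(3) by (auto simp: bit_def dvdM_def)
    have "a' \<noteq> \<zero>" using a' a v c by (auto simp: mult_def)
    moreover have "bit a' c u" if u: "u \<in> D" "divs u c" "sat M (case_nat u e) \<chi>" for u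
    proof -
      have "bit a c u" using a(2) u by (simp add: mult_def)
      then show ?thesis
        using g_coprime[of u v c a'] u v c a' not unfolding bit_def by blast
    qed
    ultimately have "mult a'" by (simp add: mult_def)
    then obtain x where x: "x \<in> D" "a \<oplus> x = a'" using a(3) a' by blast
    \<comment> \<open>Minimality gives \<open>a \<le> a'\<close>, whereas
      \<open>a = g c v \<otimes> a'\<close> exceeds \<open>a'\<close> by
      \<open>(v + 1) c a'\<close>; cancelling forces this surplus to be zero.\<close>
    have "a' \<oplus> ((v \<oplus> \<one>) \<otimes> c \<otimes> a' \<oplus> x) = g c v \<otimes> a' \<oplus> x"
      using v c a'(1) x(1) by (simp add: g_def distrib_right add_assoc)
    also have "\<dots> = a' \<oplus> \<zero>" using a' x by simp
    finally have "(v \<oplus> \<one>) \<otimes> c \<otimes> a' \<oplus> x = \<zero>"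
      using add_cancel_left[of "(v \<oplus> \<one>) \<otimes> c \<otimes> a' \<oplus> x" \<zero> a'] v c a' x by simp
    then show False
      using v c a' x \<open>a' \<noteq> \<zero>\<close> False by (simp add: add_eq_zero mul_eq_zero one_nonzero)
  qed
  then show ?thesis using a by (auto simp: mult_def)
qed

subsection \<open>Finite satisfiability\<close>

lemma sat_body:
  assumes e: "range e \<subseteq> D" and D: "y \<in> D" "p \<in> D" "s \<in> D"
  shows "sat M (prepend [y, p, s] e) (body p0 k C) \<longleftrightarrow>
    (p = num p0 \<longrightarrow> (\<forall>ys. length ys = k \<and> set ys \<subseteq> D \<and> seq_code ys s \<longrightarrow>
      (\<exists>x\<in>D. sat M (prepend (x # ys) (prepend [y, p, s] e)) C) \<longrightarrow>
      sat M (prepend (y # ys) (prepend [y, p, s] e)) C))"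
proof -
  let ?E = "prepend [y, p, s] e"
  have E: "range ?E \<subseteq> D" using e D by (intro range_prepend) auto
  have 1: "sat M (prepend ys ?E) (Exists (Conj (Eq (Var 0) (Var (k + 3))) (seq_fm 1 k 0))) \<longleftrightarrow> seq_code ys s"
    if ys: "length ys = k" "set ys \<subseteq> D" for ys
  proof -
    have "prepend (z # ys) ?E (k + 3) = s" for z
      using ys by (simp add: prepend_def)
    moreover have "map (\<lambda>l. prepend (s # ys) ?E (1 + l)) [0..<k] = ys"
      using ys by (intro nth_equalityI) (auto simp: prepend_def)
    moreover have "range (prepend (s # ys) ?E) \<subseteq> D"
      by (rule range_prepend[OF _ E]) (use ys D in auto)
    ultimately show ?thesis using D by (auto simp: case_nat_prepend sat_seq_fm)
  qed
  have 2: "sat M (prepend ys ?E) (Forall (Imp (Eq (Var 0) (Var (k + 1))) C)) \<longleftrightarrow>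
      sat M (prepend (y # ys) ?E) C" if ys: "length ys = k" for ys
  proof -
    have "prepend (x # ys) ?E (k + 1) = y" for x using ys by (simp add: prepend_def)
    then show ?thesis using D by (auto simp: case_nat_prepend)
  qed
  have "sat M ?E (body p0 k C) \<longleftrightarrow> (p = num p0 \<longrightarrow> (\<forall>ys. length ys = k \<and> set ys \<subseteq> D \<longrightarrow>
      sat M (prepend ys ?E) (Imp (Exists (Conj (Eq (Var 0) (Var (k + 3))) (seq_fm 1 k 0)))
       (Imp (Exists C) (Forall (Imp (Eq (Var 0) (Var (k + 1))) C))))))"
    by (simp add: body_def sat_Forall_pow)
  also have "\<dots> \<longleftrightarrow> (p = num p0 \<longrightarrow> (\<forall>ys. length ys = k \<and> set ys \<subseteq> D \<and> seq_code ys s \<longrightarrow>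
      (\<exists>x\<in>D. sat M (prepend (x # ys) ?E) C) \<longrightarrow> sat M (prepend (y # ys) ?E) C))"
    using 1 2 by (simp only: sat.simps(5)) (auto simp: case_nat_prepend)
  finally show ?thesis .
qed

section \<open>Instances of OP in the model\<close>

definition holds :: "nat \<Rightarrow> 'm \<Rightarrow> 'm \<Rightarrow> 'm \<Rightarrow> bool" where
  "holds m y p s \<longleftrightarrow> sat M (prepend [y, p, s] (\<lambda>_. \<zero>)) (psi m)"

lemma sat_psi: "sat M (prepend (y # p # s # as) e) (psi m) \<longleftrightarrow> holds m y p s"
  unfolding holds_def
proof (rule sat_cong)
  fix i assume "i \<in> fv (psi m :: ('f, 'r) fm)"
  then have "i \<le> 2" using fv_psi by blast
  then show "prepend (y # p # s # as) e i = prepend [y, p, s] (\<lambda>_. \<zero>) i"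
    by (auto simp: prepend_def nth_Cons' le_Suc_eq eval_nat_numeral)
qed

text \<open>The \<open>m\<close>-th derivation yields an instance of OP about just this
  \<open>p\<close> and \<open>s\<close>. Outside 1 to \<open>n\<close> nothing is said about
  \<open>\<phi>\<close>, since the derivation does not determine it there.\<close>

definition applies :: "'m \<Rightarrow> 'm \<Rightarrow> nat \<Rightarrow> prim_rec \<Rightarrow> nat \<Rightarrow> (nat \<Rightarrow> ('f, 'r) fm) \<Rightarrow> 'm list \<Rightarrow> bool" where
  "applies p s m f n \<phi> ys \<longleftrightarrow>
     derivation m = pair 5 (pair (pr_code f) (pair (length ys) (pair n (fm_code (conjseq \<phi> n))))) \<and>
     (\<forall>i\<in>{1..n}. fm_in LPA (\<phi> i) \<and> fv (\<phi> i) \<subseteq> {..length ys} \<and> pr_eval f [i] = fm_code (\<phi> i)) \<and>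
     p = num (pr_code f) \<and> set ys \<subseteq> D \<and> seq_code ys s"

definition solves :: "'m \<Rightarrow> nat \<Rightarrow> (nat \<Rightarrow> ('f, 'r) fm) \<Rightarrow> 'm list \<Rightarrow> bool" where
  "solves x n \<phi> ys \<longleftrightarrow> (\<forall>i\<in>{1..n}. sat M (prepend (x # ys) (\<lambda>_. \<zero>)) (\<phi> i))"

lemma solves_env:
  assumes "\<forall>i\<in>{1..n}. fv (\<phi> i) \<subseteq> {..length ys}"
  shows "sat M (prepend (x # ys) e) (conjseq \<phi> n) \<longleftrightarrow> solves x n \<phi> ys"
proof -
  have "sat M (prepend (x # ys) e) (\<phi> i) \<longleftrightarrow> sat M (prepend (x # ys) (\<lambda>_. \<zero>)) (\<phi> i)" if "i \<in> {1..n}" for i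
  proof (rule sat_cong)
    fix j assume "j \<in> fv (\<phi> i)"
    then have "j < length (x # ys)" using assms that by fastforce
    then show "prepend (x # ys) e j = prepend (x # ys) (\<lambda>_. \<zero>) j" by (simp only: prepend_nth)
  qed
  then show ?thesis by (simp add: sat_conjseq solves_def)
qed

text \<open>The derivation determines program, lengths and the codes of the first \<open>n\<close>
  formulas. All choices of \<open>\<phi>\<close> therefore have the same solutions, and quantifying
  over them changes nothing.\<close>

lemma holds_iff:
  assumes "y \<in> D" "p \<in> D" "s \<in> D"
  shows "holds m y p s \<longleftrightarrow>
    (\<forall>f n \<phi> ys. applies p s m f n \<phi> ys \<and> (\<exists>x\<in>D. solves x n \<phi> ys) \<longrightarrow> solves y n \<phi> ys)"
proof (cases m rule: psi_cases[where ?'f = 'f and ?'r = 'r])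
  case trivial
  then show ?thesis by (auto simp: holds_def applies_def)
next
  case (body f k n \<phi>)
  have fv: "\<forall>i\<in>{1..n}. fv (\<phi> i) \<subseteq> {..length ys}" if "length ys = k" for ys :: "'m list"
    using body(4) that by auto
  have in_LPA: "fm_in LPA (conjseq \<phi> n)" using body(3) by (rule conjseq_in)
  have applies: "applies p s m f' n' \<phi>' ys \<Longrightarrow>
      f' = f \<and> n' = n \<and> length ys = k \<and> p = num (pr_code f) \<and> set ys \<subseteq> D \<and> seq_code ys s \<and>
      (\<forall>x. solves x n' \<phi>' ys \<longleftrightarrow> solves x n \<phi> ys)" for f' n' \<phi>' ys
  proof -
    assume a: "applies p s m f' n' \<phi>' ys"
    then have eq: "f' = f" "n' = n" "length ys = k" "fm_code (conjseq \<phi>' n) = fm_code (conjseq \<phi> n)"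
      by (auto simp: applies_def body(2) dest: pr_code_inj)
    have "\<phi>' i = \<phi> i" if "i \<in> {1..n}" for i
    proof (rule fm_code_inj)
      show "fm_in LPA (\<phi>' i)" "fm_in LPA (\<phi> i)" "fm_code (\<phi>' i) = fm_code (\<phi> i)"
        using a that body(3,5)[of i] eq by (auto simp: applies_def)
    qed
    then show ?thesis using a eq by (auto simp: applies_def solves_def)
  qed
  have applies': "applies p s m f n \<phi> ys" if "p = num (pr_code f)" "length ys = k" "set ys \<subseteq> D" "seq_code ys s" for ys
    using that body(2-5) by (auto simp: applies_def)
  have "holds m y p s \<longleftrightarrow> sat M (prepend [y, p, s] (\<lambda>_. \<zero>)) (body (pr_code f) k (conjseq \<phi> n))"
    by (simp add: holds_def body(1))
  also have "\<dots> \<longleftrightarrow> (p = num (pr_code f) \<longrightarrow> (\<forall>ys. length ys = k \<and> set ys \<subseteq> D \<and> seq_code ys s \<longrightarrow>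
      (\<exists>x\<in>D. solves x n \<phi> ys) \<longrightarrow> solves y n \<phi> ys))"
    unfolding sat_body[OF zero_env assms] using solves_env[OF fv] by simp
  also have "\<dots> \<longleftrightarrow> (\<forall>f n \<phi> ys. applies p s m f n \<phi> ys \<and> (\<exists>x\<in>D. solves x n \<phi> ys) \<longrightarrow> solves y n \<phi> ys)"
    using applies applies' by metis
  finally show ?thesis .
qed

text \<open>\<open>p\<close> determines the program and \<open>s\<close> the sequence, so instances
  for the same \<open>p\<close> and \<open>s\<close> differ only in the length of the
  conjunction.\<close>

lemma applies_unique:
  assumes "applies p s m f n \<phi> ys" "applies p s m' f' n' \<phi>' ys'" "s \<in> D" "n \<le> n'" "solves x n' \<phi>' ys'"
  shows "solves x n \<phi> ys"
proof -
  have "f = f'" using assms(1,2) by (auto simp: applies_def num_inj dest: pr_code_inj)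
  moreover have "ys = ys'" using assms(1-3) seq_code_unique by (auto simp: applies_def)
  moreover have "\<phi> i = \<phi>' i" if "i \<in> {1..n}" for i
    by (rule fm_code_inj) (use assms(1,2,4) that \<open>f = f'\<close> in \<open>auto simp: applies_def\<close>)
  ultimately show ?thesis using assms(4,5) by (auto simp: solves_def)
qed

text \<open>A solution of the longest solvable instance solves all shorter ones, and longer
  instances hold vacuously for lack of a solution. If no instance is solvable, any element will
  do.\<close>

lemma psi_satisfiable:
  assumes "finite A" "p \<in> D" "s \<in> D"
  shows "\<exists>y\<in>D. \<forall>m\<in>A. holds m y p s"
proof -
  define S where "S = {n. \<exists>m\<in>A. \<exists>f \<phi> ys. applies p s m f n \<phi> ys \<and> (\<exists>x\<in>D. solves x n \<phi> ys)}"
  have "S \<subseteq> (\<lambda>m. pi1 (pi2 (pi2 (pi2 (derivation m))))) ` A"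
    by (auto simp: S_def applies_def intro!: rev_image_eqI)
  then have "finite S" using assms(1) finite_surj by blast
  show ?thesis
  proof (cases "S = {}")
    case True
    then have "\<forall>m\<in>A. holds m \<zero> p s" using assms by (auto simp: S_def holds_iff)
    then show ?thesis using zero_closed by blast
  next
    case False
    then have "Max S \<in> S" using \<open>finite S\<close> by (rule Max_in[rotated])
    then obtain m f \<phi> ys x where x: "applies p s m f (Max S) \<phi> ys" "x \<in> D" "solves x (Max S) \<phi> ys"
      by (auto simp: S_def)
    have "holds m' x p s" if "m' \<in> A" for m'
      unfolding holds_iff[OF x(2) assms(2,3)]
    proof (intro allI impI)
      fix f' n' \<phi>' ys'
      assume a: "applies p s m' f' n' \<phi>' ys' \<and> (\<exists>x\<in>D. solves x n' \<phi>' ys')"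
      then have "n' \<in> S" unfolding S_def using that by blast
      then have "n' \<le> Max S" using \<open>finite S\<close> by simp
      then show "solves x n' \<phi>' ys'" using applies_unique a x assms by blast
    qed
    then show ?thesis using x(2) by blast
  qed
qed

lemma sat_Q:
  "sat M (prepend (a # c # as) e) (Q m) \<longleftrightarrow> (\<forall>s\<in>D. \<forall>p\<in>D. \<forall>y\<in>D.
     divs (index (num m) y p s) c \<longrightarrow> (bit a c (index (num m) y p s) \<longleftrightarrow> holds m y p s))"
  unfolding Q_def Let_def sat.simps case_nat_prepend sat_psi sat_divs_fm sat_bit_fm eval_index_tm eval_numeral_tm
  by simp blast

lemma index_inj:
  assumes "m \<in> D" "x \<in> D" "p \<in> D" "s \<in> D" "m' \<in> D" "x' \<in> D" "p' \<in> D" "s' \<in> D"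
    and "index m x p s = index m' x' p' s'"
  shows "m = m' \<and> x = x' \<and> p = p' \<and> s = s'"
proof -
  have 1: "m = m' \<and> T x (T p s) = T x' (T p' s')" using assms by (intro T_inj) (simp_all add: index_def)
  then have 2: "x = x' \<and> T p s = T p' s'" using assms by (intro T_inj) simp_all
  then have "p = p' \<and> s = s'" using assms by (intro T_inj) simp_all
  with 1 2 show ?thesis by blast
qed

lemma index_closed [simp]: "m \<in> D \<Longrightarrow> x \<in> D \<Longrightarrow> p \<in> D \<Longrightarrow> s \<in> D \<Longrightarrow> index m x p s \<in> D"
  by (simp add: index_def)

text \<open>Finitely many formulas \<open>psi m\<close> combine into one arithmetical formula about
  the index, to which comprehension applies; injectivity of \<open>index\<close> keeps the answers
  for different arguments apart.\<close>

lemma Q_satisfiable: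
  assumes "finite A" "c \<in> D"
  shows "\<exists>a\<in>D. \<forall>m\<in>A. sat M (prepend [a, c] e) (Q m)"
proof -
  obtain ms where ms: "set ms = A" using assms(1) finite_list by blast
  let ?\<chi> = "Neg (Conjs (map (\<lambda>m. Neg (Exists (Exists (Exists
    (Conj (Eq (Var 3) (index_tm (numeral_tm m) (Var 0) (Var 1) (Var 2))) (psi m)))))) ms)) :: ('f, 'r) fm"
  have \<chi>: "sat M (prepend [v] (\<lambda>_. \<zero>)) ?\<chi> \<longleftrightarrow>
      (\<exists>m\<in>A. \<exists>s\<in>D. \<exists>p\<in>D. \<exists>y\<in>D. v = index (num m) y p s \<and> holds m y p s)" for v
    unfolding sat_Conjs set_map ms sat.simps case_nat_prepend
    by (auto simp: case_nat_prepend sat_psi)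
  have "fm_in LPA ?\<chi>" by (auto simp: fm_in_psi)
  from comprehension[OF this zero_env assms(2)] obtain a where a: "a \<in> D"
    "\<And>v. v \<in> D \<Longrightarrow> divs v c \<Longrightarrow> bit a c v \<longleftrightarrow> sat M (prepend [v] (\<lambda>_. \<zero>)) ?\<chi>"
    by (auto simp: case_nat_prepend[of _ "[]", simplified])
  have "sat M (prepend [a, c] e) (Q m)" if "m \<in> A" for m
    unfolding sat_Q
  proof (intro ballI impI)
    fix s p y assume D: "s \<in> D" "p \<in> D" "y \<in> D" "divs (index (num m) y p s) c"
    have "bit a c (index (num m) y p s) \<longleftrightarrow> (\<exists>m'\<in>A. \<exists>s'\<in>D. \<exists>p'\<in>D. \<exists>y'\<in>D.
        index (num m) y p s = index (num m') y' p' s' \<and> holds m' y' p' s')"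
      using a(2)[of "index (num m) y p s"] D unfolding \<chi> by simp
    also have "\<dots> \<longleftrightarrow> holds m y p s"
    proof
      assume "\<exists>m'\<in>A. \<exists>s'\<in>D. \<exists>p'\<in>D. \<exists>y'\<in>D.
        index (num m) y p s = index (num m') y' p' s' \<and> holds m' y' p' s'"
      then obtain m' s' p' y' where *: "s' \<in> D" "p' \<in> D" "y' \<in> D" "holds m' y' p' s'"
        "index (num m) y p s = index (num m') y' p' s'" by blast
      from index_inj[OF _ _ _ _ _ _ _ _ *(5)] D * show "holds m y p s"
        by (auto simp: num_inj)
    qed (use D that in blast)
    finally show "bit a c (index (num m) y p s) \<longleftrightarrow> holds m y p s" .
  qed
  then show ?thesis using a(1) by blast
qed

end

section \<open>Recursive saturation and RSAT\<close>

lemma recursively_saturatedD: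
  assumes "recursively_saturated M" "range a \<subseteq> Dom M" "\<And>\<phi>. \<phi> \<in> \<Gamma> \<Longrightarrow> fm_in LPA \<phi> \<and> fv \<phi> \<subseteq> {..k}"
    "recursive_set (fm_code ` \<Gamma>)"
    "\<And>\<Delta>. finite \<Delta> \<Longrightarrow> \<Delta> \<subseteq> \<Gamma> \<Longrightarrow> \<exists>b\<in>Dom M. \<forall>\<phi>\<in>\<Delta>. sat M (case_nat b a) \<phi>"
  shows "\<exists>b\<in>Dom M. \<forall>\<phi>\<in>\<Gamma>. sat M (case_nat b a) \<phi>"
  using assms(1)[unfolded recursively_saturated_def, rule_format, of a \<Gamma> k] assms(2-) by simp

lemma conv_seq_fm [simp]: "conv (seq_fm i k j) = seq_fm i k j"
  by (induction k arbitrary: i j) (simp_all add: Let_def)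

lemma PA_in_LPA: "\<Phi> \<in> PA \<Longrightarrow> fm_in LPA \<Phi>"
proof -
  have "fm_in LPA (induction_axiom \<phi>)" if "fm_in LPA \<phi>" for \<phi> :: "('f, 'r) fm"
    using that unfolding induction_axiom_def by (auto intro!: fm_in_subst split: nat.split)
  then show "\<Phi> \<in> PA \<Longrightarrow> fm_in LPA \<Phi>" unfolding PA_def by auto
qed

lemma ternary_Forall_pow [simp]: "ternary ((Forall ^^ k) \<phi>) = ternary \<phi>"
  by (induction k) auto

lemma ternary_Conjs [simp]: "ternary (Conjs \<phi>s) \<longleftrightarrow> (\<forall>\<phi>\<in>set \<phi>s. ternary \<phi>)"
  by (induction \<phi>s) (auto simp: Conjs_def)

lemma ternary_RSAT: "(\<Phi> :: ('f, rsym) fm) \<in> RSAT \<Longrightarrow> ternary \<Phi>"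
proof -
  have R: "ternary (R_fm p k)" for p k
    by (simp add: R_fm_def ternary_LPA[OF fm_in_seq_fm])
  have "ternary (OP k p n \<phi>)" if "codes_formulas k p \<phi>" for k p n and \<phi> :: "nat \<Rightarrow> ('f, rsym) fm"
    using that by (auto simp: OP_def R codes_formulas_def intro: ternary_LPA)
  moreover have "ternary (NE k p :: ('f, rsym) fm)" for k p by (simp add: NE_def R)
  ultimately show "\<Phi> \<in> RSAT \<Longrightarrow> ternary \<Phi>"
    unfolding RSAT_def by (auto intro: ternary_LPA[OF PA_in_LPA])
qed

lemma OP_in_RSAT: "codes_formulas k p \<phi> \<Longrightarrow> OP k p n \<phi> \<in> RSAT"
  unfolding RSAT_def by (rule UnI1, rule UnI2, intro CollectI exI conjI, rule refl)

lemma NE_in_RSAT: "codes_formulas k p (\<phi> :: nat \<Rightarrow> ('f, rsym) fm) \<Longrightarrow> (NE k p :: ('f, rsym) fm) \<in> RSAT"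
  unfolding RSAT_def by (rule UnI2, intro CollectI exI conjI, rule refl)

lemma sat_expandR_RSAT:
  "\<Phi> \<in> RSAT \<Longrightarrow> sat M a (subst_R \<theta> 0 \<Phi>) \<longleftrightarrow> sat (expandR M \<theta> a) a \<Phi>"
  by (rule sat_subst_R) (simp_all add: ternary_RSAT)

lemma models_pa:
  assumes "models L M U" "PA \<subseteq> U" shows "pa M"
  using assms unfolding models_def structure_for_def by unfold_locales auto

section \<open>From RSAT to recursive saturation\<close>

lemma RSAT_imp_recursively_saturated:
  fixes M :: "('f, 'r, 'm) struc"
  assumes "range a \<subseteq> Dom M" "Dom M \<noteq> {}" and RSAT: "\<And>\<Phi>. \<Phi> \<in> RSAT \<Longrightarrow> sat (expandR M \<theta> a) a \<Phi>"
  shows "recursively_saturated (reduct LPA M)"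
  unfolding recursively_saturated_def Dom_reduct
proof (intro allI impI)
  fix k b and \<Gamma> :: "('f, 'r) fm set"
  assume b: "range b \<subseteq> Dom M" and \<Gamma>: "\<forall>\<phi>\<in>\<Gamma>. fm_in LPA \<phi> \<and> fv \<phi> \<subseteq> {..k}"
    and rec: "recursive_set (fm_code ` \<Gamma>)"
    and fin: "\<forall>\<Delta>. finite \<Delta> \<and> \<Delta> \<subseteq> \<Gamma> \<longrightarrow> (\<exists>x\<in>Dom M. \<forall>\<phi>\<in>\<Delta>. sat (reduct LPA M) (case_nat x b) \<phi>)"
  let ?N = "expandR M \<theta> a" and ?ys = "map b [0..<k]"
  show "\<exists>x\<in>Dom M. \<forall>\<phi>\<in>\<Gamma>. sat (reduct LPA M) (case_nat x b) \<phi>"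
  proof (cases "\<Gamma> = {}")
    \<comment> \<open>The empty type has no enumeration, so it is treated apart.\<close>
    case True
    then show ?thesis using assms(2) by auto
  next
    case False
    then have "fm_code ` \<Gamma> \<noteq> {}" by simp
    from recursive_set_enumeration[OF rec this] obtain f where
      f: "\<And>i. pr_eval f [i] \<in> fm_code ` \<Gamma>" "\<And>c. c \<in> fm_code ` \<Gamma> \<Longrightarrow> \<exists>i\<ge>1. pr_eval f [i] = c"
      by blast
    have "\<forall>i. \<exists>\<phi>. \<phi> \<in> \<Gamma> \<and> pr_eval f [i] = fm_code \<phi>" using f(1) by blast
    then obtain \<phi> where \<phi>: "\<And>i. \<phi> i \<in> \<Gamma>" "\<And>i. pr_eval f [i] = fm_code (\<phi> i)" by metis
    let ?\<phi> = "\<lambda>i. conv (\<phi> i) :: ('f, rsym) fm" and ?p = "pr_code f"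
    have codes: "codes_formulas k ?p ?\<phi>"
      using \<phi> \<Gamma> unfolding codes_formulas_def by auto
    have ys: "length ?ys = k" "set ?ys \<subseteq> Dom M" using b by auto
    have sat_\<phi>: "sat ?N (prepend (x # ?ys) a) (?\<phi> i) \<longleftrightarrow> sat (reduct LPA M) (case_nat x b) (\<phi> i)" for x i
    proof -
      have LPA: "fm_in LPA (\<phi> i)" "fv (\<phi> i) \<subseteq> {..k}" using \<phi> \<Gamma> by blast+
      have "sat ?N (prepend (x # ?ys) a) (?\<phi> i) \<longleftrightarrow> sat M (prepend (x # ?ys) a) (\<phi> i)"
        by (rule sat_conv[OF same_arith_expandR(1) LPA(1)])
      also have "\<dots> \<longleftrightarrow> sat M (case_nat x b) (\<phi> i)"
      proof (rule sat_cong)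
        fix l assume "l \<in> fv (\<phi> i)"
        then have "l \<le> k" using LPA(2) by auto
        then show "prepend (x # ?ys) a l = case_nat x b l"
          by (cases l) (auto simp: prepend_def)
      qed
      also have "\<dots> \<longleftrightarrow> sat (reduct LPA M) (case_nat x b) (\<phi> i)"
        by (rule sat_reduct[OF LPA(1), symmetric])
      finally show ?thesis .
    qed
    have "(NE k ?p :: ('f, rsym) fm) \<in> RSAT" by (rule NE_in_RSAT[OF codes])
    from RSAT[OF this] have "sat ?N (prepend ?ys a) (Exists (R_fm ?p k))"
      unfolding NE_def sat_Forall_pow using ys by (simp del: sat.simps)
    then obtain x where x: "x \<in> Dom M" "sat ?N (prepend (x # ?ys) a) (R_fm ?p k)"
      by (auto simp: case_nat_prepend)
    \<comment> \<open>Index 0 may be left out: OP conjoins the formulas from 1 on, and each member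
      of \<open>\<Gamma>\<close> occurs at a positive index.\<close>
    have "sat (reduct LPA M) (case_nat x b) (\<phi> n)" if "n \<ge> 1" for n
    proof -
      have "OP k ?p n ?\<phi> \<in> RSAT" by (rule OP_in_RSAT[OF codes])
      from RSAT[OF this] have "sat ?N (prepend ?ys a)
          (Imp (Exists (Conjs (map ?\<phi> [1..<Suc n]))) (Forall (Imp (R_fm ?p k) (Conjs (map ?\<phi> [1..<Suc n])))))"
        using ys unfolding OP_def sat_Forall_pow by (auto simp del: sat.simps)
      moreover obtain y where "y \<in> Dom M" "\<forall>\<chi>\<in>\<phi> ` {1..n}. sat (reduct LPA M) (case_nat y b) \<chi>"
        using fin \<phi>(1) by (metis finite_atLeastAtMost finite_imageI image_subset_iff)
      then have "y \<in> Dom M" "sat ?N (prepend (y # ?ys) a) (Conjs (map ?\<phi> [1..<Suc n]))"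
        by (auto simp: sat_\<phi>)
      ultimately have "sat ?N (prepend (x # ?ys) a) (Conjs (map ?\<phi> [1..<Suc n]))"
        using x unfolding sat.simps case_nat_prepend expandR_sel by blast
      then have "sat ?N (prepend (x # ?ys) a) (?\<phi> n)" using that by simp
      then show ?thesis by (simp only: sat_\<phi>)
    qed
    moreover have "\<exists>n\<ge>1. \<chi> = \<phi> n" if \<chi>: "\<chi> \<in> \<Gamma>" for \<chi>
    proof -
      obtain n where "n \<ge> 1" "fm_code (\<phi> n) = fm_code \<chi>" using f(2)[of "fm_code \<chi>"] \<phi>(2) \<chi> by auto
      moreover have "fm_in LPA \<chi>" "fm_in LPA (\<phi> n)" using \<Gamma> \<phi>(1) \<chi> by blast+
      ultimately show ?thesis using fm_code_inj by metis
    qed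
    ultimately show ?thesis using x(1) by blast
  qed
qed

section \<open>Definable expansions satisfying RSAT\<close>

context pa
begin

lemma conv_seq_sat: "range e \<subseteq> D \<Longrightarrow>
  sat (expandR M \<theta> a) e (seq_fm i k j) \<longleftrightarrow> seq_code (map (\<lambda>l. e (i + l)) [0..<k]) (e j)"
proof -
  assume e: "range e \<subseteq> D"
  have "sat (expandR M \<theta> a) e (conv (seq_fm i k j :: ('f, 'r) fm)) = sat M e (seq_fm i k j)"
    by (rule sat_conv[OF same_arith_expandR(1) fm_in_seq_fm])
  then show ?thesis by (simp only: conv_seq_fm sat_seq_fm[OF e])
qed

lemma sat_R_fm:
  assumes "range a \<subseteq> D" "x \<in> D" "length ys = k" "set ys \<subseteq> D"
  shows "sat (expandR M \<theta> a) (prepend (x # ys) a) (R_fm p k) \<longleftrightarrow>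
    (\<exists>z\<in>D. seq_code ys z \<and> sat M (prepend [num p, x, z] a) \<theta>)"
proof -
  have "sat (expandR M \<theta> a) (prepend (z # x # ys) a) (seq_fm 2 k 0) \<longleftrightarrow> seq_code ys z" if "z \<in> D" for z
  proof -
    have "range (prepend (z # x # ys) a) \<subseteq> D"
      by (rule range_prepend) (use assms that in auto)
    moreover have "map (\<lambda>l. prepend (z # x # ys) a (2 + l)) [0..<k] = ys"
      using assms by (intro nth_equalityI) (auto simp: prepend_def)
    ultimately show ?thesis by (simp add: conv_seq_sat)
  qed
  then show ?thesis by (auto simp: R_fm_def case_nat_prepend)
qed

text \<open>Each instance of OP is among the conditions \<open>holds m\<close>, its index being
  found by \<open>derive_conjseq\<close>. For NE, codes of sequences have to exist as well, because
  \<open>R_fm\<close> quantifies over them.\<close>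

lemma RSAT_expandR:
  assumes a: "range a \<subseteq> D"
    and NE: "\<And>p s. p \<in> D \<Longrightarrow> s \<in> D \<Longrightarrow> \<exists>x\<in>D. sat M (prepend [p, x, s] a) \<theta>"
    and OP: "\<And>p s x m. p \<in> D \<Longrightarrow> s \<in> D \<Longrightarrow> x \<in> D \<Longrightarrow> sat M (prepend [p, x, s] a) \<theta> \<Longrightarrow> holds m x p s"
    and \<Phi>: "\<Phi> \<in> RSAT"
  shows "sat (expandR M \<theta> a) a \<Phi>"
proof -
  let ?N = "expandR M \<theta> a"
  consider "\<Phi> \<in> PA" | k p n and \<phi> :: "nat \<Rightarrow> ('f, rsym) fm" where "codes_formulas k p \<phi>" "\<Phi> = OP k p n \<phi>"
    | k p where "\<Phi> = NE k p"
    using \<Phi> unfolding RSAT_def by blast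
  then show ?thesis
  proof cases
    case 1
    \<comment> \<open>The induction scheme of RSAT is arithmetical, so the interpretation of
      \<open>R\<close> does not enter.\<close>
    have "sat M a (conv \<Phi>)" by (rule PA[OF conv_PA[OF 1] a])
    then show ?thesis using sat_conv[OF same_arith_expandR(2) PA_in_LPA[OF 1]] by blast
  next
    case (2 k p n \<phi>)
    have \<phi>: "\<And>i. fm_in LPA (\<phi> i)" "\<And>i. fv (\<phi> i) \<subseteq> {..k}" using 2(1) by (auto simp: codes_formulas_def)
    let ?\<phi> = "\<lambda>i. conv (\<phi> i) :: ('f, 'r) fm"
    have codes: "codes_formulas k p ?\<phi>" using 2(1) by (auto simp: codes_formulas_def)
    obtain f where f: "p = pr_code f" "\<And>i. pr_eval f [i] = fm_code (?\<phi> i)"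
      using codes unfolding codes_formulas_def by blast
    obtain m where m: "derivation m = pair 5 (pair p (pair k (pair n (fm_code (conjseq ?\<phi> n)))))"
      using derive_conjseq[OF codes, of n] by auto
    show ?thesis
      unfolding 2(2) OP_def sat_Forall_pow
    proof (intro allI impI)
      fix ys assume "length ys = k \<and> set ys \<subseteq> Dom ?N"
      then have ys: "length ys = k" "set ys \<subseteq> D" by simp_all
      have Conjs: "sat ?N (prepend (x # ys) a) (Conjs (map \<phi> [1..<Suc n])) \<longleftrightarrow> solves x n ?\<phi> ys" for x
      proof -
        have "sat ?N (prepend (x # ys) a) (\<phi> i) \<longleftrightarrow> sat M (prepend (x # ys) a) (?\<phi> i)" for i
          using sat_conv[OF same_arith_expandR(2) \<phi>(1)] by blast
        then have "sat ?N (prepend (x # ys) a) (Conjs (map \<phi> [1..<Suc n])) \<longleftrightarrow>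
            sat M (prepend (x # ys) a) (conjseq ?\<phi> n)"
          by (auto simp: sat_conjseq)
        also have "\<dots> \<longleftrightarrow> solves x n ?\<phi> ys" by (rule solves_env) (use \<phi> ys in simp)
        finally show ?thesis .
      qed
      have "solves x n ?\<phi> ys" if x: "x \<in> D" "sat ?N (prepend (x # ys) a) (R_fm p k)"
        and ex: "\<exists>x\<in>D. solves x n ?\<phi> ys" for x
      proof -
        obtain z where z: "z \<in> D" "seq_code ys z" "sat M (prepend [num p, x, z] a) \<theta>"
          using sat_R_fm[OF a x(1) ys] x(2) by blast
        have "holds m x (num p) z" by (rule OP[OF _ z(1) x(1) z(3)]) simp
        moreover have "applies (num p) z m f n ?\<phi> ys"
          using m f ys z \<phi> by (simp add: applies_def)
        ultimately show ?thesis using holds_iff[of x "num p" z m] x(1) z(1) ex by auto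
      qed
      then show "sat ?N (prepend ys a) (Imp (Exists (Conjs (map \<phi> [1..<Suc n])))
          (Forall (Imp (R_fm p k) (Conjs (map \<phi> [1..<Suc n])))))"
        unfolding sat.simps case_nat_prepend expandR_sel Conjs by blast
    qed
  next
    case (3 k p)
    show ?thesis
      unfolding 3 NE_def sat_Forall_pow
    proof (intro allI impI)
      fix ys assume "length ys = k \<and> set ys \<subseteq> Dom ?N"
      then have ys: "length ys = k" "set ys \<subseteq> D" by simp_all
      obtain z where z: "z \<in> D" "seq_code ys z" using seq_code_exists[OF ys(2)] by blast
      obtain x where x: "x \<in> D" "sat M (prepend [num p, x, z] a) \<theta>" using NE[of "num p" z] z(1) by auto
      then have "sat ?N (prepend (x # ys) a) (R_fm p k)" using z sat_R_fm[OF a _ ys] by blast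
      then show "sat ?N (prepend ys a) (Exists (R_fm p k))"
        using x(1) by (auto simp: case_nat_prepend)
    qed
  qed
qed

section \<open>Largeness by divisibility\<close>

lemma divs_directed:
  assumes "d \<in> D" "d' \<in> D"
  shows "\<exists>d''\<in>D. \<forall>c. divs d'' c \<longrightarrow> divs d c \<and> divs d' c"
proof -
  consider x where "x \<in> D" "d \<oplus> x = d'" | x where "x \<in> D" "d' \<oplus> x = d"
    using linear[OF assms] by blast
  then show ?thesis
  proof cases
    case (1 x)
    then show ?thesis using divs_mono[of d x] assms by (intro bexI[of _ d']) auto
  next
    case (2 x)
    then show ?thesis using divs_mono[of d' x] assms by (intro bexI[of _ d]) auto
  qed
qed

text \<open>The instance of \<open>Pos\<close> for the omitting types argument. Directedness of the
  thresholds makes it partition regular, and a set that is not large is avoided beyond some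
  threshold \<open>d\<close>.\<close>

definition cofinal :: "'m set \<Rightarrow> bool" where
  "cofinal A \<longleftrightarrow> (\<forall>d\<in>D. \<exists>c\<in>A. c \<in> D \<and> divs d c)"

lemma cofinal_Un: "cofinal (A \<union> B) \<Longrightarrow> cofinal A \<or> cofinal B"
proof (rule ccontr)
  assume AB: "cofinal (A \<union> B)" and "\<not> (cofinal A \<or> cofinal B)"
  then obtain d d' where d: "d \<in> D" "d' \<in> D" "\<And>c. c \<in> A \<Longrightarrow> c \<in> D \<Longrightarrow> \<not> divs d c"
    "\<And>c. c \<in> B \<Longrightarrow> c \<in> D \<Longrightarrow> \<not> divs d' c"
    unfolding cofinal_def by blast
  obtain d'' where "d'' \<in> D" "\<And>c. divs d'' c \<Longrightarrow> divs d c \<and> divs d' c"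
    using divs_directed[OF d(1,2)] by blast
  with AB d show False unfolding cofinal_def by blast
qed

text \<open>
  If all models elementarily equivalent to \<open>M\<close> are recursively saturated, the type \<open>Q\<close> is isolated
  in the sense that some \<open>\<chi>\<close> defines, uniformly for arbitrarily divisible \<open>c\<close>, codes of truth values
  which are correct for each \<open>psi m\<close> from some \<open>c\<close> on (depending on \<open>m\<close>).
\<close>

lemma isolating_formula:
  assumes L: "countable_lang L" "structure_for L M"
    and saturated: "\<And>N :: ('f, 'r, 'm) struc. structure_for L N \<Longrightarrow>
      (\<And>\<phi> e. fm_in L \<phi> \<Longrightarrow> (\<And>e. range e \<subseteq> Dom M \<Longrightarrow> sat M e \<phi>) \<Longrightarrow> range e \<subseteq> Dom N \<Longrightarrow> sat N e \<phi>) \<Longrightarrow>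
      recursively_saturated (reduct LPA N)"
  shows "\<exists>\<chi> j. fm_in L \<chi> \<and> cofinal {e 0 | e. range e \<subseteq> D \<and> sat M e \<chi>} \<and>
    (\<forall>m. \<exists>d\<in>D. \<forall>e. range e \<subseteq> D \<and> sat M e \<chi> \<and> divs d (e 0) \<longrightarrow>
       sat M (case_nat (e j) (\<lambda>_. e 0)) (Q m))"
proof (rule ccontr)
  assume none: "\<not> ?thesis"
  interpret omitting L M num cofinal Q
  proof
    show "countable_lang L" "structure_for L M" by (fact L)+
    \<comment> \<open>The numerals provide infinitely many distinct points of \<open>'m\<close> for
      the carrier of the model to be built.\<close>
    show "inj num" by (rule injI) (simp add: num_inj)
    show "cofinal A \<Longrightarrow> A \<subseteq> B \<Longrightarrow> cofinal B" for A B unfolding cofinal_def by blast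
    show "cofinal (A \<union> B) \<Longrightarrow> cofinal A \<or> cofinal B" for A B by (rule cofinal_Un)
    show "cofinal (Dom M)" unfolding cofinal_def using divs_exists by blast
    show "\<not> cofinal {}" unfolding cofinal_def using zero_closed by blast
    show "fm_in L (Q m)" for m by (rule fm_in_mono[OF fm_in_Q])
    \<comment> \<open>If the claim fails for \<open>\<chi>\<close> and \<open>j\<close>, some
      \<open>m\<close> has no threshold, which means that the counterexamples occur for cofinally
      many \<open>c\<close>.\<close>
    show "\<exists>m. cofinal {e 0 | e. range e \<subseteq> Dom M \<and> sat M e \<chi> \<and> \<not> sat M (case_nat (e j) (\<lambda>_. e 0)) (Q m)}"
      if \<chi>: "fm_in L \<chi>" "cofinal {e 0 | e. range e \<subseteq> Dom M \<and> sat M e \<chi>}" for \<chi> j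
    proof -
      have "\<not> (\<forall>m. \<exists>d\<in>D. \<forall>e. range e \<subseteq> D \<and> sat M e \<chi> \<and> divs d (e 0) \<longrightarrow>
          sat M (case_nat (e j) (\<lambda>_. e 0)) (Q m))"
      proof
        assume *: "\<forall>m. \<exists>d\<in>D. \<forall>e. range e \<subseteq> D \<and> sat M e \<chi> \<and> divs d (e 0) \<longrightarrow>
          sat M (case_nat (e j) (\<lambda>_. e 0)) (Q m)"
        from none show False
          by (rule notE) (intro exI[of _ \<chi>] exI[of _ j] conjI \<chi> *)
      qed
      then obtain m where m: "\<not> (\<exists>d\<in>D. \<forall>e. range e \<subseteq> D \<and> sat M e \<chi> \<and> divs d (e 0) \<longrightarrow>
          sat M (case_nat (e j) (\<lambda>_. e 0)) (Q m))"
        by blast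
      have "\<exists>c\<in>{e 0 | e. range e \<subseteq> D \<and> sat M e \<chi> \<and> \<not> sat M (case_nat (e j) (\<lambda>_. e 0)) (Q m)}.
          c \<in> D \<and> divs d c" if d: "d \<in> D" for d
      proof -
        obtain e where "range e \<subseteq> D" "sat M e \<chi>" "divs d (e 0)" "\<not> sat M (case_nat (e j) (\<lambda>_. e 0)) (Q m)"
          using m d by blast
        then show ?thesis by (intro bexI[of _ "e 0"]) (blast, blast)
      qed
      then show ?thesis unfolding cofinal_def by blast
    qed
  qed
  from omitting_model obtain N :: "('f, 'r, 'm) struc" and c where
    c_in: "c \<in> Dom N" and N: "structure_for L N \<and>
      (\<forall>\<phi>. fm_in L \<phi> \<and> (\<forall>e. range e \<subseteq> Dom M \<longrightarrow> sat M e \<phi>) \<longrightarrow> (\<forall>e. range e \<subseteq> Dom N \<longrightarrow> sat N e \<phi>)) \<and>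
      (\<forall>b\<in>Dom N. \<exists>m. \<not> sat N (case_nat b (\<lambda>_. c)) (Q m))"
    by (elim exE bexE)
  have equiv: "\<And>\<phi> e. fm_in L \<phi> \<Longrightarrow> (\<And>e. range e \<subseteq> Dom M \<Longrightarrow> sat M e \<phi>) \<Longrightarrow> range e \<subseteq> Dom N \<Longrightarrow> sat N e \<phi>"
    using N[THEN conjunct2, THEN conjunct1] by blast
  have omits: "\<And>b. b \<in> Dom N \<Longrightarrow> \<exists>m. \<not> sat N (case_nat b (\<lambda>_. c)) (Q m)"
    using N[THEN conjunct2, THEN conjunct2] by blast
  have c: "range (\<lambda>_. c) \<subseteq> Dom N" using c_in by auto
  have "recursively_saturated (reduct LPA N)" by (rule saturated[OF N[THEN conjunct1] equiv])
  moreover have "\<exists>b\<in>Dom N. \<forall>\<phi>\<in>\<Delta>. sat (reduct LPA N) (case_nat b (\<lambda>_. c)) \<phi>"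
    if \<Delta>: "finite \<Delta>" "\<Delta> \<subseteq> range Q" for \<Delta>
  proof -
    obtain A where A: "finite A" "\<Delta> = Q ` A" using finite_subset_image[OF \<Delta>] by blast
    obtain ms where ms: "set ms = A" using finite_list[OF A(1)] by blast
    \<comment> \<open>Finite satisfiability transfers without any knowledge about \<open>c\<close>,
      because in \<open>M\<close> the formula holds for every value of the parameter.\<close>
    have "sat N (\<lambda>_. c) (Exists (Conjs (map Q ms)))"
    proof (rule equiv[OF _ _ c])
      show "fm_in L (Exists (Conjs (map Q ms)))" by (auto simp: fm_in_mono[OF fm_in_Q])
      fix e :: "nat \<Rightarrow> 'm" assume e: "range e \<subseteq> Dom M"
      have "case_nat a e = prepend [a, e 0] (\<lambda>i. e (Suc i))" for a
        by (rule ext) (auto simp: prepend_def nth_Cons' split: nat.split)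
      moreover obtain a where "a \<in> D" "\<forall>m\<in>A. sat M (prepend [a, e 0] (\<lambda>i. e (Suc i))) (Q m)"
        using Q_satisfiable[OF A(1), of "e 0"] e by blast
      ultimately show "sat M e (Exists (Conjs (map Q ms)))" using ms by auto
    qed
    then obtain b where "b \<in> Dom N" "\<forall>m\<in>A. sat N (case_nat b (\<lambda>_. c)) (Q m)" using ms by auto
    then show ?thesis unfolding A(2) by (auto simp: sat_reduct[OF fm_in_Q])
  qed
  moreover have "fm_in LPA \<phi> \<and> fv \<phi> \<subseteq> {..1}" if "\<phi> \<in> range Q" for \<phi> :: "('f, 'r) fm"
    using that fm_in_Q fv_Q by auto
  ultimately have "\<exists>b\<in>Dom (reduct LPA N). \<forall>\<phi>\<in>range Q. sat (reduct LPA N) (case_nat b (\<lambda>_. c)) \<phi>"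
    by (intro recursively_saturatedD[OF _ _ _ recursive_Q, of _ _ 1]) (simp_all add: c_in image_subset_iff)
  then obtain b where "b \<in> Dom N" "\<forall>\<phi>\<in>range Q. sat (reduct LPA N) (case_nat b (\<lambda>_. c)) \<phi>" by auto
  then show False using omits[of b] by (auto simp: sat_reduct[OF fm_in_Q])
qed

end

text \<open>Truth of the formulas \<open>psi m\<close> in \<open>M\<close> is definable from \<open>\<chi>\<close> as truth in the limit.\<close>

locale isolated = pa M for M :: "('f, 'r, 'm) struc" +
  fixes L :: "('f, 'r) lang" and \<chi> :: "('f, 'r) fm" and j :: nat
  assumes \<chi>: "fm_in L \<chi>" and cofinal: "cofinal {e 0 | e. range e \<subseteq> D \<and> sat M e \<chi>}"
    and correct: "\<exists>d\<in>D. \<forall>e. range e \<subseteq> D \<and> sat M e \<chi> \<and> divs d (e 0) \<longrightarrow>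
       sat M (case_nat (e j) (\<lambda>_. e 0)) (Q m)"
begin

definition S :: "'m \<Rightarrow> 'm \<Rightarrow> 'm \<Rightarrow> 'm \<Rightarrow> bool" where
  "S i y p s \<longleftrightarrow> (\<exists>d\<in>D. \<forall>e. range e \<subseteq> D \<and> sat M e \<chi> \<and> divs d (e 0) \<longrightarrow> bit (e j) (e 0) (index i y p s))"

text \<open>Beyond a common threshold all codes give the correct answer. Cofinality enters in one
  direction: without a code beyond the threshold, \<open>S\<close> would hold vacuously.\<close>

lemma S_num:
  assumes D: "y \<in> D" "p \<in> D" "s \<in> D"
  shows "S (num m) y p s \<longleftrightarrow> holds m y p s"
proof -
  let ?v = "index (num m) y p s"
  obtain d where d: "d \<in> D" "\<And>e. range e \<subseteq> D \<Longrightarrow> sat M e \<chi> \<Longrightarrow> divs d (e 0) \<Longrightarrow>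
      sat M (case_nat (e j) (\<lambda>_. e 0)) (Q m)"
    using correct[of m] by blast
  have v: "?v \<in> D" using D by simp
  obtain d' where d': "d' \<in> D" "\<And>c. divs d' c \<Longrightarrow> divs d c \<and> divs ?v c"
    using divs_directed[OF d(1) v] by blast
  have bit: "bit (e j) (e 0) ?v \<longleftrightarrow> holds m y p s" if "range e \<subseteq> D" "sat M e \<chi>" "divs d' (e 0)" for e
  proof -
    have "case_nat (e j) (\<lambda>_. e 0) = prepend [e j, e 0] (\<lambda>_. e 0)"
      by (rule ext) (auto simp: prepend_def nth_Cons' split: nat.split)
    then have "sat M (prepend [e j, e 0] (\<lambda>_. e 0)) (Q m)" using d(2) d'(2) that by metis
    then show ?thesis using d'(2)[OF that(3)] D unfolding sat_Q by blast
  qed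
  show ?thesis
  proof
    assume "S (num m) y p s"
    then obtain b where b: "b \<in> D" "\<And>e. range e \<subseteq> D \<Longrightarrow> sat M e \<chi> \<Longrightarrow> divs b (e 0) \<Longrightarrow> bit (e j) (e 0) ?v"
      unfolding S_def by blast
    obtain b' where b': "b' \<in> D" "\<And>c. divs b' c \<Longrightarrow> divs b c \<and> divs d' c"
      using divs_directed[OF b(1) d'(1)] by blast
    obtain e where e: "range e \<subseteq> D" "sat M e \<chi>" "divs b' (e 0)"
      using cofinal b'(1) unfolding cofinal_def by blast
    then show "holds m y p s" using bit[of e] b(2)[of e] b'(2) by blast
  next
    assume "holds m y p s"
    then show "S (num m) y p s" unfolding S_def using bit d'(1) by blast
  qed
qed

lemma sat_Exists: "sat N e (Exists \<phi>) \<longleftrightarrow> (\<exists>a\<in>Dom N. sat N (case_nat a e) \<phi>)"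
  by simp

text \<open>\<open>r\<close> bounds the variables of \<open>\<chi>\<close> and the positions 0 and
  \<open>j\<close>, so a block of \<open>r\<close> quantifiers stands for the quantification over
  environments in \<open>S\<close>. Behind the block come the threshold \<open>Var r\<close> and the
  four arguments.\<close>

definition S_fm :: "('f, 'r) fm" where
  "S_fm = (let r = (SOME r. fv \<chi> \<union> {0, j} \<subseteq> {..<r}) in
     Exists ((Forall ^^ r) (Imp (Conj \<chi> (divs_fm (Var r) (Var 0))) (bit_fm (Var j) (Var 0)
       (index_tm (Var (r + 1)) (Var (r + 2)) (Var (r + 3)) (Var (r + 4)))))))"

lemma fm_in_S_fm: "fm_in L S_fm"
  using \<chi> by (simp add: S_fm_def Let_def)

lemma sat_S_fm: "range e \<subseteq> D \<Longrightarrow> sat M e S_fm \<longleftrightarrow> S (e 0) (e 1) (e 2) (e 3)"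
proof -
  assume e: "range e \<subseteq> D"
  define r where "r = (SOME r. fv \<chi> \<union> {0, j} \<subseteq> {..<r})"
  have "\<exists>r. fv \<chi> \<union> {0, j} \<subseteq> {..<r}" by (meson finite_fv finite_Un finite.intros finite_nat_iff_bounded)
  then have r: "fv \<chi> \<union> {0, j} \<subseteq> {..<r}" unfolding r_def by (rule someI_ex)
  have "(\<forall>as. length as = r \<and> set as \<subseteq> D \<longrightarrow> sat M (prepend as (case_nat d e))
      (Imp (Conj \<chi> (divs_fm (Var r) (Var 0))) (bit_fm (Var j) (Var 0)
       (index_tm (Var (r + 1)) (Var (r + 2)) (Var (r + 3)) (Var (r + 4)))))) \<longleftrightarrow>
    (\<forall>e'. range e' \<subseteq> D \<and> sat M e' \<chi> \<and> divs d (e' 0) \<longrightarrow>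
      bit (e' j) (e' 0) (index (e 0) (e 1) (e 2) (e 3)))" (is "?l \<longleftrightarrow> ?r") if d: "d \<in> D" for d
  proof -
    have E: "prepend as (case_nat d e) r = d" "prepend as (case_nat d e) (r + 1) = e 0"
      "prepend as (case_nat d e) (r + 2) = e 1" "prepend as (case_nat d e) (r + 3) = e 2"
      "prepend as (case_nat d e) (r + 4) = e 3" if "length as = r" for as
      using that by (simp_all add: prepend_def eval_nat_numeral)
    have l: "?l \<longleftrightarrow> (\<forall>as. length as = r \<and> set as \<subseteq> D \<longrightarrow>
        sat M (prepend as (case_nat d e)) \<chi> \<and> divs d (prepend as (case_nat d e) 0) \<longrightarrow>
        bit (prepend as (case_nat d e) j) (prepend as (case_nat d e) 0) (index (e 0) (e 1) (e 2) (e 3)))"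
      using E by (simp del: prepend_add)
    show ?thesis
    proof
      assume ?l
      show ?r
      proof (intro allI impI)
        fix e' assume e': "range e' \<subseteq> D \<and> sat M e' \<chi> \<and> divs d (e' 0)"
        let ?as = "map e' [0..<r]"
        have eq: "prepend ?as (case_nat d e) i = e' i" if "i < r" for i using that by (simp add: prepend_def)
        have "sat M (prepend ?as (case_nat d e)) \<chi> \<longleftrightarrow> sat M e' \<chi>"
          by (rule sat_cong) (use eq r in auto)
        moreover have "prepend ?as (case_nat d e) j = e' j" "prepend ?as (case_nat d e) 0 = e' 0"
          using eq r by auto
        moreover have "length ?as = r" "set ?as \<subseteq> D" using e' by auto
        ultimately show "bit (e' j) (e' 0) (index (e 0) (e 1) (e 2) (e 3))"
          using \<open>?l\<close> e' unfolding l by metis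
      qed
    next
      assume ?r
      show ?l
        unfolding l
      proof (intro allI impI)
        fix as assume as: "length as = r \<and> set as \<subseteq> D"
          and sat: "sat M (prepend as (case_nat d e)) \<chi> \<and> divs d (prepend as (case_nat d e) 0)"
        have "range (prepend as (case_nat d e)) \<subseteq> D"
          by (rule range_prepend) (use as d e in \<open>auto simp: range_case_nat\<close>)
        with \<open>?r\<close> sat show "bit (prepend as (case_nat d e) j) (prepend as (case_nat d e) 0)
            (index (e 0) (e 1) (e 2) (e 3))" by blast
      qed
    qed
  qed
  then show ?thesis
    unfolding S_fm_def r_def[symmetric] Let_def S_def sat_Exists sat_Forall_pow by (rule bex_cong[OF refl])
qed

definition S_at :: "nat \<Rightarrow> nat \<Rightarrow> nat \<Rightarrow> nat \<Rightarrow> ('f, 'r) fm" where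
  "S_at i y p s = subst (\<lambda>l. Var ([i, y, p, s] ! (if l < 4 then l else 0))) S_fm"

lemma fm_in_S_at: "fm_in L (S_at i y p s)"
  unfolding S_at_def by (intro fm_in_subst fm_in_S_fm) simp

lemma sat_S_at:
  assumes "range e \<subseteq> D" shows "sat M e (S_at i y p s) \<longleftrightarrow> S (e i) (e y) (e p) (e s)"
proof -
  have "range (\<lambda>l. eval M e (Var ([i, y, p, s] ! (if l < 4 then l else 0)))) \<subseteq> D" using assms by auto
  from sat_S_fm[OF this] show ?thesis by (simp add: S_at_def sat_subst)
qed

section \<open>The standard cut and the definition of \<open>R\<close>\<close>

definition less_fm :: "nat \<Rightarrow> nat \<Rightarrow> ('f, 'r) fm" where
  "less_fm i k = Exists (Eq (Add (Add (Var (Suc i)) (Var 0)) One) (Var (Suc k)))"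

definition below :: "'m \<Rightarrow> 'm \<Rightarrow> bool" where
  "below i k \<longleftrightarrow> (\<exists>c\<in>D. i \<oplus> c \<oplus> \<one> = k)"

lemma sat_less_fm [simp]: "sat M e (less_fm i k) \<longleftrightarrow> below (e i) (e k)"
  by (auto simp: less_fm_def below_def)

lemma fm_in_less_fm [simp]: "fm_in L (less_fm i k)"
  by (simp add: less_fm_def)

definition V :: "'m \<Rightarrow> bool" where
  "V k \<longleftrightarrow> (\<forall>p\<in>D. \<forall>s\<in>D. \<exists>y\<in>D. \<forall>i\<in>D. below i k \<longrightarrow> S i y p s)"

text \<open>From the inside outwards, the variables 0 to 4 are \<open>i\<close>, \<open>y\<close>,
  \<open>s\<close>, \<open>p\<close>, \<open>k\<close>.\<close>

definition V_fm :: "('f, 'r) fm" where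
  "V_fm = Forall (Forall (Exists (Forall (Imp (less_fm 0 4) (S_at 0 1 3 2)))))"

lemma fm_in_V_fm: "fm_in L V_fm"
  by (simp add: V_fm_def fm_in_S_at)

lemma sat_V_fm: "range e \<subseteq> D \<Longrightarrow> sat M e V_fm \<longleftrightarrow> V (e 0)"
  by (simp add: V_fm_def V_def sat_S_at range_case_nat eval_nat_numeral)

lemma V_num: "V (num n)"
  unfolding V_def
proof (intro ballI)
  fix p s assume D: "p \<in> D" "s \<in> D"
  obtain y where y: "y \<in> D" "\<forall>m\<in>{..<n}. holds m y p s"
    using psi_satisfiable[OF _ D, of "{..<n}"] by auto
  have "S i y p s" if i: "i \<in> D" "below i (num n)" for i
  proof -
    obtain m where "m < n" "i = num m" using below_num[OF i(1)] i(2) by (auto simp: below_def)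
    then show ?thesis using y D by (simp add: S_num)
  qed
  with y(1) show "\<exists>y\<in>D. \<forall>i\<in>D. below i (num n) \<longrightarrow> S i y p s" by blast
qed

theorem definable_RSAT:
  assumes "recursively_saturated (reduct LPA M)"
  shows "\<exists>\<theta> a. fm_in L \<theta> \<and> range a \<subseteq> D \<and> (\<forall>\<Phi>\<in>RSAT. sat M a (subst_R \<theta> 0 \<Phi>))"
proof -
  have "\<exists>\<theta> a. fm_in L \<theta> \<and> range a \<subseteq> D \<and>
    (\<forall>p\<in>D. \<forall>s\<in>D. \<exists>x\<in>D. sat M (prepend [p, x, s] a) \<theta>) \<and>
    (\<forall>p\<in>D. \<forall>s\<in>D. \<forall>x\<in>D. \<forall>m. sat M (prepend [p, x, s] a) \<theta> \<longrightarrow> holds m x p s)"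
  proof (cases "\<exists>k\<in>D. k \<notin> range num \<and> V k")
    case True
    then obtain k where k: "k \<in> D" "k \<notin> range num" "V k" by blast
    \<comment> \<open>\<open>R\<close> takes \<open>p\<close>, \<open>x\<close>, \<open>s\<close> in
      this order, so below the quantifier they are \<open>Var 1\<close>, \<open>Var 2\<close>,
      \<open>Var 3\<close>; \<open>Var 4\<close> is the nonstandard parameter
      \<open>k\<close>.\<close>
    let ?\<theta> = "Forall (Imp (less_fm 0 4) (S_at 0 2 1 3))" and ?a = "\<lambda>_::nat. k"
    have a: "range ?a \<subseteq> D" using k by auto
    have sat: "sat M (prepend [p, x, s] ?a) ?\<theta> \<longleftrightarrow> (\<forall>i\<in>D. below i k \<longrightarrow> S i x p s)"
      if "p \<in> D" "x \<in> D" "s \<in> D" for p x s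
    proof -
      have "range (prepend [i, p, x, s] ?a) \<subseteq> D" if "i \<in> D" for i
        by (rule range_prepend) (use \<open>p \<in> D\<close> \<open>x \<in> D\<close> \<open>s \<in> D\<close> a that in auto)
      then show ?thesis by (simp add: case_nat_prepend sat_S_at prepend_def)
    qed
    have below_k: "below (num m) k" for m
      using above_num[OF k(1,2)] by (simp add: below_def)
    show ?thesis
    proof (intro exI[of _ ?\<theta>] exI[of _ ?a] conjI ballI allI impI)
      show "fm_in L ?\<theta>" by (simp add: fm_in_S_at)
      show "range ?a \<subseteq> D" by (rule a)
    next
      fix p s assume ps: "p \<in> D" "s \<in> D"
      then obtain y where "y \<in> D" "\<forall>i\<in>D. below i k \<longrightarrow> S i y p s" using k(3) unfolding V_def by blast
      then show "\<exists>x\<in>D. sat M (prepend [p, x, s] ?a) ?\<theta>" using sat[OF ps(1) _ ps(2)] by blast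
    next
      fix p s x m assume D: "p \<in> D" "s \<in> D" "x \<in> D" and "sat M (prepend [p, x, s] ?a) ?\<theta>"
      then have "S (num m) x p s" using sat[OF D(1,3,2)] below_k by simp
      then show "holds m x p s" using S_num D by blast
    qed
  next
    case False
    \<comment> \<open>Here \<open>V\<close> holds of the standard numbers only, so relativizing to
      \<open>V_fm\<close> quantifies over exactly the indices about which \<open>S_num\<close>
      speaks.\<close>
    then have V: "V k \<longleftrightarrow> k \<in> range num" if "k \<in> D" for k using V_num that by blast
    let ?\<theta> = "Forall (Imp V_fm (S_at 0 2 1 3))" and ?a = "\<lambda>_::nat. \<zero>"
    have a: "range ?a \<subseteq> D" by auto
    have sat: "sat M (prepend [p, x, s] ?a) ?\<theta> \<longleftrightarrow> (\<forall>m. holds m x p s)"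
      if "p \<in> D" "x \<in> D" "s \<in> D" for p x s
    proof -
      have "range (prepend [i, p, x, s] ?a) \<subseteq> D" if "i \<in> D" for i
        by (rule range_prepend) (use \<open>p \<in> D\<close> \<open>x \<in> D\<close> \<open>s \<in> D\<close> that in auto)
      then have "sat M (prepend [p, x, s] ?a) ?\<theta> \<longleftrightarrow> (\<forall>i\<in>D. V i \<longrightarrow> S i x p s)"
        using a by (simp add: case_nat_prepend sat_V_fm sat_S_at prepend_def)
      also have "\<dots> \<longleftrightarrow> (\<forall>m. S (num m) x p s)" using V num_closed by blast
      finally show ?thesis using S_num that by simp
    qed
    have "\<exists>x\<in>D. \<forall>m. holds m x p s" if ps: "p \<in> D" "s \<in> D" for p s
    proof -
      let ?b = "prepend [p, s] (\<lambda>_. \<zero>)"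
      have b: "range ?b \<subseteq> D" by (rule range_prepend) (use ps in auto)
      have psi: "sat (reduct LPA M) (case_nat x ?b) (psi m) \<longleftrightarrow> holds m x p s" for x m
        by (simp add: sat_reduct[OF fm_in_psi] case_nat_prepend sat_psi)
      have "\<exists>x\<in>D. \<forall>\<phi>\<in>\<Delta>. sat (reduct LPA M) (case_nat x ?b) \<phi>" if \<Delta>: "finite \<Delta>" "\<Delta> \<subseteq> range psi" for \<Delta>
      proof -
        obtain A where A: "finite A" "\<Delta> = psi ` A" using finite_subset_image[OF \<Delta>] by blast
        then show ?thesis using psi_satisfiable[OF A(1) ps] psi by auto
      qed
      note fin = this
      have "\<exists>x\<in>Dom (reduct LPA M). \<forall>\<phi>\<in>range psi. sat (reduct LPA M) (case_nat x ?b) \<phi>"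
      proof (rule recursively_saturatedD[OF assms _ _ recursive_psi, of _ 2])
        show "fm_in LPA \<phi> \<and> fv \<phi> \<subseteq> {..2}" if "\<phi> \<in> range psi" for \<phi> :: "('f, 'r) fm"
          using that fm_in_psi fv_psi by auto
      qed (use b fin in simp_all)
      then show ?thesis using psi by auto
    qed
    note solution = this
    show ?thesis
    proof (intro exI[of _ ?\<theta>] exI[of _ ?a] conjI ballI allI impI)
      show "fm_in L ?\<theta>" by (simp add: fm_in_S_at fm_in_V_fm)
      show "range ?a \<subseteq> D" by (rule a)
    next
      fix p s assume ps: "p \<in> D" "s \<in> D"
      from solution[OF this] show "\<exists>x\<in>D. sat M (prepend [p, x, s] ?a) ?\<theta>" using sat[OF ps(1) _ ps(2)] by blast
    next
      fix p s x m assume D: "p \<in> D" "s \<in> D" "x \<in> D" and "sat M (prepend [p, x, s] ?a) ?\<theta>"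
      then show "holds m x p s" using sat[OF D(1,3,2)] by blast
    qed
  qed
  then obtain \<theta> a where \<theta>: "fm_in L \<theta>" "range a \<subseteq> D"
    and NE: "\<forall>p\<in>D. \<forall>s\<in>D. \<exists>x\<in>D. sat M (prepend [p, x, s] a) \<theta>"
    and OP: "\<forall>p\<in>D. \<forall>s\<in>D. \<forall>x\<in>D. \<forall>m. sat M (prepend [p, x, s] a) \<theta> \<longrightarrow> holds m x p s"
    by (elim exE conjE)
  have "sat M a (subst_R \<theta> 0 \<Phi>)" if "\<Phi> \<in> RSAT" for \<Phi>
    unfolding sat_expandR_RSAT[OF that]
  proof (rule RSAT_expandR[OF \<theta>(2) _ _ that])
    show "\<exists>x\<in>D. sat M (prepend [p, x, s] a) \<theta>" if "p \<in> D" "s \<in> D" for p s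
      using NE[rule_format, OF that] .
    show "holds m x p s" if "p \<in> D" "s \<in> D" "x \<in> D" "sat M (prepend [p, x, s] a) \<theta>" for p s x m
      using OP[rule_format, OF that] .
  qed
  with \<theta> show ?thesis by blast
qed

end

theorem theorem66:
  fixes L :: "('f, 'r) lang" and U :: "('f, 'r) fm set"
  assumes "countable_lang L" and "theory_in L U" and "PA \<subseteq> U"
  shows "imposes_recursive_saturation TYPE('m) L U \<longleftrightarrow>
         semantically_defines TYPE('m) L U RSAT"
proof
  assume sem: "semantically_defines TYPE('m) L U RSAT"
  show "imposes_recursive_saturation TYPE('m) L U"
    unfolding imposes_recursive_saturation_def
  proof (intro allI impI)
    fix M :: "('f, 'r, 'm) struc" assume M: "models L M U"
    from sem[unfolded semantically_defines_def, rule_format, OF this] obtain \<theta> a where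
      a: "range a \<subseteq> Dom M" and \<theta>: "\<forall>\<Phi>\<in>RSAT. sat M a (subst_R \<theta> 0 \<Phi>)"
      by (elim exE conjE)
    show "recursively_saturated (reduct LPA M)"
    proof (rule RSAT_imp_recursively_saturated[OF a])
      show "Dom M \<noteq> {}" using M unfolding models_def structure_for_def by blast
      show "sat (expandR M \<theta> a) a \<Phi>" if "\<Phi> \<in> RSAT" for \<Phi>
        using \<theta> that sat_expandR_RSAT[OF that] by blast
    qed
  qed
next
  assume imp: "imposes_recursive_saturation TYPE('m) L U"
  show "semantically_defines TYPE('m) L U RSAT"
    unfolding semantically_defines_def
  proof (intro allI impI)
    fix M :: "('f, 'r, 'm) struc" assume M: "models L M U"
    interpret pa M by (rule models_pa[OF M assms(3)])
    have "structure_for L M" using M by (simp add: models_def)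
    \<comment> \<open>The carrier of \<open>N\<close> lies in the same type as that of
      \<open>M\<close>, so the hypothesis on \<open>U\<close> applies as soon as \<open>N\<close> is
      a model of \<open>U\<close>.\<close>
    moreover have "recursively_saturated (reduct LPA N)"
      if N: "structure_for L N" and equiv: "\<And>\<phi> e. fm_in L \<phi> \<Longrightarrow> (\<And>e. range e \<subseteq> Dom M \<Longrightarrow> sat M e \<phi>) \<Longrightarrow>
        range e \<subseteq> Dom N \<Longrightarrow> sat N e \<phi>" for N :: "('f, 'r, 'm) struc"
    proof -
      \<comment> \<open>The transfer covers formulas of \<open>L\<close>; \<open>theory_in\<close>
        puts the axioms of \<open>U\<close> among them.\<close>
      have "sat N e \<phi>" if "\<phi> \<in> U" "range e \<subseteq> Dom N" for \<phi> e
        using assms(2) M that by (intro equiv) (auto simp: theory_in_def models_def)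
      then have "models L N U" using N by (simp add: models_def)
      then show ?thesis using imp unfolding imposes_recursive_saturation_def by blast
    qed
    ultimately obtain \<chi> j where "fm_in L \<chi>" "cofinal {e 0 | e. range e \<subseteq> Dom M \<and> sat M e \<chi>}"
      "\<forall>m. \<exists>d\<in>Dom M. \<forall>e. range e \<subseteq> Dom M \<and> sat M e \<chi> \<and> divs d (e 0) \<longrightarrow>
         sat M (case_nat (e j) (\<lambda>_. e 0)) (Q m)"
      using isolating_formula[OF assms(1)] by blast
    then interpret isolated M L \<chi> j by unfold_locales blast+
    show "\<exists>\<theta> a. fm_in L \<theta> \<and> range a \<subseteq> Dom M \<and> (\<forall>\<Phi>\<in>RSAT. sat M a (subst_R \<theta> 0 \<Phi>))"
      using definable_RSAT imp M unfolding imposes_recursive_saturation_def by blast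
  qed
qed

end
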